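(* Let $(\mathbf u,\mathbf W)$ be a minimizer for $J$ in $\mathcal F(\Omega)$, suppose that $f_1$ and $g_1$ are bounded, and that there are $\lambda>0$ and $\varepsilon>0$ such that the following nondegeneracy condition holds: for each measurable set $A\subset W_1$ with $0<|A|\le\varepsilon$, there are disjoint subsets $A_j\subset A$, $2\le j\le N$, such that $$F(W_1\setminus A,W_2\cup A_2,\dots,W_N\cup A_N)\le F(\mathbf W)-\lambda|A|.$$ Let $x\in\mathbb R^n$ and $r>0$ be such that $\mathbf u$ is continuous on $B(x,r)$, $r\le\min(1,\varepsilon^{1/n})$, and $B(x,r/2)$ meets the boundary of $\Omega_1=\{y\in\Omega: u_1(y)>0\}$. Suppose also that for some $C_0>0$, at least one of the following holds: (a) $u_1$ is $C_0$-Lipschitz on $B(x,r)$; (b) $|B(x,r)\setminus\Omega_1|\ge C_0^{-1}r^n$. Then, with $u_{1,+}=\max(0,u_1)$, $$\frac1{|B(x,r)|}\int_{B(x,r)}|\nabla u_{1,+}|^2\ge c_3,$$ where the constant $c_3>0$ depends only on $n$, $\lambda$, $\|f_1\|_\infty$, $\|g_1\|_\infty$, and $C_0$.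
   Context: $n\ge2$ and $N\ge1$ are integers; $|A|$ is the Lebesgue measure of $A$; $B(x,r)$ is the open ball; $\Omega\subset\mathbb R^n$ is a Borel set with $|\Omega|<+\infty$. $W^{1,2}(\mathbb R^n)$ denotes the set of functions in $L^2_{loc}(\mathbb R^n)$ whose distributional gradient lies in $L^2(\mathbb R^n)$. $\mathcal W(\Omega)$ is the set of $N$-tuples $\mathbf W=(W_1,\dots,W_N)$ of pairwise disjoint Borel subsets of $\Omega$. $\mathcal F(\Omega)$ is the set of pairs $(\mathbf u,\mathbf W)$ with $\mathbf W\in\mathcal W(\Omega)$ and $\mathbf u=(u_1,\dots,u_N)$ an $N$-tuple of real-valued functions $u_i\in W^{1,2}(\mathbb R^n)$ such that $u_i(x)=0$ for almost every $x\in\mathbb R^n\setminus W_i$. Given measurable functions $f_i,g_i$ on $\Omega$ (such that the integrals below converge) and $F:\mathcal W(\Omega)\to\mathbb R$, $$J(\mathbf u,\mathbf W)=\sum_{i=1}^N\int|\nabla u_i|^2\,dx+\sum_{i=1}^N\int[u_i^2f_i-u_ig_i]\,dx+F(W_1,\dots,W_N).$$ A minimizer for $J$ in $\mathcal F(\Omega)$ is a pair $(\mathbf u,\mathbf W)\in\mathcal F(\Omega)$ such that $J(\mathbf u,\mathbf W)\le J(\mathbf u^*,\mathbf W^* )$ for all $(\mathbf u^*,\mathbf W^* )\in\mathcal F(\Omega)$.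
   Formalization: The boundary point of Ω_1 in B(x,r/2) is also required to satisfy u_1=0; without this the claim fails when Ω lacks a null set (e.g. a ball minus its centre), and it is automatic when u_1 vanishes everywhere on B(x,r) outside Ω. *)

theory Defs
  imports "HOL-Analysis.Analysis" "HOL-Probability.Essential_Supremum"
begin

primrec C_k :: "nat \<Rightarrow> ('a::euclidean_space \<Rightarrow> real) \<Rightarrow> bool" where
  "C_k 0 \<phi> \<longleftrightarrow> continuous_on UNIV \<phi>"
| "C_k (Suc k) \<phi> \<longleftrightarrow>
     (\<exists>G. (\<forall>x. GDERIV \<phi> x :> G x) \<and> (\<forall>b\<in>Basis. C_k k (\<lambda>x. G x \<bullet> b)))"

definition test_function :: "('a::euclidean_space \<Rightarrow> real) \<Rightarrow> bool" where
  "test_function \<phi> \<longleftrightarrow> (\<forall>k. C_k k \<phi>) \<and> compact (closure {x. \<phi> x \<noteq> 0})"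

definition locally_integrable ::
    "('a::euclidean_space \<Rightarrow> 'b::{banach, second_countable_topology}) \<Rightarrow> bool" where
  "locally_integrable u \<longleftrightarrow> (\<forall>K. compact K \<longrightarrow> set_integrable lebesgue K u)"

definition has_weak_gradient :: "('a::euclidean_space \<Rightarrow> real) \<Rightarrow> ('a \<Rightarrow> 'a) \<Rightarrow> bool" where
  "has_weak_gradient u v \<longleftrightarrow> locally_integrable u \<and> locally_integrable v \<and>
     (\<forall>\<phi> G. test_function \<phi> \<and> (\<forall>x. GDERIV \<phi> x :> G x) \<longrightarrow>
        (\<forall>b\<in>Basis. (LINT x|lebesgue. u x * (G x \<bullet> b)) = - (LINT x|lebesgue. (v x \<bullet> b) * \<phi> x)))"

text \<open>A weak gradient is unique up to null sets, so integrals do not depend on the choice.\<close>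

definition weak_grad :: "('a::euclidean_space \<Rightarrow> real) \<Rightarrow> 'a \<Rightarrow> 'a" where
  "weak_grad u = (SOME v. has_weak_gradient u v)"

text \<open>Only the gradient is globally square integrable; \<open>u\<close> itself is only locally so.\<close>

definition W12 :: "('a::euclidean_space \<Rightarrow> real) set" where
  "W12 = {u. u \<in> borel_measurable lebesgue \<and>
             (\<forall>K. compact K \<longrightarrow> set_integrable lebesgue K (\<lambda>x. (u x)\<^sup>2)) \<and>
             (\<exists>v. has_weak_gradient u v \<and> integrable lebesgue (\<lambda>x. (norm (v x))\<^sup>2))}"

text \<open>\<open>N\<close>-tuples of sets are extensional functions on \<open>{1..N}\<close>, so that a functional of such a
  tuple depends on its \<open>N\<close> entries only.\<close>

definition partitions :: "nat \<Rightarrow> 'a::euclidean_space set \<Rightarrow> (nat \<Rightarrow> 'a set) set" where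
  "partitions N \<Omega> =
     {W \<in> {1..N} \<rightarrow>\<^sub>E sets borel. (\<forall>i\<in>{1..N}. W i \<subseteq> \<Omega>) \<and> disjoint_family_on W {1..N}}"

definition admissible ::
    "nat \<Rightarrow> 'a::euclidean_space set \<Rightarrow> ((nat \<Rightarrow> 'a \<Rightarrow> real) \<times> (nat \<Rightarrow> 'a set)) set" where
  "admissible N \<Omega> =
     {(u, W). W \<in> partitions N \<Omega> \<and>
        (\<forall>i\<in>{1..N}. u i \<in> W12 \<and> (AE x in lebesgue. x \<notin> W i \<longrightarrow> u i x = 0))}"

definition lower_order_converges ::
    "nat \<Rightarrow> 'a::euclidean_space set \<Rightarrow> (nat \<Rightarrow> 'a \<Rightarrow> real) \<Rightarrow> (nat \<Rightarrow> 'a \<Rightarrow> real) \<Rightarrow> bool" where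
  "lower_order_converges N \<Omega> f g \<longleftrightarrow>
     (\<forall>(u, W)\<in>admissible N \<Omega>. \<forall>i\<in>{1..N}.
        set_integrable lebesgue \<Omega> (\<lambda>x. (u i x)\<^sup>2 * f i x - u i x * g i x))"

definition J_functional ::
    "nat \<Rightarrow> 'a::euclidean_space set \<Rightarrow> (nat \<Rightarrow> 'a \<Rightarrow> real) \<Rightarrow> (nat \<Rightarrow> 'a \<Rightarrow> real) \<Rightarrow>
     ((nat \<Rightarrow> 'a set) \<Rightarrow> real) \<Rightarrow> (nat \<Rightarrow> 'a \<Rightarrow> real) \<Rightarrow> (nat \<Rightarrow> 'a set) \<Rightarrow> real" where
  "J_functional N \<Omega> f g F u W =
     (\<Sum>i=1..N. LINT x|lebesgue. (norm (weak_grad (u i) x))\<^sup>2) +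
     (\<Sum>i=1..N. LINT x:\<Omega>|lebesgue. (u i x)\<^sup>2 * f i x - u i x * g i x) + F W"

definition is_minimizer ::
    "nat \<Rightarrow> 'a::euclidean_space set \<Rightarrow> (nat \<Rightarrow> 'a \<Rightarrow> real) \<Rightarrow> (nat \<Rightarrow> 'a \<Rightarrow> real) \<Rightarrow>
     ((nat \<Rightarrow> 'a set) \<Rightarrow> real) \<Rightarrow> (nat \<Rightarrow> 'a \<Rightarrow> real) \<Rightarrow> (nat \<Rightarrow> 'a set) \<Rightarrow> bool" where
  "is_minimizer N \<Omega> f g F u W \<longleftrightarrow> (u, W) \<in> admissible N \<Omega> \<and>
     (\<forall>(u', W')\<in>admissible N \<Omega>. J_functional N \<Omega> f g F u W \<le> J_functional N \<Omega> f g F u' W')"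

text \<open>\<open>A\<close> and the \<open>A' j\<close> must be Borel, since \<open>F\<close> is defined on tuples of Borel sets.\<close>

definition nondegenerate ::
    "nat \<Rightarrow> ((nat \<Rightarrow> 'a::euclidean_space set) \<Rightarrow> real) \<Rightarrow> (nat \<Rightarrow> 'a set) \<Rightarrow> real \<Rightarrow> real \<Rightarrow> bool" where
  "nondegenerate N F W lam eps \<longleftrightarrow>
     (\<forall>A\<in>sets borel. A \<subseteq> W 1 \<and> 0 < measure lebesgue A \<and> measure lebesgue A \<le> eps \<longrightarrow>
        (\<exists>A'. (\<forall>j\<in>{2..N}. A' j \<in> sets borel \<and> A' j \<subseteq> A) \<and> disjoint_family_on A' {2..N} \<and>
           F (\<lambda>i\<in>{1..N}. if i = 1 then W 1 - A else W i \<union> A' i)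
             \<le> F W - lam * measure lebesgue A))"

text \<open>With values in \<^typ>\<open>ennreal\<close>, the essential supremum over a null set is 0.\<close>

definition Linf_norm :: "'a::euclidean_space set \<Rightarrow> ('a \<Rightarrow> real) \<Rightarrow> real" where
  "Linf_norm \<Omega> h = enn2real (esssup (lebesgue_on \<Omega>) (\<lambda>x. ennreal \<bar>h x\<bar>))"

text \<open>Admissible functions vanish only almost everywhere off \<open>\<Omega>\<close>. If \<open>\<Omega>\<close> lacks a null set, then
  \<open>frontier (pos_set \<Omega> v)\<close> may contain points where the continuous function \<open>v\<close> is positive
  (e.g. a ball without its centre). Those are not free boundary points, and the theorem fails
  there; its boundary hypothesis therefore asks for a frontier point that is a zero of \<open>v\<close>,
  which is automatic in the ball of continuity when \<open>v\<close> is zero everywhere on the part of that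
  ball outside \<open>\<Omega>\<close>.\<close>

definition pos_set :: "'a set \<Rightarrow> ('a \<Rightarrow> real) \<Rightarrow> 'a set" where
  "pos_set \<Omega> v = {y\<in>\<Omega>. 0 < v y}"

end

theory Submission
  imports Defs
begin

text \<open>
Let \<open>u\<close> be the first component of the minimizer and let \<open>y\<close> be a zero of \<open>u\<close> on the frontier of its
positivity set, with \<open>y\<close> in the half ball. The proof first shows that \<open>u\<close> cannot be small in mean
square near \<open>y\<close>, and then that a function which is not small in mean square, but is small on a
substantial set, has a substantial gradient.

Nondegeneracy in mean square. Remove from the first region the set \<open>A\<close> of the points of a ball
around \<open>y\<close> where \<open>u\<close> is positive, and replace \<open>u\<close> by \<open>u - \<psi>\<^sup>2 u\<^sub>+\<close>, where the cutoff function \<open>\<psi>\<close> is \<open>1\<close>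
on that ball. The functional of the regions drops by \<open>lam |A|\<close>, so minimality yields a Caccioppoli
inequality (\<open>Caccioppoli_nondegenerate\<close>): the energy of \<open>u\<^sub>+\<close> in the ball, and also the volume of its
support there, are controlled by the mean square of \<open>u\<^sub>+\<close> in a slightly larger ball. In the other
direction, the Faber-Krahn inequality (\<open>Faber_Krahn_ball\<close>) controls the mean square of \<open>u\<^sub>+\<close> by its
energy, with a factor that tends to \<open>0\<close> with the volume of the support. Used alternately on balls
of radii between \<open>r/2\<close> and \<open>r/4\<close>, the two inequalities improve superlinearly
(\<open>De_Giorgi_iteration\<close>). If the mean square of \<open>u\<^sub>+\<close> in \<open>ball y (r/2)\<close> were below a certain multiple
of \<open>r\<^sup>2\<close>, then \<open>u\<^sub>+\<close> would vanish almost everywhere in \<open>ball y (r/4)\<close>, although \<open>u\<close> is continuous and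
takes positive values arbitrarily close to \<open>y\<close>. This is \<open>L2_nondegeneracy\<close>. Since \<open>r\<close> is at most \<open>1\<close>, the
terms with \<open>f\<close> and \<open>g\<close> are at most of the order of the others.

Passage to the gradient. Under (b) the function \<open>u\<^sub>+\<close> vanishes on a fixed proportion of the ball,
under (a) it is at most \<open>C0 \<delta> r\<close> on the ball of radius \<open>\<delta> r\<close> around \<open>y\<close>. In both cases a Poincare
inequality (\<open>Poincare_zero_set\<close>, \<open>Poincare_small_ball\<close>) bounds the mean square of \<open>u\<^sub>+\<close> by its energy, up
to an error that is small with \<open>\<delta>\<close>.

Both Poincare inequalities and the Faber-Krahn inequality are instances of \<open>Poincare_ball\<close>. Its
proof compares the value at \<open>p\<close> with the values at the points \<open>p + h\<close> where the function is small, and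
uses that on a convex set the mean square of \<open>w (p + h) - w p\<close> is at most \<open>|h|\<^sup>2\<close> times the energy.

Analysis of weak gradients. Everything rests on the identity
\<open>u (x + h) - u x = (integral over t in {0..1} of the derivative of u in direction h at x + t h)\<close>, valid
for almost every \<open>x\<close> (\<open>weak_deriv_segment\<close>). It is proved by duality against test functions.
It gives the mean square bound on differences, and the convergence
of difference quotients in \<open>L\<^sup>1\<close>, from which the formula for the weak gradient of the positive part
follows (\<open>weak_deriv_pos_part\<close>). The duality arguments end with \<open>fundamental_lemma\<close>.
\<close>

section \<open>Smooth functions\<close>

lemma C_k_SucE:
  assumes "C_k (Suc k) f"
  obtains G where "\<And>x. GDERIV f x :> G x" "\<And>b. b \<in> Basis \<Longrightarrow> C_k k (\<lambda>x. G x \<bullet> b)"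
  using assms unfolding C_k.simps by blast

lemma C_k_SucI:
  assumes "\<And>x. GDERIV f x :> G x" "\<And>b. b \<in> Basis \<Longrightarrow> C_k k (\<lambda>x. G x \<bullet> b)"
  shows "C_k (Suc k) f"
  using assms unfolding C_k.simps by blast

(* The rules above replace this equation, whose nested existential quantifiers mislead automation. *)
declare C_k.simps(2) [simp del]

lemma C_k_continuous:
  assumes "C_k k f"
  shows "continuous_on UNIV f"
proof (cases k)
  case (Suc j)
  show ?thesis
  proof (rule C_k_SucE[OF assms[unfolded Suc]])
    fix G assume "\<And>x. GDERIV f x :> G x"
    then show ?thesis
      unfolding gderiv_def by (rule has_derivative_continuous_on)
  qed
qed (use assms in simp)

lemma C_k_SucD: "C_k (Suc k) f \<Longrightarrow> C_k k f"
proof (induction k arbitrary: f)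
  case 0
  then show ?case using C_k_continuous[of "Suc 0"] by simp
next
  case (Suc k)
  obtain G where G: "\<And>x. GDERIV f x :> G x" "\<And>b. b \<in> Basis \<Longrightarrow> C_k (Suc k) (\<lambda>x. G x \<bullet> b)"
    by (rule C_k_SucE[OF Suc.prems]) blast
  have "C_k k (\<lambda>x. G x \<bullet> b)" if "b \<in> Basis" for b
    using Suc.IH G(2) that by blast
  then show ?case using G(1) by (intro C_k_SucI)
qed

lemma C_k_const: "C_k k (\<lambda>x. c)"
proof (induction k arbitrary: c)
  case (Suc k)
  show ?case by (rule C_k_SucI[where G = "\<lambda>x. 0"]) (auto simp del: C_k.simps simp: GDERIV_const Suc)
qed simp

lemma C_k_inner: "C_k k (\<lambda>x. x \<bullet> a)"
proof (cases k)
  case (Suc j)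
  have "GDERIV (\<lambda>x. x \<bullet> a) x :> a" for x
    unfolding gderiv_def by (auto intro!: derivative_eq_intros)
  then show ?thesis unfolding Suc
    by (intro C_k_SucI[where G = "\<lambda>x. a"]) (auto simp del: C_k.simps simp: C_k_const)
qed (auto intro!: continuous_intros)

lemma C_k_add: "C_k k f \<Longrightarrow> C_k k g \<Longrightarrow> C_k k (\<lambda>x. f x + g x)"
proof (induction k arbitrary: f g)
  case 0
  then show ?case by (auto intro!: continuous_intros)
next
  case (Suc k)
  obtain F G where *:
    "\<And>x. GDERIV f x :> F x" "\<And>b. b \<in> Basis \<Longrightarrow> C_k k (\<lambda>x. F x \<bullet> b)"
    "\<And>x. GDERIV g x :> G x" "\<And>b. b \<in> Basis \<Longrightarrow> C_k k (\<lambda>x. G x \<bullet> b)"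
    by (rule C_k_SucE[OF Suc.prems(1)], rule C_k_SucE[OF Suc.prems(2)]) blast
  then show ?case
    using * by (intro C_k_SucI[where G = "\<lambda>x. F x + G x"]) (auto simp del: C_k.simps simp: inner_add_left Suc.IH intro!: GDERIV_add)
qed

lemma C_k_mult: "C_k k f \<Longrightarrow> C_k k g \<Longrightarrow> C_k k (\<lambda>x. f x * g x)"
proof (induction k arbitrary: f g)
  case 0
  then show ?case by (auto intro!: continuous_intros)
next
  case (Suc k)
  obtain F G where *:
    "\<And>x. GDERIV f x :> F x" "\<And>b. b \<in> Basis \<Longrightarrow> C_k k (\<lambda>x. F x \<bullet> b)"
    "\<And>x. GDERIV g x :> G x" "\<And>b. b \<in> Basis \<Longrightarrow> C_k k (\<lambda>x. G x \<bullet> b)"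
    by (rule C_k_SucE[OF Suc.prems(1)], rule C_k_SucE[OF Suc.prems(2)]) blast
  have fg: "C_k k f" "C_k k g" using Suc.prems[THEN C_k_SucD] by auto
  show ?case
  proof (rule C_k_SucI[where G = "\<lambda>x. f x *\<^sub>R G x + g x *\<^sub>R F x"])
    show "GDERIV (\<lambda>x. f x * g x) x :> f x *\<^sub>R G x + g x *\<^sub>R F x" for x
      using * by (auto intro!: GDERIV_mult)
    show "C_k k (\<lambda>x. (f x *\<^sub>R G x + g x *\<^sub>R F x) \<bullet> b)" if "b \<in> Basis" for b
      unfolding inner_add_left inner_scaleR_left
      by (intro C_k_add Suc.IH fg * that)
  qed
qed

lemma C_k_sum: "(\<And>i. i \<in> I \<Longrightarrow> C_k k (f i)) \<Longrightarrow> C_k k (\<lambda>x. \<Sum>i\<in>I. f i x)"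
  by (induction I rule: infinite_finite_induct) (auto simp: C_k_const C_k_add)

lemma C_k_prod: "(\<And>i. i \<in> I \<Longrightarrow> C_k k (f i)) \<Longrightarrow> C_k k (\<lambda>x. \<Prod>i\<in>I. f i x)"
  by (induction I rule: infinite_finite_induct) (auto simp: C_k_const C_k_mult)

lemma GDERIV_real_iff: "GDERIV g (t::real) :> d \<longleftrightarrow> DERIV g t :> d"
proof -
  have "(\<lambda>h. h \<bullet> d) = (*) d" by (auto simp: mult.commute)
  then show ?thesis by (simp add: gderiv_def has_field_derivative_def)
qed

text \<open>
The outer function is one-dimensional, so the chain rule produces a single product, and the
induction closes with \<open>C_k_mult\<close>.
\<close>
lemma C_k_compose:
  fixes g :: "real \<Rightarrow> real"
  shows "C_k k g \<Longrightarrow> C_k k f \<Longrightarrow> C_k k (\<lambda>x. g (f x))"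
proof (induction k arbitrary: f g)
  case 0
  then show ?case using continuous_on_compose2[of UNIV g UNIV f] by auto
next
  case (Suc k)
  obtain F G where *:
    "\<And>x. GDERIV f x :> F x" "\<And>b. b \<in> Basis \<Longrightarrow> C_k k (\<lambda>x. F x \<bullet> b)"
    "\<And>x. GDERIV g x :> G x" "\<And>b. b \<in> Basis \<Longrightarrow> C_k k (\<lambda>x. G x \<bullet> b)"
    by (rule C_k_SucE[OF Suc.prems(1)], rule C_k_SucE[OF Suc.prems(2)]) blast
  have f: "C_k k f" by (rule C_k_SucD) (rule Suc.prems)
  have G: "C_k k G" using *(4)[of 1] by simp
  show ?case
  proof (rule C_k_SucI[where G = "\<lambda>x. G (f x) *\<^sub>R F x"])
    show "GDERIV (\<lambda>x. g (f x)) x :> G (f x) *\<^sub>R F x" for x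
      using *(1,3) unfolding GDERIV_real_iff by (intro GDERIV_DERIV_compose)
    show "C_k k (\<lambda>x. (G (f x) *\<^sub>R F x) \<bullet> b)" if "b \<in> Basis" for b
      unfolding inner_scaleR_left by (rule C_k_mult[OF Suc.IH[OF G f] *(2)[OF that]])
  qed
qed

lemma C_k_shift: "C_k k f \<Longrightarrow> C_k k (\<lambda>x. f (x + a))"
proof (induction k arbitrary: f)
  case 0
  then show ?case by (auto intro!: continuous_on_compose2[of UNIV f] continuous_intros)
next
  case (Suc k)
  obtain F where *:
    "\<And>x. GDERIV f x :> F x" "\<And>b. b \<in> Basis \<Longrightarrow> C_k k (\<lambda>x. F x \<bullet> b)"
    by (rule C_k_SucE[OF Suc.prems]) blast
  have "GDERIV (\<lambda>x. f (x + a)) x :> F (x + a)" for x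
  proof -
    have "((\<lambda>x. x + a) has_derivative (\<lambda>h. h)) (at x)"
      by (auto intro!: derivative_eq_intros)
    from has_derivative_compose[OF this *(1)[unfolded gderiv_def]] show ?thesis
      unfolding gderiv_def .
  qed
  then show ?case using *(2)
    by (intro C_k_SucI[where G = "\<lambda>x. F (x + a)"]) (auto intro: Suc.IH)
qed

text \<open>
\<open>flat 0\<close> is the classical smooth function that vanishes exactly on the nonpositive half line. The extra powers make the family closed under differentiation.
\<close>
definition flat :: "nat \<Rightarrow> real \<Rightarrow> real" where
  "flat m t = (if 0 < t then (1 / t) ^ m * exp (- (1 / t)) else 0)"

text \<open>
At \<open>0\<close> the difference quotient tends to \<open>0\<close> because the exponential beats every power.
\<close>
lemma DERIV_flat: "DERIV (flat m) t :> flat (m + 2) t - real m * flat (m + 1) t"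
proof -
  consider "t > 0" | "t < 0" | "t = 0" by linarith
  then show ?thesis
  proof cases
    case 1
    have pw: "(1 / t) ^ (m + 2) * exp (- (1 / t)) - real m * ((1 / t) ^ (m + 1) * exp (- (1 / t)))
        = (real m * (1 / t) ^ (m - 1) * (- 1 / t\<^sup>2)) * exp (- (1 / t))
          + (1 / t) ^ m * (exp (- (1 / t)) * (1 / t\<^sup>2))"
      using 1 by (cases m) (auto simp: field_simps power2_eq_square)
    have "DERIV (\<lambda>t. (1 / t) ^ m * exp (- (1 / t))) t :>
        (1 / t) ^ (m + 2) * exp (- (1 / t)) - real m * ((1 / t) ^ (m + 1) * exp (- (1 / t)))"
      unfolding pw using 1
      by (auto intro!: derivative_eq_intros simp: power2_eq_square) (simp add: field_simps)?
    moreover have "\<forall>\<^sub>F s in nhds t. flat m s = (1 / s) ^ m * exp (- (1 / s))"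
      using eventually_nhds_in_open[of "{0<..}" t] 1 by (auto elim!: eventually_mono simp: flat_def)
    ultimately show ?thesis
      using 1 by (subst DERIV_cong_ev[OF refl _ refl]) (auto simp: flat_def)
  next
    case 2
    have "\<forall>\<^sub>F s in nhds t. flat m s = 0"
      using eventually_nhds_in_open[of "{..<0}" t] 2 by (auto elim!: eventually_mono simp: flat_def)
    then show ?thesis
      using 2 by (subst DERIV_cong_ev[OF refl _ refl]) (auto simp: flat_def)
  next
    case 3
    have "((\<lambda>s::real. s ^ (m + 1) / exp s) \<longlongrightarrow> 0) at_top"
      by (rule tendsto_power_div_exp_0)
    then have "((\<lambda>s. (inverse s) ^ (m + 1) / exp (inverse s)) \<longlongrightarrow> 0) (at_right (0::real))"
      using filterlim_compose[OF _ filterlim_inverse_at_top_right] by fast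
    then have "((\<lambda>s. flat m s / s) \<longlongrightarrow> 0) (at_right 0)"
      by (rule Lim_transform_eventually)
        (auto simp: eventually_at_filter flat_def field_simps exp_minus)
    moreover have "((\<lambda>s. flat m s / s) \<longlongrightarrow> 0) (at_left 0)"
      by (rule Lim_transform_eventually[OF tendsto_const])
        (auto simp: eventually_at_filter flat_def)
    ultimately have "((\<lambda>s. flat m s / s) \<longlongrightarrow> 0) (at 0)"
      by (simp add: filterlim_split_at)
    then show ?thesis
      using 3 by (simp add: DERIV_def flat_def)
  qed
qed

lemma C_k_flat: "C_k k (flat m)"
proof (induction k arbitrary: m)
  case 0
  show ?case unfolding C_k.simps
    using DERIV_flat[of m] by (intro continuous_at_imp_continuous_on ballI) (rule DERIV_isCont)
next
  case (Suc k)
  have "C_k k (\<lambda>t. flat (m + 2) t + (- real m) * flat (m + 1) t)"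
    by (intro C_k_add C_k_mult C_k_const Suc)
  then show ?case
    using DERIV_flat[of m]
    by (intro C_k_SucI[where G = "\<lambda>t. flat (m + 2) t - real m * flat (m + 1) t"])
       (auto simp del: C_k.simps simp: GDERIV_real_iff)
qed

section \<open>Test functions and the fundamental lemma of the calculus of variations\<close>

lemma test_functionI:
  assumes "\<And>k. C_k k \<phi>" "\<And>x. R < norm x \<Longrightarrow> \<phi> x = 0"
  shows "test_function \<phi>"
proof -
  have "bounded {x. \<phi> x \<noteq> 0}"
    using assms(2) by (meson bounded_iff linorder_not_less mem_Collect_eq)
  then show ?thesis using assms(1) by (simp add: test_function_def)
qed

lemma test_function_support:
  assumes "test_function \<phi>"
  obtains R where "0 < R" "\<And>x. R < norm x \<Longrightarrow> \<phi> x = 0"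
proof -
  have "bounded {x. \<phi> x \<noteq> 0}"
    using assms by (simp add: test_function_def)
  then obtain B where "B > 0" "\<And>x. \<phi> x \<noteq> 0 \<Longrightarrow> norm x \<le> B"
    by (auto simp: bounded_pos)
  then show ?thesis using that[of B] by force
qed

lemma test_function_continuous: "test_function \<phi> \<Longrightarrow> continuous_on UNIV \<phi>"
  using C_k_continuous unfolding test_function_def by blast

lemma GDERIV_unique:
  assumes "GDERIV f x :> a" "GDERIV f x :> b"
  shows "a = b"
proof -
  have "(\<lambda>h. h \<bullet> a) = (\<lambda>h. h \<bullet> b)"
    using assms has_derivative_unique unfolding gderiv_def by blast
  then show ?thesis by (metis inner_commute vector_eq_rdot)
qed

lemma test_function_GDERIV:
  assumes "test_function \<phi>"
  obtains G where "\<And>x. GDERIV \<phi> x :> G x"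
  by (rule C_k_SucE[of 0 \<phi>]) (use assms in \<open>auto simp: test_function_def simp del: C_k.simps\<close>)

lemma test_function_gradient:
  fixes \<phi> :: "'a::euclidean_space \<Rightarrow> real"
  assumes \<phi>: "test_function \<phi>" and G: "\<And>x. GDERIV \<phi> x :> G x"
    and R: "\<And>x. R < norm x \<Longrightarrow> \<phi> x = 0"
  shows "continuous_on UNIV G" "\<And>x. R < norm x \<Longrightarrow> G x = 0"
    "\<And>b. b \<in> Basis \<Longrightarrow> test_function (\<lambda>x. G x \<bullet> b)"
proof -
  have ck: "C_k k (\<lambda>x. G x \<bullet> b)" if "b \<in> Basis" for k b
  proof -
    have "C_k (Suc k) \<phi>" using \<phi> by (simp add: test_function_def)
    then obtain H where H: "\<And>x. GDERIV \<phi> x :> H x" "\<And>b. b \<in> Basis \<Longrightarrow> C_k k (\<lambda>x. H x \<bullet> b)"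
      by (rule C_k_SucE) blast
    have "H = G" using GDERIV_unique[OF H(1) G] by auto
    then show ?thesis using H(2) that by auto
  qed
  then show "continuous_on UNIV G"
    using C_k_continuous continuous_on_componentwise[of UNIV G] by blast
  show 0: "G x = 0" if "R < norm x" for x
  proof (rule GDERIV_unique)
    show "GDERIV \<phi> x :> G x" by (rule G)
    have "((\<lambda>x. 0) has_derivative (\<lambda>h. h \<bullet> 0)) (at x)" by simp
    moreover have "open {x::'a. R < norm x}" by (intro open_Collect_less continuous_intros)
    moreover have "x \<in> {x. R < norm x}" using that by simp
    ultimately show "GDERIV \<phi> x :> 0"
      unfolding gderiv_def by (rule has_derivative_transform_within_open) (use R in auto)
  qed
  show "test_function (\<lambda>x. G x \<bullet> b)" if "b \<in> Basis" for b
    by (rule test_functionI[where R = R]) (use ck that 0 in auto)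
qed

lemma bounded_of_compact_support:
  fixes f :: "'a::euclidean_space \<Rightarrow> 'b::real_normed_vector"
  assumes "continuous_on UNIV f" "\<And>x. R < norm x \<Longrightarrow> f x = 0"
  obtains M where "0 < M" "\<And>x. norm (f x) \<le> M"
proof -
  have "bounded (f ` cball 0 R)"
    by (intro compact_imp_bounded compact_continuous_image continuous_on_subset[OF assms(1)]) auto
  then obtain M where M: "M > 0" "\<And>x. x \<in> cball 0 R \<Longrightarrow> norm (f x) \<le> M"
    by (auto simp: bounded_pos)
  have "norm (f x) \<le> M" for x
    using M assms(2)[of x] by (cases "R < norm x") auto
  then show ?thesis using M that by blast
qed

lemma test_function_shift:
  assumes "test_function \<phi>"
  shows "test_function (\<lambda>x. \<phi> (x + a))"
proof -
  obtain R where R: "\<And>x. R < norm x \<Longrightarrow> \<phi> x = 0" using test_function_support[OF assms] by metis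
  show ?thesis
  proof (rule test_functionI)
    show "C_k k (\<lambda>x. \<phi> (x + a))" for k
      using assms by (intro C_k_shift) (auto simp: test_function_def)
    show "\<phi> (x + a) = 0" if "R + norm a < norm x" for x
      using that norm_triangle_ineq2[of x "-a"] by (intro R) auto
  qed
qed

lemma test_function_smooth_mult:
  assumes "test_function \<phi>" "\<And>k. C_k k \<psi>"
  shows "test_function (\<lambda>x. \<psi> x * \<phi> x)"
proof -
  obtain R where R: "\<And>x. R < norm x \<Longrightarrow> \<phi> x = 0" using test_function_support[OF assms(1)] by metis
  show ?thesis
    by (rule test_functionI[where R = R])
      (use assms R in \<open>auto intro!: C_k_mult simp: test_function_def\<close>)
qed

text \<open>
The scalar counterpart of \<^const>\<open>locally_integrable\<close> for Borel functions and the Borel measure,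
where Fubini's theorem and translations are available. Balls around the origin exhaust the
compact sets.
\<close>
definition loc_int :: "('a::euclidean_space \<Rightarrow> real) \<Rightarrow> bool" where
  "loc_int f \<longleftrightarrow> f \<in> borel_measurable borel \<and>
     (\<forall>R. integrable lborel (\<lambda>x. indicator (cball 0 R) x * f x))"

lemma loc_int_measurable [measurable_dest]: "loc_int f \<Longrightarrow> f \<in> borel_measurable borel"
  by (simp add: loc_int_def)

lemma loc_int_mult_bounded:
  assumes f: "loc_int f" and g: "g \<in> borel_measurable borel"
    and M: "\<And>x. \<bar>g x\<bar> \<le> M" and R: "\<And>x. R < norm x \<Longrightarrow> g x = 0"
  shows "integrable lborel (\<lambda>x. f x * g x)"
proof (rule Bochner_Integration.integrable_bound)
  show "integrable lborel (\<lambda>x. M * (indicator (cball 0 R) x * f x))"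
    using f by (intro integrable_mult_right) (simp add: loc_int_def)
  show "(\<lambda>x. f x * g x) \<in> borel_measurable lborel"
    using f g by (auto simp: loc_int_def)
  have "\<bar>f x\<bar> * \<bar>g x\<bar> \<le> M * \<bar>indicator (cball 0 R) x * f x\<bar>" for x
    using mult_left_mono[OF M[of x], of "\<bar>f x\<bar>"] R[of x] M[of x]
    by (cases "R < norm x") (auto simp: indicator_def mult.commute)
  moreover have "0 \<le> M" using M[of 0] by auto
  ultimately show "AE x in lborel. norm (f x * g x) \<le> norm (M * (indicator (cball 0 R) x * f x))"
    by (auto simp: abs_mult)
qed

lemma loc_int_mult_test:
  assumes "loc_int f" "test_function \<phi>"
  shows "integrable lborel (\<lambda>x. f x * \<phi> x)"
proof -
  obtain R where R: "\<And>x. R < norm x \<Longrightarrow> \<phi> x = 0" using test_function_support[OF assms(2)] by metis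
  obtain M where "\<And>x. norm (\<phi> x) \<le> M"
    using bounded_of_compact_support[OF test_function_continuous[OF assms(2)] R] by metis
  then show ?thesis
    using assms R test_function_continuous[OF assms(2)]
    by (intro loc_int_mult_bounded[where R = R and M = M]) (auto simp: borel_measurable_continuous_onI)
qed

lemma loc_int_linear:
  assumes "loc_int f" "loc_int g"
  shows "loc_int (\<lambda>x. f x + c * g x)"
proof -
  have "integrable lborel (\<lambda>x. indicator (cball 0 R) x * f x + c * (indicator (cball 0 R) x * g x))" for R
    using assms by (intro Bochner_Integration.integrable_add integrable_mult_right) (auto simp: loc_int_def)
  then show ?thesis using assms by (auto simp: loc_int_def algebra_simps)
qed

text \<open>
A product of one-dimensional bumps, one for each coordinate. As \<open>k\<close> grows, the transition layers
inside the box become thin.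
\<close>
definition box_bump :: "'a::euclidean_space \<Rightarrow> 'a \<Rightarrow> nat \<Rightarrow> 'a \<Rightarrow> real" where
  "box_bump a c k x = (\<Prod>b\<in>Basis. flat 0 (real k * (x \<bullet> b - a \<bullet> b)) * flat 0 (real k * (c \<bullet> b - x \<bullet> b)))"

lemma flat_0_bounds: "0 \<le> flat 0 t" "flat 0 t \<le> 1"
  by (auto simp: flat_def)

lemma box_bump_bounds: "0 \<le> box_bump a c k x" "box_bump a c k x \<le> 1"
  unfolding box_bump_def
  by (auto intro!: prod_nonneg prod_le_1 mult_nonneg_nonneg mult_le_one flat_0_bounds)

lemma box_bump_outside: "x \<notin> box a c \<Longrightarrow> box_bump a c k x = 0"
  unfolding box_bump_def
  by (auto simp: mem_box flat_def zero_less_mult_iff intro!: prod_zero)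

lemma test_function_box_bump: "test_function (box_bump a c k)"
proof -
  have "bounded (box a c)" by simp
  then obtain R where R: "\<And>x. x \<in> box a c \<Longrightarrow> norm x \<le> R" unfolding bounded_iff by blast
  have *: "C_k j (\<lambda>x. flat 0 (real k * (x \<bullet> b - a \<bullet> b)))" "C_k j (\<lambda>x. flat 0 (real k * (c \<bullet> b - x \<bullet> b)))"
    for j and b :: 'a
  proof -
    have "C_k j (\<lambda>x::'a. real k * (x \<bullet> b + (- (a \<bullet> b))))" "C_k j (\<lambda>x::'a. real k * (c \<bullet> b + (-1) * (x \<bullet> b)))"
      by (intro C_k_mult C_k_add C_k_const C_k_inner)+
    then show "C_k j (\<lambda>x. flat 0 (real k * (x \<bullet> b - a \<bullet> b)))" "C_k j (\<lambda>x. flat 0 (real k * (c \<bullet> b - x \<bullet> b)))"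
      using C_k_compose[OF C_k_flat] by fastforce+
  qed
  show ?thesis
  proof (rule test_functionI)
    show "C_k j (box_bump a c k)" for j
      unfolding box_bump_def by (rule C_k_prod, rule C_k_mult; rule *)
    show "box_bump a c k x = 0" if "R < norm x" for x
      using that R by (intro box_bump_outside) force
  qed
qed

lemma flat_0_tendsto:
  assumes "0 < t"
  shows "(\<lambda>k. flat 0 (real k * t)) \<longlonglongrightarrow> 1"
proof -
  have "(\<lambda>k. exp (- (1 / t) * (1 / real k))) \<longlonglongrightarrow> exp (- (1 / t) * 0)"
    by (intro tendsto_intros lim_1_over_n)
  moreover have "\<forall>\<^sub>F k in sequentially. exp (- (1 / t) * (1 / real k)) = flat 0 (real k * t)"
    by (rule eventually_mono[OF eventually_gt_at_top[of 0]]) (use assms in \<open>auto simp: flat_def mult.commute\<close>)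
  ultimately show ?thesis using Lim_transform_eventually by fastforce
qed

lemma box_bump_tendsto:
  fixes a c x :: "'a::euclidean_space"
  shows "(\<lambda>k. box_bump a c k x) \<longlonglongrightarrow> indicator (box a c) x"
proof (cases "x \<in> box a c")
  case True
  have "(\<lambda>k. box_bump a c k x) \<longlonglongrightarrow> (\<Prod>b\<in>(Basis::'a set). 1 * 1)"
    unfolding box_bump_def using True
    by (intro tendsto_prod tendsto_mult flat_0_tendsto) (auto simp: mem_box)
  then show ?thesis using True by simp
qed (simp add: box_bump_outside)

lemma loc_int_integrable_box:
  assumes "loc_int f"
  shows "integrable lborel (\<lambda>x. f x * indicator (box a c) x)"
proof -
  have "bounded (box a c)" by simp
  then obtain R where R: "\<And>x. x \<in> box a c \<Longrightarrow> norm x \<le> R" unfolding bounded_iff by blast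
  show ?thesis
    using R by (intro loc_int_mult_bounded[OF assms, where M = 1 and R = R]) (force simp: indicator_def)+
qed

lemma box_integral_zero_of_test:
  assumes f: "loc_int f" and 0: "\<And>\<phi>. test_function \<phi> \<Longrightarrow> (LINT x|lborel. f x * \<phi> x) = 0"
  shows "(LINT x|lborel. f x * indicator (box a c) x) = 0"
proof -
  have [measurable]: "f \<in> borel_measurable borel" using f by measurable
  have [measurable]: "box_bump a c k \<in> borel_measurable borel" for k
    using test_function_continuous[OF test_function_box_bump] by (rule borel_measurable_continuous_onI)
  have "(\<lambda>k. LINT x|lborel. f x * box_bump a c k x) \<longlonglongrightarrow> (LINT x|lborel. f x * indicator (box a c) x)"
  proof (rule integral_dominated_convergence[where w = "\<lambda>x. \<bar>f x * indicator (box a c) x\<bar>"])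
    show "integrable lborel (\<lambda>x. \<bar>f x * indicator (box a c) x\<bar>)"
      using loc_int_integrable_box[OF f] by (rule integrable_abs)
    show "AE x in lborel. (\<lambda>k. f x * box_bump a c k x) \<longlonglongrightarrow> f x * indicator (box a c) x"
      by (auto intro!: tendsto_mult box_bump_tendsto)
    show "AE x in lborel. norm (f x * box_bump a c k x) \<le> \<bar>f x * indicator (box a c) x\<bar>" for k
      using box_bump_bounds[of a c k] box_bump_outside[of _ a c k]
      by (auto simp: indicator_def abs_mult intro!: mult_left_le)
  qed measurable
  then show ?thesis
    unfolding 0[OF test_function_box_bump] LIMSEQ_const_iff by simp
qed

text \<open>
The function integrates to \<open>0\<close> over every box, as a dominated limit of test functions. Hence its
positive and negative parts are densities of measures that agree on boxes, so everywhere.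
\<close>
lemma fundamental_lemma:
  fixes f :: "'a::euclidean_space \<Rightarrow> real"
  assumes f: "loc_int f" and 0: "\<And>\<phi>. test_function \<phi> \<Longrightarrow> (LINT x|lborel. f x * \<phi> x) = 0"
  shows "AE x in lborel. f x = 0"
proof -
  have [measurable]: "f \<in> borel_measurable borel" using f by measurable
  define N1 where "N1 = density lborel (\<lambda>x. ennreal (max 0 (f x)))"
  define N2 where "N2 = density lborel (\<lambda>x. ennreal (max 0 (- f x)))"
  have box: "emeasure N1 (box a c) = emeasure N2 (box a c)" "emeasure N1 (box a c) < \<infinity>" for a c
  proof -
    have i: "integrable lborel (\<lambda>x. max 0 (f x * indicator (box a c) x))"
       "integrable lborel (\<lambda>x. max 0 (- (f x * indicator (box a c) x)))"
      using loc_int_integrable_box[OF f] by auto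
    have e1: "emeasure N1 (box a c) = ennreal (LINT x|lborel. max 0 (f x * indicator (box a c) x))"
      unfolding N1_def
      by (subst emeasure_density, simp, simp, subst nn_integral_eq_integral[symmetric])
         (use i in \<open>auto intro!: nn_integral_cong split: split_indicator\<close>)
    have e2: "emeasure N2 (box a c) = ennreal (LINT x|lborel. max 0 (- (f x * indicator (box a c) x)))"
      unfolding N2_def
      by (subst emeasure_density, simp, simp, subst nn_integral_eq_integral[symmetric])
         (use i in \<open>auto intro!: nn_integral_cong split: split_indicator\<close>)
    have "(LINT x|lborel. max 0 (f x * indicator (box a c) x)) - (LINT x|lborel. max 0 (- (f x * indicator (box a c) x)))
      = (LINT x|lborel. f x * indicator (box a c) x)"
      unfolding Bochner_Integration.integral_diff[OF i, symmetric]
      by (rule Bochner_Integration.integral_cong) (auto simp: max_def)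
    then show "emeasure N1 (box a c) = emeasure N2 (box a c)"
      using box_integral_zero_of_test[OF f 0] e1 e2 by simp
    show "emeasure N1 (box a c) < \<infinity>" using e1 by simp
  qed
  have eq: "N1 = N2"
  proof (rule measure_eqI_generator_eq)
    let ?E = "range (\<lambda>(a, b). box a b::'a set)"
    show "Int_stable ?E"
      by (auto simp: Int_stable_def box_Int_box)
    show "?E \<subseteq> Pow UNIV" "sets N1 = sigma_sets UNIV ?E" "sets N2 = sigma_sets UNIV ?E"
      by (simp_all add: borel_eq_box N1_def N2_def)
    let ?A = "\<lambda>n::nat. box (- (real n *\<^sub>R One)) (real n *\<^sub>R One) :: 'a set"
    show "range ?A \<subseteq> ?E" "(\<Union>i. ?A i) = UNIV"
      unfolding UN_box_eq_UNIV by auto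
    show "emeasure N1 X = emeasure N2 X" if "X \<in> ?E" for X
      using that box(1) by auto
    show "emeasure N1 (?A i) \<noteq> \<infinity>" for i
      using box(2)[of "- (real i *\<^sub>R One)" "real i *\<^sub>R One"] by auto
  qed
  have "emeasure N1 {x. f x > 0} = 0"
    unfolding eq unfolding N2_def
    by (subst emeasure_density) (auto simp: nn_integral_0_iff_AE split: split_indicator)
  then have "AE x in lborel. ennreal (max 0 (f x)) * indicator {x. f x > 0} x = 0"
    unfolding N1_def by (subst (asm) emeasure_density) (simp_all add: nn_integral_0_iff_AE)
  moreover have "emeasure N2 {x. f x < 0} = 0"
    unfolding eq[symmetric] unfolding N1_def
    by (subst emeasure_density) (auto simp: nn_integral_0_iff_AE split: split_indicator)
  then have "AE x in lborel. ennreal (max 0 (- f x)) * indicator {x. f x < 0} x = 0"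
    unfolding N2_def by (subst (asm) emeasure_density) (simp_all add: nn_integral_0_iff_AE)
  ultimately show ?thesis
    by eventually_elim (auto simp: indicator_def max_def ennreal_eq_0_iff split: if_splits)
qed

section \<open>Weak derivatives along segments\<close>

text \<open>
The weak derivative in a fixed direction \<open>h\<close>, for Borel representatives. Treating one direction at
a time keeps the arguments scalar. The direction is an arbitrary vector, so that a difference quotient
with step \<open>t\<close> corresponds to the direction \<open>t h\<close>.
\<close>
definition weak_deriv :: "'a::euclidean_space \<Rightarrow> ('a \<Rightarrow> real) \<Rightarrow> ('a \<Rightarrow> real) \<Rightarrow> bool" where
  "weak_deriv h u w \<longleftrightarrow> loc_int u \<and> loc_int w \<and>
     (\<forall>\<phi> G. test_function \<phi> \<and> (\<forall>x. GDERIV \<phi> x :> G x) \<longrightarrow>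
        (LINT x|lborel. u x * (G x \<bullet> h)) = - (LINT x|lborel. w x * \<phi> x))"

lemma weak_derivD:
  assumes "weak_deriv h u w"
  shows "loc_int u" "loc_int w"
    "\<And>\<phi> G. test_function \<phi> \<Longrightarrow> (\<And>x. GDERIV \<phi> x :> G x) \<Longrightarrow>
       (LINT x|lborel. u x * (G x \<bullet> h)) = - (LINT x|lborel. w x * \<phi> x)"
  using assms by (auto simp: weak_deriv_def)

lemma weak_deriv_scale:
  assumes "weak_deriv h u w"
  shows "weak_deriv (t *\<^sub>R h) u (\<lambda>x. t * w x)"
proof -
  have "loc_int (\<lambda>x. t * w x)"
  proof -
    have "integrable lborel (\<lambda>x. t * (indicator (cball 0 R) x * w x))" for R
      using weak_derivD(2)[OF assms] by (intro integrable_mult_right) (auto simp: loc_int_def)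
    then show ?thesis using weak_derivD(2)[OF assms] by (auto simp: loc_int_def mult_ac)
  qed
  moreover have "(LINT x|lborel. u x * (G x \<bullet> t *\<^sub>R h)) = - (LINT x|lborel. t * w x * \<phi> x)"
    if "test_function \<phi>" "\<And>x. GDERIV \<phi> x :> G x" for \<phi> G
  proof -
    have "(LINT x|lborel. t * (u x * (G x \<bullet> h))) = - (LINT x|lborel. t * (w x * \<phi> x))"
      using weak_derivD(3)[OF assms that] by simp
    then show ?thesis by (simp add: mult_ac)
  qed
  ultimately show ?thesis
    using weak_derivD(1)[OF assms] by (auto simp: weak_deriv_def)
qed

lemma lborel_integral_shift:
  fixes f :: "'a::euclidean_space \<Rightarrow> 'b::{banach, second_countable_topology}"
  assumes "f \<in> borel_measurable borel"
  shows "(LINT x|lborel. f (x + a)) = (LINT x|lborel. f x)"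
  using integral_distr[of "(+) a" lborel borel f] assms
  by (simp add: lborel_distr_plus add.commute)

lemma lborel_nn_integral_shift:
  assumes "f \<in> borel_measurable borel"
  shows "(\<integral>\<^sup>+x. f (x + a) \<partial>lborel) = (\<integral>\<^sup>+x. f x \<partial>lborel)"
  using nn_integral_distr[of "(+) a" lborel borel f] assms
  by (simp add: lborel_distr_plus add.commute)

lemma lborel_integrable_shift:
  fixes f :: "'a::euclidean_space \<Rightarrow> 'b::{banach, second_countable_topology}"
  assumes "integrable lborel f"
  shows "integrable lborel (\<lambda>x. f (x + a))"
  using integrable_distr[of "(+) a" lborel borel f] assms
  by (simp add: lborel_distr_plus add.commute)

lemma loc_int_shift:
  assumes "loc_int f"
  shows "loc_int (\<lambda>x. f (x + a))"
proof -
  have [measurable]: "f \<in> borel_measurable borel" using assms by measurable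
  have "integrable lborel (\<lambda>x. indicator (cball 0 R) x * f (x + a))" for R
  proof -
    have "integrable lborel (\<lambda>x. f x * indicator (cball a R) x)"
    proof (rule loc_int_mult_bounded[OF assms, where M = 1 and R = "R + norm a"])
      show "indicator (cball a R) x = (0::real)" if "R + norm a < norm x" for x
        using that norm_triangle_ineq2[of x a] by (auto simp: indicator_def dist_norm norm_minus_commute)
    qed (auto simp: indicator_def)
    then have "integrable lborel (\<lambda>x. f (x + a) * indicator (cball a R) (x + a))"
      by (rule lborel_integrable_shift)
    then show ?thesis by (simp add: indicator_def dist_norm mult.commute)
  qed
  then show ?thesis by (simp add: loc_int_def)
qed

text \<open>
The interval has finite length, so a uniform bound on the integrals over the slices makes the
function integrable on the product.
\<close>
lemma unit_interval_Fubini: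
  fixes F :: "real \<Rightarrow> 'a::euclidean_space \<Rightarrow> real"
  assumes [measurable]: "case_prod F \<in> borel_measurable (borel \<Otimes>\<^sub>M borel)"
    and int: "\<And>t. t \<in> {0..1} \<Longrightarrow> integrable lborel (F t)"
    and C: "\<And>t. t \<in> {0..1} \<Longrightarrow> (LINT x|lborel. \<bar>F t x\<bar>) \<le> C"
  shows "integrable lborel (\<lambda>x. LINT t|lborel. indicator {0..1} t * F t x)"
    and "(LINT x|lborel. (LINT t|lborel. indicator {0..1} t * F t x))
      = (LINT t|lborel. indicator {0..1} t * (LINT x|lborel. F t x))"
    and "AE x in lborel. integrable lborel (\<lambda>t. indicator {0..1} t * F t x)"
proof -
  have [measurable]: "case_prod F \<in> borel_measurable (lborel \<Otimes>\<^sub>M lborel)"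
    using assms(1) by (simp add: measurable_def space_pair_measure sets_pair_measure)
  have "integrable (lborel \<Otimes>\<^sub>M lborel) (\<lambda>(t, x). indicator {0..1} t * F t x)"
  proof (rule lborel_pair.Fubini_integrable)
    show "integrable lborel (\<lambda>t. LINT x|lborel. norm (case (t, x) of (t, x) \<Rightarrow> indicator {0..1} t * F t x))"
    proof (rule Bochner_Integration.integrable_bound)
      show "integrable lborel (\<lambda>t. C * indicator {0..1::real} t)" by simp
      have "0 \<le> (LINT x|lborel. \<bar>F 0 x\<bar>)" by (rule Bochner_Integration.integral_nonneg) simp
      then have "0 \<le> C" using C[of 0] by (meson atLeastAtMost_iff order.refl order_trans zero_le_one)
      then show "AE t in lborel. norm (LINT x|lborel. norm (case (t, x) of (t, x) \<Rightarrow> indicator {0..1} t * F t x))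
          \<le> norm (C * indicator {0..1} t)"
        using C by (auto simp: indicator_def abs_mult)
    qed measurable
    show "AE t in lborel. integrable lborel (\<lambda>x. case (t, x) of (t, x) \<Rightarrow> indicator {0..1} t * F t x)"
      using int by (auto simp: indicator_def)
  qed measurable
  note * = this
  show "integrable lborel (\<lambda>x. LINT t|lborel. indicator {0..1} t * F t x)"
    using lborel_pair.integrable_snd[OF *] .
  show "(LINT x|lborel. (LINT t|lborel. indicator {0..1} t * F t x))
      = (LINT t|lborel. indicator {0..1} t * (LINT x|lborel. F t x))"
    using lborel_pair.Fubini_integral[OF *] by simp
  show "AE x in lborel. integrable lborel (\<lambda>t. indicator {0..1} t * F t x)"
    using lborel_pair.AE_integrable_snd[OF *] .
qed

definition segment_mean :: "'a::euclidean_space \<Rightarrow> ('a \<Rightarrow> real) \<Rightarrow> 'a \<Rightarrow> real" where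
  "segment_mean h w x = (LINT t|lborel. indicator {0..1} t * w (x + t *\<^sub>R h))"

lemma segment_mean_measurable [measurable]:
  assumes [measurable]: "w \<in> borel_measurable borel"
  shows "segment_mean h w \<in> borel_measurable borel"
  unfolding segment_mean_def by measurable

text \<open>
Translations by \<open>t h\<close> with \<open>t\<close> in the unit interval move the support of \<open>g\<close> within a fixed larger
ball; this gives the uniform bound on the slices.
\<close>
lemma segment_mean_mult:
  fixes w :: "'a::euclidean_space \<Rightarrow> real"
  assumes w: "loc_int w" and g [measurable]: "g \<in> borel_measurable borel"
    and M: "\<And>x. \<bar>g x\<bar> \<le> M" and R: "\<And>x. R < norm x \<Longrightarrow> g x = 0"
  shows "integrable lborel (\<lambda>x. segment_mean h w x * g x)"
    and "(LINT x|lborel. segment_mean h w x * g x)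
      = (LINT t|lborel. indicator {0..1} t * (LINT x|lborel. w (x + t *\<^sub>R h) * g x))"
    and "AE x in lborel. integrable lborel (\<lambda>t. indicator {0..1} t * (w (x + t *\<^sub>R h) * g x))"
proof -
  have [measurable]: "w \<in> borel_measurable borel" using w by measurable
  define C where "C = M * (LINT x|lborel. \<bar>indicator (cball 0 (R + norm h)) x * w x\<bar>)"
  have M0: "0 \<le> M" using M[of 0] by auto
  have i: "integrable lborel (\<lambda>x. w (x + a) * g x)" for a
    by (rule loc_int_mult_bounded[OF loc_int_shift[OF w] g M R])
  have C: "(LINT x|lborel. \<bar>w (x + t *\<^sub>R h) * g x\<bar>) \<le> C" if t: "t \<in> {0..1}" for t
  proof -
    have j: "integrable lborel (\<lambda>x. M * \<bar>indicator (cball 0 (R + norm h)) x * w x\<bar>)"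
      using w by (auto simp: loc_int_def intro!: integrable_mult_right integrable_abs)
    have "(LINT x|lborel. \<bar>w (x + t *\<^sub>R h) * g x\<bar>)
      \<le> (LINT x|lborel. M * \<bar>indicator (cball 0 (R + norm h)) (x + t *\<^sub>R h) * w (x + t *\<^sub>R h)\<bar>)"
    proof (rule integral_mono)
      show "integrable lborel (\<lambda>x. M * \<bar>indicator (cball 0 (R + norm h)) (x + t *\<^sub>R h) * w (x + t *\<^sub>R h)\<bar>)"
        using lborel_integrable_shift[OF j] .
      fix x
      show "\<bar>w (x + t *\<^sub>R h) * g x\<bar> \<le> M * \<bar>indicator (cball 0 (R + norm h)) (x + t *\<^sub>R h) * w (x + t *\<^sub>R h)\<bar>"
      proof (cases "R < norm x")
        case False
        have "norm (t *\<^sub>R h) \<le> norm h" using t by (simp add: mult_left_le_one_le)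
        then have "norm (x + t *\<^sub>R h) \<le> R + norm h"
          using norm_triangle_ineq[of x "t *\<^sub>R h"] False by linarith
        then show ?thesis
          using mult_right_mono[OF M[of x], of "\<bar>w (x + t *\<^sub>R h)\<bar>"] by (simp add: abs_mult mult.commute)
      qed (use R M0 in auto)
    qed (use i in auto)
    also have "\<dots> = (LINT x|lborel. M * \<bar>indicator (cball 0 (R + norm h)) x * w x\<bar>)"
      by (rule lborel_integral_shift[where f = "\<lambda>x. M * \<bar>indicator (cball 0 (R + norm h)) x * w x\<bar>"])
        (intro borel_measurable_times borel_measurable_abs borel_measurable_const
          borel_measurable_indicator, simp_all add: \<open>w \<in> borel_measurable borel\<close>)
    also have "\<dots> = C" by (simp add: C_def)
    finally show ?thesis .
  qed
  have m: "(\<lambda>(t, x). w (x + t *\<^sub>R h) * g x) \<in> borel_measurable (borel \<Otimes>\<^sub>M borel)" by measurable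
  have e: "segment_mean h w x * g x = (LINT t|lborel. indicator {0..1} t * (w (x + t *\<^sub>R h) * g x))" for x
    unfolding segment_mean_def
    by (subst integral_mult_left_zero[symmetric]) (simp add: mult.assoc)
  show "integrable lborel (\<lambda>x. segment_mean h w x * g x)"
    unfolding e by (rule unit_interval_Fubini(1)[OF m i C])
  show "(LINT x|lborel. segment_mean h w x * g x)
      = (LINT t|lborel. indicator {0..1} t * (LINT x|lborel. w (x + t *\<^sub>R h) * g x))"
    unfolding e by (rule unit_interval_Fubini(2)[OF m i C])
  show "AE x in lborel. integrable lborel (\<lambda>t. indicator {0..1} t * (w (x + t *\<^sub>R h) * g x))"
    by (rule unit_interval_Fubini(3)[OF m i C])
qed

lemma loc_int_segment_mean:
  assumes "loc_int w"
  shows "loc_int (segment_mean h w)"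
proof -
  have "integrable lborel (\<lambda>x. segment_mean h w x * indicator (cball 0 R) x)" for R
    by (rule segment_mean_mult(1)[OF assms, where M = 1 and R = R]) (auto simp: indicator_def)
  moreover have "segment_mean h w \<in> borel_measurable borel" using assms by measurable
  ultimately show ?thesis by (simp add: loc_int_def mult.commute)
qed

text \<open>
The fundamental theorem of calculus along the segment from \<open>x - h\<close> to \<open>x\<close>. The backward segment is
what appears when a translation is moved onto a test function.
\<close>
lemma segment_FTC:
  assumes G: "\<And>x. GDERIV \<phi> x :> G x" and c: "continuous_on UNIV G"
  shows "(LINT t|lborel. indicator {0..1} t * (G (x - t *\<^sub>R h) \<bullet> h)) = \<phi> x - \<phi> (x - h)"
proof -
  have d: "((\<lambda>t. - \<phi> (x - t *\<^sub>R h)) has_vector_derivative (G (x - t *\<^sub>R h) \<bullet> h)) (at t within {0..1})" for t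
  proof -
    have "((\<lambda>t. x - t *\<^sub>R h) has_derivative (\<lambda>s. - (s *\<^sub>R h))) (at t within {0..1})"
      by (auto intro!: derivative_eq_intros)
    from has_derivative_compose[OF this G[unfolded gderiv_def]]
    have "((\<lambda>t. - \<phi> (x - t *\<^sub>R h)) has_derivative (\<lambda>s. - (- (s *\<^sub>R h) \<bullet> G (x - t *\<^sub>R h)))) (at t within {0..1})"
      by (rule has_derivative_minus)
    then show ?thesis
      by (simp add: has_vector_derivative_def inner_commute)
  qed
  have "continuous_on {0..1} (\<lambda>t. G (x - t *\<^sub>R h) \<bullet> h)"
    by (intro continuous_intros continuous_on_compose2[OF c]) auto
  from integral_FTC_atLeastAtMost[OF _ d this] show ?thesis by simp
qed

text \<open>
The identity holds for test functions by the fundamental theorem of calculus. Moving translations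
and derivatives between \<open>u\<close> and a test function transfers it to \<open>u\<close>: both sides have the same
integral against every test function, so the fundamental lemma applies.
\<close>
lemma weak_deriv_segment:
  fixes u :: "'a::euclidean_space \<Rightarrow> real"
  assumes uw: "weak_deriv h u w"
  shows "AE x in lborel. u (x + h) - u x = segment_mean h w x"
proof -
  note u = weak_derivD(1)[OF uw] and w = weak_derivD(2)[OF uw]
  have [measurable]: "u \<in> borel_measurable borel" "w \<in> borel_measurable borel" using u w by measurable
  define D where "D x = (u (x + h) + (-1) * u x) + (-1) * segment_mean h w x" for x
  have D: "loc_int D"
    unfolding D_def by (intro loc_int_linear loc_int_shift loc_int_segment_mean u w)
  have "AE x in lborel. D x = 0"
  proof (rule fundamental_lemma[OF D])
    fix \<phi> :: "'a \<Rightarrow> real" assume \<phi>: "test_function \<phi>"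
    obtain G where G: "\<And>x. GDERIV \<phi> x :> G x" by (rule test_function_GDERIV[OF \<phi>]) blast
    obtain R where R: "0 < R" "\<And>x. R < norm x \<Longrightarrow> \<phi> x = 0" by (rule test_function_support[OF \<phi>]) blast
    note Gc = test_function_gradient(1)[OF \<phi> G R(2)]
    have G0: "G x = 0" if "R < norm x" for x
      using test_function_gradient(2)[OF \<phi> G R(2)] that by blast
    have [measurable]: "\<phi> \<in> borel_measurable borel" "G \<in> borel_measurable borel"
      using Gc test_function_continuous[OF \<phi>] by (auto intro: borel_measurable_continuous_onI)
    have ct: "continuous_on UNIV (\<lambda>x. G x \<bullet> h)" using Gc by (intro continuous_intros)
    obtain M where M: "\<And>x. \<bar>G x \<bullet> h\<bar> \<le> M"
      using bounded_of_compact_support[OF ct, of R] G0 by (metis inner_zero_left real_norm_def)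
    obtain M' where M': "\<And>x. \<bar>\<phi> x\<bar> \<le> M'"
      using bounded_of_compact_support[OF test_function_continuous[OF \<phi>], of R] R(2)
      by (metis real_norm_def)
    have iu: "integrable lborel (\<lambda>x. u x * \<phi> (x - h))" "integrable lborel (\<lambda>x. u x * \<phi> x)"
      using test_function_shift[OF \<phi>, of "-h"] loc_int_mult_test[OF u] \<phi> by auto
    have "(LINT x|lborel. u (x + h) * \<phi> x) = (LINT x|lborel. u x * \<phi> (x - h))"
      using lborel_integral_shift[of "\<lambda>x. u x * \<phi> (x - h)" h] by simp
    then have "(LINT x|lborel. u (x + h) * \<phi> x) - (LINT x|lborel. u x * \<phi> x)
      = - (LINT x|lborel. u x * (\<phi> x - \<phi> (x - h)))"
      using iu by (simp add: right_diff_distrib)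
    also have "(LINT x|lborel. u x * (\<phi> x - \<phi> (x - h)))
      = (LINT x|lborel. LINT t|lborel. indicator {0..1} t * (u x * (G (x - t *\<^sub>R h) \<bullet> h)))"
    proof -
      have "u x * (\<phi> x - \<phi> (x - h)) = (LINT t|lborel. indicator {0..1} t * (u x * (G (x - t *\<^sub>R h) \<bullet> h)))" for x
        by (simp add: mult.left_commute[of _ "u x"] segment_FTC[OF G Gc])
      then show ?thesis by simp
    qed
    also have "\<dots> = (LINT t|lborel. indicator {0..1} t * (LINT x|lborel. u x * (G (x - t *\<^sub>R h) \<bullet> h)))"
    proof (rule unit_interval_Fubini(2)[where C = "LINT x|lborel. M * \<bar>indicator (cball 0 (R + norm h)) x * u x\<bar>"])
      show m: "(\<lambda>(t, x). u x * (G (x - t *\<^sub>R h) \<bullet> h)) \<in> borel_measurable (borel \<Otimes>\<^sub>M borel)" by measurable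
      fix t :: real assume t: "t \<in> {0..1}"
      show i: "integrable lborel (\<lambda>x. u x * (G (x - t *\<^sub>R h) \<bullet> h))"
      proof (rule loc_int_mult_bounded[OF u _ M])
        show "G (x - t *\<^sub>R h) \<bullet> h = 0" if "R + norm (t *\<^sub>R h) < norm x" for x
          using that norm_triangle_ineq2[of x "t *\<^sub>R h"] G0[of "x - t *\<^sub>R h"] by auto
      qed measurable
      show "(LINT x|lborel. \<bar>u x * (G (x - t *\<^sub>R h) \<bullet> h)\<bar>)
        \<le> (LINT x|lborel. M * \<bar>indicator (cball 0 (R + norm h)) x * u x\<bar>)"
      proof (rule integral_mono)
        show "integrable lborel (\<lambda>x. M * \<bar>indicator (cball 0 (R + norm h)) x * u x\<bar>)"
          using u by (auto simp: loc_int_def intro!: integrable_mult_right integrable_abs)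
        show "\<bar>u x * (G (x - t *\<^sub>R h) \<bullet> h)\<bar> \<le> M * \<bar>indicator (cball 0 (R + norm h)) x * u x\<bar>" for x
        proof (cases "R < norm (x - t *\<^sub>R h)")
          case True
          moreover have "0 \<le> M" using M[of 0] by auto
          ultimately show ?thesis using G0 by simp
        next
          case False
          have "norm (t *\<^sub>R h) \<le> norm h" using t by (simp add: mult_left_le_one_le)
          then have "norm x \<le> R + norm h"
            using norm_triangle_ineq2[of x "t *\<^sub>R h"] False by linarith
          then show ?thesis
            using mult_right_mono[OF M[of "x - t *\<^sub>R h"], of "\<bar>u x\<bar>"] by (simp add: abs_mult mult.commute)
        qed
      qed (use i in auto)
    qed
    also have "\<dots> = - (LINT t|lborel. indicator {0..1} t * (LINT x|lborel. w (x + t *\<^sub>R h) * \<phi> x))"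
    proof -
      have "(LINT x|lborel. u x * (G (x - t *\<^sub>R h) \<bullet> h)) = - (LINT x|lborel. w (x + t *\<^sub>R h) * \<phi> x)" for t
      proof -
        have "GDERIV (\<lambda>x. \<phi> (x - t *\<^sub>R h)) x :> G (x - t *\<^sub>R h)" for x
        proof -
          have "((\<lambda>x. x - t *\<^sub>R h) has_derivative (\<lambda>h. h)) (at x)"
            by (auto intro!: derivative_eq_intros)
          from has_derivative_compose[OF this G[unfolded gderiv_def]] show ?thesis
            unfolding gderiv_def .
        qed
        then have "(LINT x|lborel. u x * (G (x - t *\<^sub>R h) \<bullet> h)) = - (LINT x|lborel. w x * \<phi> (x - t *\<^sub>R h))"
          using weak_derivD(3)[OF uw, of "\<lambda>x. \<phi> (x - t *\<^sub>R h)"] test_function_shift[OF \<phi>, of "- t *\<^sub>R h"]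
          by simp
        then show ?thesis
          using lborel_integral_shift[of "\<lambda>x. w x * \<phi> (x - t *\<^sub>R h)" "t *\<^sub>R h"] by simp
      qed
      then show ?thesis by simp
    qed
    also have "\<dots> = - (LINT x|lborel. segment_mean h w x * \<phi> x)"
      using segment_mean_mult(2)[OF w _ M' R(2)] by simp
    finally have 1: "(LINT x|lborel. u (x + h) * \<phi> x) - (LINT x|lborel. u x * \<phi> x)
      = (LINT x|lborel. segment_mean h w x * \<phi> x)" by simp
    have "integrable lborel (\<lambda>x. u (x + h) * \<phi> x)" "integrable lborel (\<lambda>x. segment_mean h w x * \<phi> x)"
      by (intro loc_int_mult_test[OF _ \<phi>] loc_int_shift loc_int_segment_mean u w)+
    then show "(LINT x|lborel. D x * \<phi> x) = 0"
      unfolding D_def using 1 iu(2) by (simp add: ring_distribs)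
  qed
  then show ?thesis by eventually_elim (simp add: D_def)
qed

section \<open>Difference quotients\<close>

text \<open>
Continuity at \<open>0\<close> of translation in the \<open>L\<^sup>1\<close> norm, along sequences.
\<close>
definition L1_continuous :: "('a::euclidean_space \<Rightarrow> real) \<Rightarrow> bool" where
  "L1_continuous f \<longleftrightarrow> (\<forall>h. h \<longlonglongrightarrow> 0 \<longrightarrow> (\<lambda>k::nat. LINT x|lborel. \<bar>f (x + h k) - f x\<bar>) \<longlonglongrightarrow> 0)"

text \<open>
Translation is an isometry, so the property passes to \<open>L\<^sup>1\<close> limits by the three-epsilon argument.
\<close>
lemma L1_continuous_approx:
  fixes f :: "'a::euclidean_space \<Rightarrow> real"
  assumes f: "integrable lborel f"
    and appr: "\<And>e. 0 < e \<Longrightarrow> \<exists>g. integrable lborel g \<and> L1_continuous g \<and> (LINT x|lborel. \<bar>f x - g x\<bar>) < e"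
  shows "L1_continuous f"
  unfolding L1_continuous_def
proof (intro allI impI LIMSEQ_I)
  fix h :: "nat \<Rightarrow> 'a" and e :: real assume h: "h \<longlonglongrightarrow> 0" and e: "0 < e"
  obtain g where g: "integrable lborel g" "L1_continuous g" "(LINT x|lborel. \<bar>f x - g x\<bar>) < e / 3"
    using appr[of "e / 3"] e by auto
  obtain N where N: "\<And>k. k \<ge> N \<Longrightarrow> (LINT x|lborel. \<bar>g (x + h k) - g x\<bar>) < e / 3"
    using LIMSEQ_D[OF g(2)[unfolded L1_continuous_def, rule_format, OF h], of "e / 3"] e
    by (auto simp: integral_nonneg)
  have "(LINT x|lborel. \<bar>f (x + h k) - f x\<bar>) < e" if k: "k \<ge> N" for k
  proof -
    note i = f g(1) lborel_integrable_shift[OF f, of "h k"] lborel_integrable_shift[OF g(1), of "h k"]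
    have [measurable]: "f \<in> borel_measurable borel" "g \<in> borel_measurable borel" using f g(1) by auto
    have "(LINT x|lborel. \<bar>f (x + h k) - f x\<bar>)
      \<le> (LINT x|lborel. \<bar>f (x + h k) - g (x + h k)\<bar> + \<bar>g (x + h k) - g x\<bar> + \<bar>f x - g x\<bar>)"
      by (rule integral_mono) (use i in auto)
    also have "\<dots> = (LINT x|lborel. \<bar>f (x + h k) - g (x + h k)\<bar>) + (LINT x|lborel. \<bar>g (x + h k) - g x\<bar>)
       + (LINT x|lborel. \<bar>f x - g x\<bar>)"
      using i by simp
    also have "(LINT x|lborel. \<bar>f (x + h k) - g (x + h k)\<bar>) = (LINT x|lborel. \<bar>f x - g x\<bar>)"
      by (rule lborel_integral_shift[where f = "\<lambda>x. \<bar>f x - g x\<bar>"]) simp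
    finally show ?thesis using N[OF k] g(3) by linarith
  qed
  then show "\<exists>N. \<forall>k\<ge>N. norm ((LINT x|lborel. \<bar>f (x + h k) - f x\<bar>) - 0) < e"
    by (intro exI[of _ N]) (auto simp: integral_nonneg)
qed

text \<open>
A set and its translate have the same volume, so the symmetric difference is controlled by the
intersection. If \<open>x\<close> lies in an open set, so do its small translates, and dominated
convergence applies.
\<close>
lemma L1_continuous_indicator_open:
  fixes U :: "'a::euclidean_space set"
  assumes U: "open U" "emeasure lborel U < \<infinity>"
  shows "L1_continuous (indicator U :: 'a \<Rightarrow> real)"
  unfolding L1_continuous_def
proof (intro allI impI)
  fix h :: "nat \<Rightarrow> 'a" assume h: "h \<longlonglongrightarrow> 0"
  have [measurable]: "U \<in> sets borel" using U by simp
  have i: "integrable lborel (indicator U :: 'a \<Rightarrow> real)" using U by simp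
  note ish = lborel_integrable_shift[OF i]
  have ip: "integrable lborel (\<lambda>x. indicator U x * indicator U (x + h k) :: real)" for k
    by (rule Bochner_Integration.integrable_bound[OF i]) (auto simp: indicator_def)
  have "(\<lambda>k. LINT x|lborel. indicator U x * indicator U (x + h k) :: real) \<longlonglongrightarrow> (LINT x|lborel. indicator U x)"
  proof (rule integral_dominated_convergence[where w = "indicator U"])
    show "AE x in lborel. (\<lambda>k. indicator U x * indicator U (x + h k) :: real) \<longlonglongrightarrow> indicator U x"
    proof (intro AE_I2)
      fix x show "(\<lambda>k. indicator U x * indicator U (x + h k) :: real) \<longlonglongrightarrow> indicator U x"
      proof (cases "x \<in> U")
        case True
        have "(\<lambda>k. x + h k) \<longlonglongrightarrow> x + 0" by (intro tendsto_intros h)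
        then have "\<forall>\<^sub>F k in sequentially. x + h k \<in> U"
          using topological_tendstoD[of "\<lambda>k. x + h k" x sequentially U] U(1) True by simp
        then have "\<forall>\<^sub>F k in sequentially. indicator U x * indicator U (x + h k) = (1::real)"
          by eventually_elim (use True in auto)
        then show ?thesis using True by (simp add: tendsto_eventually)
      qed simp
    qed
  qed (use i in \<open>auto simp: indicator_def\<close>)
  then have "(\<lambda>k. (LINT x|lborel. indicator U x) + (LINT x|lborel. indicator U x)
      - 2 * (LINT x|lborel. indicator U x * indicator U (x + h k) :: real))
    \<longlonglongrightarrow> (LINT x|lborel. indicator U x) + (LINT x|lborel. indicator U x) - 2 * (LINT x|lborel. indicator U x)"
    by (intro tendsto_intros)
  moreover have "(LINT x|lborel. \<bar>indicator U (x + h k) - indicator U x\<bar>)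
     = (LINT x|lborel. indicator U x) + (LINT x|lborel. indicator U x)
      - 2 * (LINT x|lborel. indicator U x * indicator U (x + h k) :: real)" for k
  proof -
    have "(LINT x|lborel. \<bar>indicator U (x + h k) - indicator U x\<bar>)
      = (LINT x|lborel. indicator U (x + h k) + indicator U x - 2 * (indicator U x * indicator U (x + h k)) :: real)"
      by (rule Bochner_Integration.integral_cong) (auto simp: indicator_def)
    also have "\<dots> = (LINT x|lborel. indicator U (x + h k)) + (LINT x|lborel. indicator U x)
      - 2 * (LINT x|lborel. indicator U x * indicator U (x + h k) :: real)"
      using i ish[of "h k"] ip[of k] by simp
    also have "(LINT x|lborel. indicator U (x + h k) :: real) = (LINT x|lborel. indicator U x)"
      by (rule lborel_integral_shift) simp
    finally show ?thesis .
  qed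
  ultimately show "(\<lambda>k. LINT x|lborel. \<bar>indicator U (x + h k) - indicator U x\<bar> :: real) \<longlonglongrightarrow> 0"
    by simp
qed

lemma L1_continuous_scale:
  assumes "L1_continuous f"
  shows "L1_continuous (\<lambda>x. f x * c)"
  unfolding L1_continuous_def
proof (intro allI impI)
  fix h :: "nat \<Rightarrow> 'a" assume "h \<longlonglongrightarrow> 0"
  then have "(\<lambda>k. \<bar>c\<bar> * (LINT x|lborel. \<bar>f (x + h k) - f x\<bar>)) \<longlonglongrightarrow> \<bar>c\<bar> * 0"
    using assms unfolding L1_continuous_def by (intro tendsto_intros) blast
  moreover have "\<bar>f (x + h k) * c - f x * c\<bar> = \<bar>c\<bar> * \<bar>f (x + h k) - f x\<bar>" for k x
    by (metis abs_mult left_diff_distrib mult.commute)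
  ultimately show "(\<lambda>k. LINT x|lborel. \<bar>f (x + h k) * c - f x * c\<bar>) \<longlonglongrightarrow> 0" by simp
qed

text \<open>
Outer regularity reduces indicators of measurable sets to those of open sets.
\<close>
lemma L1_continuous_integrable:
  fixes f :: "'a::euclidean_space \<Rightarrow> real"
  assumes "integrable lborel f"
  shows "L1_continuous f"
  using assms
proof (induction rule: integrable_induct)
  case (base A c)
  then have A [measurable]: "A \<in> sets borel" and fin: "emeasure lborel A < \<infinity>" by auto
  have "L1_continuous (indicator A :: 'a \<Rightarrow> real)"
  proof (rule L1_continuous_approx)
    show "integrable lborel (indicator A :: 'a \<Rightarrow> real)" using fin by simp
    fix e :: real assume e: "0 < e"
    obtain U where U: "open U" "A \<subseteq> U" "emeasure lborel (U - A) < ennreal e"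
      using outer_regular_lborel[OF A e] by blast
    have [measurable]: "U \<in> sets borel" using U by simp
    have "emeasure lborel U = emeasure lborel A + emeasure lborel (U - A)"
      using U(2) by (subst plus_emeasure) (auto intro: arg_cong[where f = "emeasure lborel"])
    then have finU: "emeasure lborel U < \<infinity>"
      using fin U(3) by (auto simp: ennreal_add_less_top less_top[symmetric] intro: order_less_trans)
    have "(LINT x|lborel. \<bar>indicator A x - indicator U x :: real\<bar>) = (LINT x|lborel. indicator (U - A) x)"
      using U(2) by (intro Bochner_Integration.integral_cong) (auto simp: indicator_def)
    also have "\<dots> < e" 
    proof -
      have "emeasure lborel (U - A) \<noteq> top" using U(3) by auto
      then have "ennreal (measure lborel (U - A)) < ennreal e"
        using U(3) emeasure_eq_ennreal_measure by metis
      then show ?thesis by (simp add: ennreal_less_iff)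
    qed
    finally show "\<exists>g. integrable lborel g \<and> L1_continuous g \<and> (LINT x|lborel. \<bar>indicator A x - g x\<bar>) < e"
      using L1_continuous_indicator_open[OF U(1) finU] finU
      by (intro exI[of _ "indicator U"]) auto
  qed
  then show ?case using L1_continuous_scale by simp
next
  case (add f g)
  show ?case unfolding L1_continuous_def
  proof (intro allI impI)
    fix h :: "nat \<Rightarrow> 'a" assume h: "h \<longlonglongrightarrow> 0"
    note i = add(1,2) lborel_integrable_shift[OF add(1)] lborel_integrable_shift[OF add(2)]
    have lim: "(\<lambda>k. (LINT x|lborel. \<bar>f (x + h k) - f x\<bar>) + (LINT x|lborel. \<bar>g (x + h k) - g x\<bar>)) \<longlonglongrightarrow> 0 + 0"
      using add(3,4) h unfolding L1_continuous_def by (intro tendsto_add) blast+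
    show "(\<lambda>k. LINT x|lborel. \<bar>f (x + h k) + g (x + h k) - (f x + g x)\<bar>) \<longlonglongrightarrow> 0"
    proof (rule tendsto_sandwich[OF _ _ tendsto_const lim[simplified]])
      show "\<forall>\<^sub>F k in sequentially. (LINT x|lborel. \<bar>f (x + h k) + g (x + h k) - (f x + g x)\<bar>)
          \<le> (LINT x|lborel. \<bar>f (x + h k) - f x\<bar>) + (LINT x|lborel. \<bar>g (x + h k) - g x\<bar>)"
      proof (intro always_eventually allI)
        fix k
        have "(LINT x|lborel. \<bar>f (x + h k) + g (x + h k) - (f x + g x)\<bar>)
          \<le> (LINT x|lborel. \<bar>f (x + h k) - f x\<bar> + \<bar>g (x + h k) - g x\<bar>)"
          by (rule integral_mono) (use i in auto)
        then show "(LINT x|lborel. \<bar>f (x + h k) + g (x + h k) - (f x + g x)\<bar>)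
          \<le> (LINT x|lborel. \<bar>f (x + h k) - f x\<bar>) + (LINT x|lborel. \<bar>g (x + h k) - g x\<bar>)"
          using i by simp
      qed
    qed (auto simp: integral_nonneg)
  qed
next
  case (lim f s)
  have m [measurable]: "f \<in> borel_measurable borel" "\<And>i. s i \<in> borel_measurable borel" using lim by auto
  have "(\<lambda>i. LINT x|lborel. \<bar>f x - s i x\<bar>) \<longlonglongrightarrow> (LINT x|(lborel::'a measure). (0::real))"
  proof (rule integral_dominated_convergence[where w = "\<lambda>x. 3 * \<bar>f x\<bar>"])
    show "AE x in lborel. (\<lambda>i. \<bar>f x - s i x\<bar>) \<longlonglongrightarrow> 0"
    proof (intro AE_I2)
      fix x
      have "(\<lambda>i. \<bar>f x - s i x\<bar>) \<longlonglongrightarrow> \<bar>f x - f x\<bar>" by (intro tendsto_intros lim) simp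
      then show "(\<lambda>i. \<bar>f x - s i x\<bar>) \<longlonglongrightarrow> 0" by simp
    qed
    show "AE x in lborel. norm \<bar>f x - s i x\<bar> \<le> 3 * \<bar>f x\<bar>" for i
    proof (intro AE_I2)
      fix x show "norm \<bar>f x - s i x\<bar> \<le> 3 * \<bar>f x\<bar>"
        using lim(3)[of x i] abs_triangle_ineq4[of "f x" "s i x"] by simp
    qed
  qed (use lim in auto)
  then have to0: "(\<lambda>i. LINT x|lborel. \<bar>f x - s i x\<bar>) \<longlonglongrightarrow> 0" by simp
  show ?case
  proof (rule L1_continuous_approx)
    fix e :: real assume "0 < e"
    then obtain i where "(LINT x|lborel. \<bar>f x - s i x\<bar>) < e"
      using order_tendstoD(2)[OF to0] eventually_happens by fastforce
    then show "\<exists>g. integrable lborel g \<and> L1_continuous g \<and> (LINT x|lborel. \<bar>f x - g x\<bar>) < e"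
      using lim by (intro exI[of _ "s i"]) auto
  qed (use lim in auto)
qed

text \<open>
The mean over a short segment differs from the function by an average of translation errors, each
of which is small in \<open>L\<^sup>1\<close>.
\<close>
lemma segment_mean_L1:
  fixes W :: "'a::euclidean_space \<Rightarrow> real"
  assumes W: "integrable lborel W" and h: "h \<longlonglongrightarrow> (0::'a)"
  shows "integrable lborel (\<lambda>x. \<bar>segment_mean (h k) W x - W x\<bar>)"
    and "(\<lambda>k. LINT x|lborel. \<bar>segment_mean (h k) W x - W x\<bar>) \<longlonglongrightarrow> 0"
proof -
  have [measurable]: "W \<in> borel_measurable borel" using W by auto
  define C where "C = (LINT x|lborel. \<bar>W x\<bar>)"
  define \<omega> where "\<omega> a = (LINT x|lborel. \<bar>W (x + a) - W x\<bar>)" for a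
  note iW = lborel_integrable_shift[OF W]
  have iD: "integrable lborel (\<lambda>x. \<bar>W (x + a) - W x\<bar>)" for a using W iW by auto
  have \<omega>0: "0 \<le> \<omega> a" for a unfolding \<omega>_def by (rule Bochner_Integration.integral_nonneg) simp
  have eqC: "(LINT x|lborel. \<bar>W (x + a)\<bar>) = C" for a
    unfolding C_def by (rule lborel_integral_shift[where f = "\<lambda>x. \<bar>W x\<bar>"]) simp
  have \<omega>C: "\<omega> a \<le> 2 * C" for a
  proof -
    have "\<omega> a \<le> (LINT x|lborel. \<bar>W (x + a)\<bar> + \<bar>W x\<bar>)"
      unfolding \<omega>_def by (rule integral_mono) (use W iW in auto)
    also have "\<dots> = 2 * C" using W iW eqC by (simp add: C_def)
    finally show ?thesis .
  qed
  have m1: "(\<lambda>(t, x). \<bar>W (x + t *\<^sub>R a) - W x\<bar>) \<in> borel_measurable (borel \<Otimes>\<^sub>M borel)" for a by measurable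
  have m2: "(\<lambda>(t, x). W (x + t *\<^sub>R a)) \<in> borel_measurable (borel \<Otimes>\<^sub>M borel)" for a by measurable
  have F1i: "integrable lborel (\<lambda>x. LINT t|lborel. indicator {0..1} t * \<bar>W (x + t *\<^sub>R a) - W x\<bar>)" for a
    by (rule unit_interval_Fubini(1)[where C = "2 * C", OF m1]; (rule iD | simp add: \<omega>C[unfolded \<omega>_def]))
  have F1e: "(LINT x|lborel. LINT t|lborel. indicator {0..1} t * \<bar>W (x + t *\<^sub>R a) - W x\<bar>)
      = (LINT t|lborel. indicator {0..1} t * (LINT x|lborel. \<bar>W (x + t *\<^sub>R a) - W x\<bar>))" for a
    by (rule unit_interval_Fubini(2)[where C = "2 * C", OF m1]; (rule iD | simp add: \<omega>C[unfolded \<omega>_def]))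
  have F2: "AE x in lborel. integrable lborel (\<lambda>t. indicator {0..1} t * W (x + t *\<^sub>R a))" for a
    by (rule unit_interval_Fubini(3)[where C = C, OF m2]; (rule iW | simp add: eqC))
  have le: "AE x in lborel. \<bar>segment_mean a W x - W x\<bar>
      \<le> (LINT t|lborel. indicator {0..1} t * \<bar>W (x + t *\<^sub>R a) - W x\<bar>)" for a
    using F2[of a]
  proof eventually_elim
    case (elim x)
    have i1: "integrable lborel (\<lambda>t::real. indicator {0..1} t * W x)" by simp
    have "segment_mean a W x - W x = (LINT t|lborel. indicator {0..1} t * (W (x + t *\<^sub>R a) - W x))"
      using elim i1 by (simp add: segment_mean_def right_diff_distrib)
    also have "\<bar>\<dots>\<bar> \<le> (LINT t|lborel. \<bar>indicator {0..1} t * (W (x + t *\<^sub>R a) - W x)\<bar>)"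
      by (rule integral_abs_bound)
    finally show ?case by (simp add: abs_mult)
  qed
  have isg: "integrable lborel (\<lambda>x. \<bar>segment_mean a W x - W x\<bar>)" for a
    by (rule Bochner_Integration.integrable_bound[OF F1i[of a]]) (use le in \<open>auto intro: order_trans\<close>)
  then show "integrable lborel (\<lambda>x. \<bar>segment_mean (h k) W x - W x\<bar>)" .
  have upper: "(LINT x|lborel. \<bar>segment_mean a W x - W x\<bar>)
      \<le> (LINT t|lborel. indicator {0..1} t * \<omega> (t *\<^sub>R a))" for a
    unfolding \<omega>_def F1e[symmetric] by (rule integral_mono_AE[OF isg F1i le])
  have lim: "(\<lambda>k. LINT t|lborel. indicator {0..1::real} t * \<omega> (t *\<^sub>R h k)) \<longlonglongrightarrow> (LINT t|(lborel::real measure). (0::real))"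
  proof (rule integral_dominated_convergence[where w = "\<lambda>t. 2 * C * indicator {0..1} t"])
    show "AE t in lborel. (\<lambda>k. indicator {0..1::real} t * \<omega> (t *\<^sub>R h k)) \<longlonglongrightarrow> 0"
    proof (intro AE_I2)
      fix t :: real
      have "(\<lambda>k. t *\<^sub>R h k) \<longlonglongrightarrow> t *\<^sub>R 0" by (intro tendsto_intros h)
      then have "(\<lambda>k. \<omega> (t *\<^sub>R h k)) \<longlonglongrightarrow> 0"
        using L1_continuous_integrable[OF W] unfolding L1_continuous_def \<omega>_def by simp
      then show "(\<lambda>k. indicator {0..1::real} t * \<omega> (t *\<^sub>R h k)) \<longlonglongrightarrow> 0"
        using tendsto_mult_right_zero by blast
    qed
    show "AE t in lborel. norm (indicator {0..1} t * \<omega> (t *\<^sub>R h k)) \<le> 2 * C * indicator {0..1} t" for k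
      using \<omega>0 \<omega>C by (auto simp: indicator_def)
    show "(\<lambda>t. indicator {0..1} t * \<omega> (t *\<^sub>R h k)) \<in> borel_measurable lborel" for k
      unfolding \<omega>_def by measurable
  qed auto
  show "(\<lambda>k. LINT x|lborel. \<bar>segment_mean (h k) W x - W x\<bar>) \<longlonglongrightarrow> 0"
    by (rule tendsto_sandwich[OF _ _ tendsto_const lim[simplified]])
      (use upper in \<open>auto simp: integral_nonneg\<close>)
qed


text \<open>
By \<open>weak_deriv_segment\<close> the difference quotient is the mean of the weak derivative over a segment that
shrinks to the point.
\<close>
lemma difference_quotient_L1:
  fixes u :: "'a::euclidean_space \<Rightarrow> real"
  assumes uw: "weak_deriv h u w" and t: "t \<longlonglongrightarrow> 0" "\<And>k. t k \<noteq> (0::real)"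
  shows "(\<lambda>k. LINT x|lborel. indicator (cball 0 R) x * \<bar>(u (x + t k *\<^sub>R h) - u x) / t k - w x\<bar>) \<longlonglongrightarrow> 0"
proof -
  note u = weak_derivD(1)[OF uw] and w = weak_derivD(2)[OF uw]
  have [measurable]: "u \<in> borel_measurable borel" "w \<in> borel_measurable borel" using u w by measurable
  \<comment> \<open>once the steps are shorter than \<open>1\<close>, only the values of
    \<open>w\<close> in the ball of radius \<open>R + 1\<close> matter\<close>
  define W where "W = (\<lambda>x. indicator (cball 0 (R + 1)) x * w x)"
  have W: "integrable lborel W" using w by (auto simp: W_def loc_int_def)
  have [measurable]: "W \<in> borel_measurable borel" using W by auto
  have th: "(\<lambda>k. t k *\<^sub>R h) \<longlonglongrightarrow> 0" using tendsto_scaleR[OF t(1) tendsto_const, of h] by simp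
  have quot: "AE x in lborel. (u (x + t k *\<^sub>R h) - u x) / t k = segment_mean (t k *\<^sub>R h) w x" for k
    using weak_deriv_segment[OF weak_deriv_scale[OF uw, of "t k"]]
  proof eventually_elim
    case (elim x)
    have "segment_mean (t k *\<^sub>R h) (\<lambda>x. t k * w x) x = t k * segment_mean (t k *\<^sub>R h) w x"
      by (simp add: segment_mean_def mult.left_commute[of _ "t k"])
    then show ?case using elim t(2)[of k] by simp
  qed
  have W_eq: "segment_mean a w x = segment_mean a W x" if "norm a \<le> 1" "norm x \<le> R" for a x
    unfolding segment_mean_def
  proof (rule Bochner_Integration.integral_cong[OF refl])
    fix s :: real
    show "indicator {0..1} s * w (x + s *\<^sub>R a) = indicator {0..1} s * W (x + s *\<^sub>R a)"
    proof (cases "s \<in> {0..1}")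
      case True
      then have "norm (s *\<^sub>R a) \<le> 1" using that(1) by (auto intro: mult_le_one)
      then have "norm (x + s *\<^sub>R a) \<le> R + 1" using norm_triangle_ineq[of x "s *\<^sub>R a"] that(2) by linarith
      then show ?thesis by (simp add: W_def)
    qed simp
  qed
  have ev: "\<forall>\<^sub>F k in sequentially. norm (t k *\<^sub>R h) \<le> 1"
    using order_tendstoD(2)[OF tendsto_norm[OF th], of 1] by (auto elim: eventually_mono)
  have "\<forall>\<^sub>F k in sequentially.
      (LINT x|lborel. indicator (cball 0 R) x * \<bar>(u (x + t k *\<^sub>R h) - u x) / t k - w x\<bar>)
      \<le> (LINT x|lborel. \<bar>segment_mean (t k *\<^sub>R h) W x - W x\<bar>)"
    using ev
  proof eventually_elim
    case (elim k)
    show ?case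
    proof (rule integral_mono_AE')
      show "integrable lborel (\<lambda>x. \<bar>segment_mean (t k *\<^sub>R h) W x - W x\<bar>)"
        by (rule segment_mean_L1(1)[OF W th])
      show "AE x in lborel. indicator (cball 0 R) x * \<bar>(u (x + t k *\<^sub>R h) - u x) / t k - w x\<bar>
          \<le> \<bar>segment_mean (t k *\<^sub>R h) W x - W x\<bar>"
        using quot[of k] by eventually_elim (use W_eq[OF elim] in \<open>auto simp: indicator_def W_def\<close>)
    qed auto
  qed
  then show ?thesis
    by (rule tendsto_sandwich[OF _ _ tendsto_const segment_mean_L1(2)[OF W th], rotated])
      (auto simp: integral_nonneg)
qed

section \<open>Weak derivatives of the positive part\<close>

lemma loc_int_bound:
  assumes "loc_int g" "f \<in> borel_measurable borel" "\<And>x. \<bar>f x\<bar> \<le> \<bar>g x\<bar>"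
  shows "loc_int f"
proof -
  have "integrable lborel (\<lambda>x. indicator (cball 0 R) x * f x)" for R
  proof (rule Bochner_Integration.integrable_bound)
    show "integrable lborel (\<lambda>x. indicator (cball 0 R) x * g x)"
      using assms(1) by (simp add: loc_int_def)
    show "(\<lambda>x. indicator (cball 0 R) x * f x) \<in> borel_measurable lborel"
      using assms(2) by (auto intro!: borel_measurable_times borel_measurable_indicator)
    show "AE x in lborel. norm (indicator (cball 0 R) x * f x) \<le> norm (indicator (cball 0 R) x * g x)"
      using assms(3) by (auto simp: abs_mult intro!: mult_left_mono)
  qed
  then show ?thesis using assms(2) by (simp add: loc_int_def)
qed

text \<open>
The one-sided derivative (from the right for \<open>\<sigma> = 1\<close>, from the left for \<open>\<sigma> = -1\<close>) at \<open>t = 0\<close> of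
\<open>t \<mapsto> max 0 (a + t b)\<close>.
\<close>
definition one_sided_pos_deriv :: "real \<Rightarrow> real \<Rightarrow> real \<Rightarrow> real" where
  "one_sided_pos_deriv \<sigma> a b = (if 0 < a then b else if a < 0 then 0 else \<sigma> * max 0 (\<sigma> * b))"

lemma pos_quotient_tendsto:
  fixes a b \<sigma> :: real
  assumes \<sigma>: "\<sigma> = 1 \<or> \<sigma> = -1"
  defines "t \<equiv> \<lambda>k. \<sigma> * inverse (real (Suc k))"
  shows "(\<lambda>k. (max 0 (a + t k * b) - max 0 a) / t k) \<longlonglongrightarrow> one_sided_pos_deriv \<sigma> a b"
proof -
  have "t \<longlonglongrightarrow> \<sigma> * 0"
    unfolding t_def by (intro tendsto_intros LIMSEQ_inverse_real_of_nat)
  then have "(\<lambda>k. a + t k * b) \<longlonglongrightarrow> a + \<sigma> * 0 * b" by (intro tendsto_intros)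
  then have lim: "(\<lambda>k. a + t k * b) \<longlonglongrightarrow> a" by simp
  have t0: "t k \<noteq> 0" for k using \<sigma> by (auto simp: t_def)
  consider "0 < a" | "a < 0" | "a = 0" by linarith
  then show ?thesis
  proof cases
    case 1
    have "\<forall>\<^sub>F k in sequentially. (max 0 (a + t k * b) - max 0 a) / t k = b"
      using order_tendstoD(1)[OF lim 1] by eventually_elim (use 1 t0 in \<open>auto simp: max_def\<close>)
    then show ?thesis using 1 by (simp add: tendsto_eventually one_sided_pos_deriv_def)
  next
    case 2
    have "\<forall>\<^sub>F k in sequentially. (max 0 (a + t k * b) - max 0 a) / t k = 0"
      using order_tendstoD(2)[OF lim 2] by eventually_elim (use 2 t0 in \<open>auto simp: max_def\<close>)
    then show ?thesis using 2 by (simp add: tendsto_eventually one_sided_pos_deriv_def)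
  next
    case 3
    have "(max 0 (a + t k * b) - max 0 a) / t k = \<sigma> * max 0 (\<sigma> * b)" for k
    proof -
      have p: "0 < inverse (real (Suc k))" by simp
      have "max 0 (t k * b) = inverse (real (Suc k)) * max 0 (\<sigma> * b)"
        using p unfolding t_def by (simp add: max_def mult.assoc mult.left_commute[of \<sigma>] zero_le_mult_iff)
      moreover have "inverse \<sigma> = \<sigma>" using \<sigma> by auto
      ultimately show ?thesis using 3 p by (simp add: t_def divide_inverse mult_ac)
    qed
    then show ?thesis using 3 by (simp add: one_sided_pos_deriv_def)
  qed
qed

lemma max_0_quotient_bound: "\<bar>(max 0 (a + t * b) - max 0 a) / t\<bar> \<le> \<bar>b::real\<bar>"
proof (cases "t = 0")
  case False
  have "\<bar>max 0 (a + t * b) - max 0 a\<bar> \<le> \<bar>t * b\<bar>" by (auto simp: max_def)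
  then show ?thesis using False by (simp add: abs_mult field_simps)
qed simp

lemma one_sided_pos_deriv_bound: "\<sigma> = 1 \<or> \<sigma> = -1 \<Longrightarrow> \<bar>one_sided_pos_deriv \<sigma> a b\<bar> \<le> \<bar>b\<bar>"
  by (auto simp: one_sided_pos_deriv_def max_def)

lemma one_sided_pos_deriv_measurable [measurable]:
  assumes [measurable]: "f \<in> borel_measurable M" "g \<in> borel_measurable M"
  shows "(\<lambda>x. one_sided_pos_deriv \<sigma> (f x) (g x)) \<in> borel_measurable M"
  unfolding one_sided_pos_deriv_def by measurable

lemma test_function_quotient:
  assumes \<phi>: "test_function \<phi>" and G: "\<And>x. GDERIV \<phi> x :> G x" and t: "t \<longlonglongrightarrow> 0" "\<And>k::nat. t k \<noteq> (0::real)"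
  shows "(\<lambda>k. (\<phi> (x - t k *\<^sub>R h) - \<phi> x) / t k) \<longlonglongrightarrow> - (G x \<bullet> h)"
    and "\<exists>M. \<forall>x k. \<bar>(\<phi> (x - t k *\<^sub>R h) - \<phi> x) / t k\<bar> \<le> M"
proof -
  have "((\<lambda>s. x - s *\<^sub>R h) has_derivative (\<lambda>s. - (s *\<^sub>R h))) (at 0)"
    by (auto intro!: derivative_eq_intros)
  moreover have "(\<phi> has_derivative (\<lambda>v. v \<bullet> G x)) (at (x - 0 *\<^sub>R h))"
    using G[of x] by (simp add: gderiv_def)
  ultimately have "((\<lambda>s. \<phi> (x - s *\<^sub>R h)) has_derivative (\<lambda>s. - (s *\<^sub>R h) \<bullet> G x)) (at 0)"
    by (rule has_derivative_compose)
  moreover have "(\<lambda>s. - (s *\<^sub>R h) \<bullet> G x) = (*) (- (G x \<bullet> h))"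
    by (auto simp: inner_commute mult.commute)
  ultimately have "DERIV (\<lambda>s. \<phi> (x - s *\<^sub>R h)) 0 :> - (G x \<bullet> h)"
    by (simp add: has_field_derivative_def)
  then have *: "((\<lambda>s. (\<phi> (x - s *\<^sub>R h) - \<phi> x) / s) \<longlongrightarrow> - (G x \<bullet> h)) (at 0)"
    by (simp add: DERIV_def)
  have "filterlim t (at 0) sequentially"
    using t by (simp add: filterlim_at)
  then show "(\<lambda>k. (\<phi> (x - t k *\<^sub>R h) - \<phi> x) / t k) \<longlonglongrightarrow> - (G x \<bullet> h)"
    using filterlim_compose[OF *] by fast
next
  obtain R where R: "\<And>x. R < norm x \<Longrightarrow> \<phi> x = 0" using test_function_support[OF \<phi>] by metis
  have c: "continuous_on UNIV G" by (rule test_function_gradient(1)[OF \<phi> G R])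
  have G0: "G x = 0" if "R < norm x" for x
    using test_function_gradient(2)[OF \<phi> G R] that by blast
  obtain M where M: "\<And>x. norm (G x) \<le> M"
    using bounded_of_compact_support[OF c, of R] G0 by metis
  have "\<bar>(\<phi> (x - t k *\<^sub>R h) - \<phi> x) / t k\<bar> \<le> M * norm h" for x k
  proof -
    have "\<bar>\<phi> x - \<phi> (x - t k *\<^sub>R h)\<bar> = \<bar>LINT s|lborel. indicator {0..1} s * (G (x - s *\<^sub>R (t k *\<^sub>R h)) \<bullet> (t k *\<^sub>R h))\<bar>"
      by (simp only: segment_FTC[OF G c])
    also have "\<dots> \<le> (LINT s|lborel. \<bar>indicator {0..1} s * (G (x - s *\<^sub>R (t k *\<^sub>R h)) \<bullet> (t k *\<^sub>R h))\<bar>)"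
      by (rule integral_abs_bound)
    also have "\<dots> \<le> (LINT s|lborel. indicator {0..1::real} s * (M * norm (t k *\<^sub>R h)))"
    proof (rule integral_mono_AE')
      show "integrable lborel (\<lambda>s::real. indicator {0..1} s * (M * norm (t k *\<^sub>R h)))" by simp
      show "AE s in lborel. \<bar>indicator {0..1} s * (G (x - s *\<^sub>R (t k *\<^sub>R h)) \<bullet> (t k *\<^sub>R h))\<bar>
          \<le> indicator {0..1} s * (M * norm (t k *\<^sub>R h))"
      proof (intro AE_I2)
        fix s :: real
        have "\<bar>G (x - s *\<^sub>R (t k *\<^sub>R h)) \<bullet> (t k *\<^sub>R h)\<bar> \<le> norm (G (x - s *\<^sub>R (t k *\<^sub>R h))) * norm (t k *\<^sub>R h)"
          by (rule Cauchy_Schwarz_ineq2)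
        also have "\<dots> \<le> M * norm (t k *\<^sub>R h)" by (rule mult_right_mono[OF M]) simp
        finally show "\<bar>indicator {0..1} s * (G (x - s *\<^sub>R (t k *\<^sub>R h)) \<bullet> (t k *\<^sub>R h))\<bar>
          \<le> indicator {0..1} s * (M * norm (t k *\<^sub>R h))" by (auto simp: indicator_def)
      qed
    qed (use order_trans[OF norm_ge_zero M] in auto)
    also have "\<dots> = M * norm h * \<bar>t k\<bar>" by simp
    finally show ?thesis using t(2)[of k] by (simp add: field_simps abs_minus_commute)
  qed
  then show "\<exists>M. \<forall>x k. \<bar>(\<phi> (x - t k *\<^sub>R h) - \<phi> x) / t k\<bar> \<le> M" by blast
qed

text \<open>
Move the derivative from the test function to \<open>max 0 u\<close> by difference quotients of a fixed sign \<open>\<sigma>\<close>.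
Since \<open>max 0\<close> is a contraction, replacing \<open>u (x + t h)\<close> by \<open>u x + t w x\<close> costs no more than the
error of the difference quotient of \<open>u\<close>, which tends to \<open>0\<close> in \<open>L\<^sup>1\<close>; what remains has a pointwise
limit.
\<close>
lemma pos_part_one_sided:
  fixes u :: "'a::euclidean_space \<Rightarrow> real"
  assumes uw: "weak_deriv h u w" and \<sigma>: "\<sigma> = 1 \<or> \<sigma> = -1"
    and \<phi>: "test_function \<phi>" and G: "\<And>x. GDERIV \<phi> x :> G x"
  shows "(LINT x|lborel. max 0 (u x) * (G x \<bullet> h)) = - (LINT x|lborel. one_sided_pos_deriv \<sigma> (u x) (w x) * \<phi> x)"
proof -
  note u = weak_derivD(1)[OF uw] and w = weak_derivD(2)[OF uw]
  define up where "up x = max 0 (u x)" for x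
  define t where "t k = \<sigma> * inverse (real (Suc k))" for k
  have "t \<longlonglongrightarrow> \<sigma> * 0"
    unfolding t_def by (intro tendsto_intros LIMSEQ_inverse_real_of_nat)
  then have t: "t \<longlonglongrightarrow> 0" "\<And>k. t k \<noteq> 0" using \<sigma> by (auto simp: t_def)
  obtain R where R: "\<And>x. R < norm x \<Longrightarrow> \<phi> x = 0" using test_function_support[OF \<phi>] by metis
  have c: "continuous_on UNIV G" by (rule test_function_gradient(1)[OF \<phi> G R])
  obtain M where M: "0 < M" "\<And>x. \<bar>\<phi> x\<bar> \<le> M"
    using bounded_of_compact_support[OF test_function_continuous[OF \<phi>], of R] R
    by (metis real_norm_def)
  have [measurable]: "u \<in> borel_measurable borel" "w \<in> borel_measurable borel"
    "\<phi> \<in> borel_measurable borel" "G \<in> borel_measurable borel"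
    using u w c test_function_continuous[OF \<phi>] by (auto intro: borel_measurable_continuous_onI)
  have up [measurable]: "up \<in> borel_measurable borel" unfolding up_def by measurable
  have upl: "loc_int up" by (rule loc_int_bound[OF u up]) (auto simp: up_def)
  \<comment> \<open>the difference quotients of \<open>max 0\<close> along the affine approximation
    of \<open>u\<close>, of \<open>max 0 u\<close>, and of \<open>u\<close>\<close>
  define \<rho> where "\<rho> k x = (max 0 (u x + t k * w x) - max 0 (u x)) / t k" for k x
  define r where "r k x = (up (x + t k *\<^sub>R h) - up x) / t k" for k x
  define q where "q k x = (u (x + t k *\<^sub>R h) - u x) / t k" for k x
  have [measurable]: "\<rho> k \<in> borel_measurable borel" for k unfolding \<rho>_def by measurable
  have i\<rho>: "integrable lborel (\<lambda>x. \<rho> k x * \<phi> x)" for k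
    using max_0_quotient_bound
    by (intro loc_int_mult_test[OF loc_int_bound[OF w] \<phi>]) (auto simp: \<rho>_def)
  have lim1: "(\<lambda>k. LINT x|lborel. \<rho> k x * \<phi> x) \<longlonglongrightarrow> (LINT x|lborel. one_sided_pos_deriv \<sigma> (u x) (w x) * \<phi> x)"
  proof (rule integral_dominated_convergence[where w = "\<lambda>x. \<bar>w x * \<phi> x\<bar>"])
    show "integrable lborel (\<lambda>x. \<bar>w x * \<phi> x\<bar>)" using loc_int_mult_test[OF w \<phi>] by (rule integrable_abs)
    show "AE x in lborel. (\<lambda>k. \<rho> k x * \<phi> x) \<longlonglongrightarrow> one_sided_pos_deriv \<sigma> (u x) (w x) * \<phi> x"
      unfolding \<rho>_def t_def by (intro AE_I2 tendsto_mult pos_quotient_tendsto[OF \<sigma>] tendsto_const)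
    show "AE x in lborel. norm (\<rho> k x * \<phi> x) \<le> \<bar>w x * \<phi> x\<bar>" for k
    proof (intro AE_I2)
      fix x
      have "\<bar>\<rho> k x\<bar> * \<bar>\<phi> x\<bar> \<le> \<bar>w x\<bar> * \<bar>\<phi> x\<bar>"
        unfolding \<rho>_def by (intro mult_right_mono max_0_quotient_bound) simp
      then show "norm (\<rho> k x * \<phi> x) \<le> \<bar>w x * \<phi> x\<bar>" by (simp add: abs_mult)
    qed
  qed measurable
  have ir1: "integrable lborel (\<lambda>x. up (x + t k *\<^sub>R h) * \<phi> x)" "integrable lborel (\<lambda>x. up x * \<phi> x)" for k
    by (intro loc_int_mult_test[OF _ \<phi>] loc_int_shift upl)+
  have r_eq: "(\<lambda>x. r k x * \<phi> x) = (\<lambda>x. (up (x + t k *\<^sub>R h) * \<phi> x - up x * \<phi> x) / t k)" for k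
    by (auto simp: r_def field_simps)
  have ir: "integrable lborel (\<lambda>x. r k x * \<phi> x)" for k
    unfolding r_eq using ir1(1)[of k] ir1(2) by simp
  have ir2: "integrable lborel (\<lambda>x. up x * \<phi> (x - t k *\<^sub>R h))" for k
    using loc_int_mult_test[OF upl test_function_shift[OF \<phi>, of "- (t k *\<^sub>R h)"]] by simp
  have parts: "(LINT x|lborel. r k x * \<phi> x) = (LINT x|lborel. up x * ((\<phi> (x - t k *\<^sub>R h) - \<phi> x) / t k))" for k
  proof -
    have "(LINT x|lborel. up (x + t k *\<^sub>R h) * \<phi> x) = (LINT x|lborel. up x * \<phi> (x - t k *\<^sub>R h))"
      using lborel_integral_shift[of "\<lambda>x. up x * \<phi> (x - t k *\<^sub>R h)" "t k *\<^sub>R h"] by simp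
    then have "(LINT x|lborel. r k x * \<phi> x) = ((LINT x|lborel. up x * \<phi> (x - t k *\<^sub>R h)) - (LINT x|lborel. up x * \<phi> x)) / t k"
      unfolding r_eq using ir1(1)[of k] ir1(2) by simp
    also have "\<dots> = (LINT x|lborel. (up x * \<phi> (x - t k *\<^sub>R h) - up x * \<phi> x) / t k)"
      using ir1(1)[of k] ir1(2) ir2[of k] by simp
    finally show ?thesis by (simp add: right_diff_distrib)
  qed
  obtain M2 where M2: "\<And>x k. \<bar>(\<phi> (x - t k *\<^sub>R h) - \<phi> x) / t k\<bar> \<le> M2"
    using test_function_quotient(2)[where h = h, OF \<phi> G t] by blast
  have N: "\<bar>t k\<bar> \<le> 1" for k using \<sigma> by (auto simp: t_def abs_mult inverse_le_1_iff)
  have lim2: "(\<lambda>k. LINT x|lborel. r k x * \<phi> x) \<longlonglongrightarrow> (LINT x|lborel. up x * (- (G x \<bullet> h)))"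
    unfolding parts
  proof (rule integral_dominated_convergence[where w = "\<lambda>x. M2 * \<bar>indicator (cball 0 (R + norm h)) x * up x\<bar>"])
    show "integrable lborel (\<lambda>x. M2 * \<bar>indicator (cball 0 (R + norm h)) x * up x\<bar>)"
      using upl by (auto simp: loc_int_def intro!: integrable_mult_right integrable_abs)
    show "AE x in lborel. (\<lambda>k. up x * ((\<phi> (x - t k *\<^sub>R h) - \<phi> x) / t k)) \<longlonglongrightarrow> up x * (- (G x \<bullet> h))"
      by (intro AE_I2 tendsto_mult test_function_quotient(1)[OF \<phi> G t] tendsto_const)
    show "AE x in lborel. norm (up x * ((\<phi> (x - t k *\<^sub>R h) - \<phi> x) / t k))
       \<le> M2 * \<bar>indicator (cball 0 (R + norm h)) x * up x\<bar>" for k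
    proof (intro AE_I2)
      fix x
      show "norm (up x * ((\<phi> (x - t k *\<^sub>R h) - \<phi> x) / t k)) \<le> M2 * \<bar>indicator (cball 0 (R + norm h)) x * up x\<bar>"
      proof (cases "norm x \<le> R + norm h")
        case True
        have "norm (up x * ((\<phi> (x - t k *\<^sub>R h) - \<phi> x) / t k)) = \<bar>(\<phi> (x - t k *\<^sub>R h) - \<phi> x) / t k\<bar> * \<bar>up x\<bar>"
          by (simp only: real_norm_def abs_mult mult.commute)
        also have "\<dots> \<le> M2 * \<bar>up x\<bar>" by (rule mult_right_mono[OF M2]) simp
        finally show ?thesis using True by simp
      next
        case False
        have "norm (t k *\<^sub>R h) \<le> norm h" using N[of k] by (simp add: mult_left_le_one_le)
        then have "R < norm (x - t k *\<^sub>R h)" "R < norm x"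
          using norm_triangle_ineq2[of x "t k *\<^sub>R h"] False norm_ge_zero[of h] by linarith+
        then show ?thesis using R False by simp
      qed
    qed
  qed measurable
  have "(\<lambda>k. (LINT x|lborel. r k x * \<phi> x) - (LINT x|lborel. \<rho> k x * \<phi> x)) \<longlonglongrightarrow> 0"
  proof (rule Lim_null_comparison)
    have "(\<lambda>k. M * (LINT x|lborel. indicator (cball 0 R) x * \<bar>q k x - w x\<bar>)) \<longlonglongrightarrow> M * 0"
      unfolding q_def by (intro tendsto_intros difference_quotient_L1[OF uw t])
    then show "(\<lambda>k. M * (LINT x|lborel. indicator (cball 0 R) x * \<bar>q k x - w x\<bar>)) \<longlonglongrightarrow> 0" by simp
    have "norm ((LINT x|lborel. r k x * \<phi> x) - (LINT x|lborel. \<rho> k x * \<phi> x))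
      \<le> M * (LINT x|lborel. indicator (cball 0 R) x * \<bar>q k x - w x\<bar>)" for k
    proof -
      have "norm ((LINT x|lborel. r k x * \<phi> x) - (LINT x|lborel. \<rho> k x * \<phi> x))
        = \<bar>LINT x|lborel. r k x * \<phi> x - \<rho> k x * \<phi> x\<bar>"
        using ir[of k] i\<rho>[of k] by simp
      also have "\<dots> \<le> (LINT x|lborel. \<bar>r k x * \<phi> x - \<rho> k x * \<phi> x\<bar>)"
        by (rule integral_abs_bound)
      also have "\<dots> \<le> (LINT x|lborel. M * (indicator (cball 0 R) x * \<bar>q k x - w x\<bar>))"
      proof (rule integral_mono)
        have "integrable lborel (\<lambda>x. indicator (cball 0 R) x * u (x + t k *\<^sub>R h))"
          "integrable lborel (\<lambda>x. indicator (cball 0 R) x * u x)"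
          "integrable lborel (\<lambda>x. indicator (cball 0 R) x * w x)"
          using loc_int_shift[OF u] u w by (auto simp: loc_int_def)
        then have "integrable lborel (\<lambda>x. M * \<bar>(indicator (cball 0 R) x * u (x + t k *\<^sub>R h)
          - indicator (cball 0 R) x * u x) / t k - indicator (cball 0 R) x * w x\<bar>)"
          by (intro integrable_mult_right integrable_abs Bochner_Integration.integrable_diff integrable_divide)
        moreover have "(\<lambda>x. M * \<bar>(indicator (cball 0 R) x * u (x + t k *\<^sub>R h)
          - indicator (cball 0 R) x * u x) / t k - indicator (cball 0 R) x * w x\<bar>)
          = (\<lambda>x. M * (indicator (cball 0 R) x * \<bar>q k x - w x\<bar>))"
          by (auto simp: q_def indicator_def)
        ultimately show "integrable lborel (\<lambda>x. M * (indicator (cball 0 R) x * \<bar>q k x - w x\<bar>))" by simp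
        show "integrable lborel (\<lambda>x. \<bar>r k x * \<phi> x - \<rho> k x * \<phi> x\<bar>)"
          using ir[of k] i\<rho>[of k] by simp
        show "\<bar>r k x * \<phi> x - \<rho> k x * \<phi> x\<bar> \<le> M * (indicator (cball 0 R) x * \<bar>q k x - w x\<bar>)" for x
        proof (cases "norm x \<le> R")
          case True
          have "r k x - \<rho> k x = (max 0 (u (x + t k *\<^sub>R h)) - max 0 (u x + t k * w x)) / t k"
            by (simp add: r_def \<rho>_def up_def diff_divide_distrib)
          moreover have "\<bar>max 0 (u (x + t k *\<^sub>R h)) - max 0 (u x + t k * w x)\<bar> \<le> \<bar>u (x + t k *\<^sub>R h) - (u x + t k * w x)\<bar>"
            by (auto simp: max_def)
          moreover have "q k x - w x = (u (x + t k *\<^sub>R h) - (u x + t k * w x)) / t k"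
            using t(2)[of k] by (simp add: q_def field_simps)
          ultimately have "\<bar>r k x - \<rho> k x\<bar> \<le> \<bar>q k x - w x\<bar>"
            by (simp add: divide_right_mono)
          then have "\<bar>r k x - \<rho> k x\<bar> * \<bar>\<phi> x\<bar> \<le> \<bar>q k x - w x\<bar> * M"
            by (intro mult_mono M) auto
          then show ?thesis using True by (simp add: abs_mult[symmetric] left_diff_distrib[symmetric] mult.commute[of _ M])
        next
          case False
          then show ?thesis using R[of x] by simp
        qed
      qed
      also have "\<dots> = M * (LINT x|lborel. indicator (cball 0 R) x * \<bar>q k x - w x\<bar>)" by simp
      finally show ?thesis .
    qed
    then show "\<forall>\<^sub>F k in sequentially. norm ((LINT x|lborel. r k x * \<phi> x) - (LINT x|lborel. \<rho> k x * \<phi> x))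
      \<le> M * (LINT x|lborel. indicator (cball 0 R) x * \<bar>q k x - w x\<bar>)" by simp
  qed
  then have "(LINT x|lborel. up x * (- (G x \<bullet> h))) - (LINT x|lborel. one_sided_pos_deriv \<sigma> (u x) (w x) * \<phi> x) = 0"
    using LIMSEQ_unique tendsto_diff[OF lim2 lim1] by blast
  then show ?thesis by (simp add: up_def)
qed

text \<open>
The left and right formulas of \<open>pos_part_one_sided\<close> must agree. On the zero set of \<open>u\<close> they differ
by \<open>|w|\<close>, so \<open>w\<close> vanishes almost everywhere there and the two become the claimed formula.
\<close>
lemma weak_deriv_pos_part:
  fixes u :: "'a::euclidean_space \<Rightarrow> real"
  assumes uw: "weak_deriv h u w"
  shows "weak_deriv h (\<lambda>x. max 0 (u x)) (\<lambda>x. if 0 < u x then w x else 0)"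
proof -
  note u = weak_derivD(1)[OF uw] and w = weak_derivD(2)[OF uw]
  have [measurable]: "u \<in> borel_measurable borel" "w \<in> borel_measurable borel" using u w by measurable
  define z where "z \<sigma> x = one_sided_pos_deriv \<sigma> (u x) (w x)" for \<sigma> x
  have z [measurable]: "z \<sigma> \<in> borel_measurable borel" for \<sigma> unfolding z_def by measurable
  have zl: "loc_int (z \<sigma>)" if "\<sigma> = 1 \<or> \<sigma> = -1" for \<sigma>
    by (rule loc_int_bound[OF w z]) (use one_sided_pos_deriv_bound[OF that] in \<open>auto simp: z_def\<close>)
  have z0: "AE x in lborel. z 1 x + (-1) * z (-1) x = 0"
  proof (rule fundamental_lemma[OF loc_int_linear[OF zl zl]])
    fix \<phi> :: "'a \<Rightarrow> real" assume \<phi>: "test_function \<phi>"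
    obtain G where G: "\<And>x. GDERIV \<phi> x :> G x" by (rule test_function_GDERIV[OF \<phi>]) blast
    have "(LINT x|lborel. z 1 x * \<phi> x) = (LINT x|lborel. z (-1) x * \<phi> x)"
      using pos_part_one_sided[OF uw _ \<phi> G, of 1] pos_part_one_sided[OF uw _ \<phi> G, of "-1"]
      by (simp add: z_def)
    then show "(LINT x|lborel. (z 1 x + (-1) * z (-1) x) * \<phi> x) = 0"
      using loc_int_mult_test[OF zl \<phi>, of 1] loc_int_mult_test[OF zl \<phi>, of "-1"]
      by (simp add: left_diff_distrib)
  qed auto
  have eq: "AE x in lborel. z 1 x = (if 0 < u x then w x else 0)"
    using z0 by eventually_elim (auto simp: z_def one_sided_pos_deriv_def max_def split: if_splits)
  have upl: "loc_int (\<lambda>x. max 0 (u x))"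
    by (rule loc_int_bound[OF u]) auto
  have wpl: "loc_int (\<lambda>x. if 0 < u x then w x else 0)"
    by (rule loc_int_bound[OF w]) auto
  have "(LINT x|lborel. max 0 (u x) * (G x \<bullet> h)) = - (LINT x|lborel. (if 0 < u x then w x else 0) * \<phi> x)"
    if \<phi>: "test_function \<phi>" and G: "\<And>x. GDERIV \<phi> x :> G x" for \<phi> G
  proof -
    have [measurable]: "\<phi> \<in> borel_measurable borel"
      using test_function_continuous[OF \<phi>] by (rule borel_measurable_continuous_onI)
    have "(LINT x|lborel. z 1 x * \<phi> x) = (LINT x|lborel. (if 0 < u x then w x else 0) * \<phi> x)"
      by (rule integral_cong_AE) (measurable, use eq in eventually_elim, simp)
    then show ?thesis using pos_part_one_sided[OF uw _ \<phi> G, of 1] by (simp add: z_def)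
  qed
  then show ?thesis using upl wpl unfolding weak_deriv_def by blast
qed

section \<open>The Poincare inequality on convex sets\<close>

text \<open>
Jensen's inequality for the square, integrating \<open>2 a g - a\<^sup>2 \<le> g\<^sup>2\<close> with \<open>a\<close> the mean of \<open>g\<close>. If \<open>g\<close>
is not integrable, the integral on the left is \<open>0\<close> by convention; if only its square is not, the
right-hand side is infinite.
\<close>
lemma unit_interval_Jensen:
  fixes g :: "real \<Rightarrow> real"
  assumes [measurable]: "g \<in> borel_measurable borel"
  shows "ennreal ((LINT s|lborel. indicator {0..1} s * g s)\<^sup>2) \<le> (\<integral>\<^sup>+s. indicator {0..1} s * ennreal ((g s)\<^sup>2) \<partial>lborel)"
proof (cases "integrable lborel (\<lambda>s. indicator {0..1} s * (g s)\<^sup>2) \<and> integrable lborel (\<lambda>s. indicator {0..1} s * g s)")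
  case True
  define a where "a = (LINT s|lborel. indicator {0..1} s * g s)"
  have i: "integrable lborel (\<lambda>s::real. indicator {0..1} s * a\<^sup>2)" by simp
  \<comment> \<open>the integral of \<open>2 a g - a\<^sup>2\<close> is again
    \<open>a\<^sup>2\<close>\<close>
  have "a\<^sup>2 = 2 * a * a - a\<^sup>2" by (simp add: power2_eq_square)
  also have "\<dots> = (LINT s|lborel. 2 * a * (indicator {0..1} s * g s) - indicator {0..1} s * a\<^sup>2)"
    using True i by (simp add: a_def)
  also have "\<dots> \<le> (LINT s|lborel. indicator {0..1} s * (g s)\<^sup>2)"
  proof (rule integral_mono)
    show "2 * a * (indicator {0..1} s * g s) - indicator {0..1} s * a\<^sup>2 \<le> indicator {0..1} s * (g s)\<^sup>2" for s
      using zero_le_power2[of "g s - a"] by (auto simp: indicator_def power2_diff mult_ac)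
  qed (use True i in auto)
  finally have "ennreal (a\<^sup>2) \<le> ennreal (LINT s|lborel. indicator {0..1} s * (g s)\<^sup>2)"
    by (rule ennreal_leI)
  also have "\<dots> = (\<integral>\<^sup>+s. ennreal (indicator {0..1} s * (g s)\<^sup>2) \<partial>lborel)"
    using True by (intro nn_integral_eq_integral[symmetric]) auto
  also have "\<dots> = (\<integral>\<^sup>+s. indicator {0..1} s * ennreal ((g s)\<^sup>2) \<partial>lborel)"
    by (intro nn_integral_cong) (auto simp: indicator_def)
  finally show ?thesis by (simp add: a_def)
next
  case False
  show ?thesis
  proof (cases "integrable lborel (\<lambda>s. indicator {0..1} s * g s)")
    case True
    have "(\<integral>\<^sup>+s. indicator {0..1} s * ennreal ((g s)\<^sup>2) \<partial>lborel)
      = (\<integral>\<^sup>+s. ennreal (norm (indicator {0..1} s * (g s)\<^sup>2)) \<partial>lborel)"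
      by (intro nn_integral_cong) (auto simp: indicator_def)
    also have "\<dots> = top" using False True unfolding integrable_iff_bounded
      by (auto simp: less_top[symmetric])
    finally show ?thesis by simp
  qed (simp add: not_integrable_integral_eq)
qed

text \<open>
Jensen's inequality in \<open>weak_deriv_segment\<close>. Convexity keeps the segment from \<open>x\<close> to \<open>x + h\<close> in \<open>K\<close>, and
each translate of the energy integral is bounded by the energy on \<open>K\<close>.
\<close>
lemma weak_deriv_translate_L2:
  fixes u :: "'a::euclidean_space \<Rightarrow> real" and v :: "'a \<Rightarrow> 'a"
  assumes uw: "weak_deriv h u (\<lambda>x. v x \<bullet> h)" and v [measurable]: "v \<in> borel_measurable borel"
    and K: "convex K" and Kb [measurable]: "K \<in> sets borel"
  shows "(\<integral>\<^sup>+x. indicator K x * indicator K (x + h) * ennreal ((u (x + h) - u x)\<^sup>2) \<partial>lborel)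
    \<le> ennreal ((norm h)\<^sup>2) * (\<integral>\<^sup>+x. indicator K x * ennreal ((norm (v x))\<^sup>2) \<partial>lborel)"
proof -
  have "(\<integral>\<^sup>+x. indicator K x * indicator K (x + h) * ennreal ((u (x + h) - u x)\<^sup>2) \<partial>lborel)
    \<le> (\<integral>\<^sup>+x. (\<integral>\<^sup>+s. ennreal ((norm h)\<^sup>2) * (indicator {0..1} s * (indicator K (x + s *\<^sub>R h) * ennreal ((norm (v (x + s *\<^sub>R h)))\<^sup>2))) \<partial>lborel) \<partial>lborel)"
  proof (rule nn_integral_mono_AE)
    show "AE x in lborel. indicator K x * indicator K (x + h) * ennreal ((u (x + h) - u x)\<^sup>2)
      \<le> (\<integral>\<^sup>+s. ennreal ((norm h)\<^sup>2) * (indicator {0..1} s * (indicator K (x + s *\<^sub>R h) * ennreal ((norm (v (x + s *\<^sub>R h)))\<^sup>2))) \<partial>lborel)"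
      using weak_deriv_segment[OF uw]
    proof eventually_elim
      case (elim x)
      show ?case
      proof (cases "x \<in> K \<and> x + h \<in> K")
        case True
        have "ennreal ((u (x + h) - u x)\<^sup>2) \<le> (\<integral>\<^sup>+s. indicator {0..1} s * ennreal ((v (x + s *\<^sub>R h) \<bullet> h)\<^sup>2) \<partial>lborel)"
          unfolding elim segment_mean_def by (rule unit_interval_Jensen) measurable
        also have "\<dots> \<le> (\<integral>\<^sup>+s. ennreal ((norm h)\<^sup>2) * (indicator {0..1} s * (indicator K (x + s *\<^sub>R h) * ennreal ((norm (v (x + s *\<^sub>R h)))\<^sup>2))) \<partial>lborel)"
        proof (rule nn_integral_mono)
          fix s :: real
          show "indicator {0..1} s * ennreal ((v (x + s *\<^sub>R h) \<bullet> h)\<^sup>2)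
            \<le> ennreal ((norm h)\<^sup>2) * (indicator {0..1} s * (indicator K (x + s *\<^sub>R h) * ennreal ((norm (v (x + s *\<^sub>R h)))\<^sup>2)))"
          proof (cases "s \<in> {0..1}")
            case s: True
            have "(1 - s) *\<^sub>R x + s *\<^sub>R (x + h) \<in> K"
              using K True s by (intro convexD_alt) auto
            then have "x + s *\<^sub>R h \<in> K" by (simp add: algebra_simps)
            moreover have "(v (x + s *\<^sub>R h) \<bullet> h)\<^sup>2 \<le> (norm h)\<^sup>2 * (norm (v (x + s *\<^sub>R h)))\<^sup>2"
              using Cauchy_Schwarz_ineq[of "v (x + s *\<^sub>R h)" h] by (simp add: power2_norm_eq_inner mult.commute)
            ultimately show ?thesis using s by (simp add: ennreal_mult[symmetric] ennreal_leI)
          qed simp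
        qed
        finally show ?thesis using True by simp
      qed (auto simp: indicator_def)
    qed
  qed
  also have "\<dots> = (\<integral>\<^sup>+s. (\<integral>\<^sup>+x. ennreal ((norm h)\<^sup>2) * (indicator {0..1} s * (indicator K (x + s *\<^sub>R h) * ennreal ((norm (v (x + s *\<^sub>R h)))\<^sup>2))) \<partial>lborel) \<partial>lborel)"
    by (rule lborel_pair.Fubini') measurable
  also have "\<dots> = (\<integral>\<^sup>+s. indicator {0..1::real} s * (ennreal ((norm h)\<^sup>2) * (\<integral>\<^sup>+x. indicator K x * ennreal ((norm (v x))\<^sup>2) \<partial>lborel)) \<partial>lborel)"
  proof (rule nn_integral_cong)
    fix s :: real
    have "(\<integral>\<^sup>+x. indicator K (x + s *\<^sub>R h) * ennreal ((norm (v (x + s *\<^sub>R h)))\<^sup>2) \<partial>lborel)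
      = (\<integral>\<^sup>+x. indicator K x * ennreal ((norm (v x))\<^sup>2) \<partial>lborel)"
      by (rule lborel_nn_integral_shift[where f = "\<lambda>x. indicator K x * ennreal ((norm (v x))\<^sup>2)"]) measurable
    then show "(\<integral>\<^sup>+x. ennreal ((norm h)\<^sup>2) * (indicator {0..1} s * (indicator K (x + s *\<^sub>R h) * ennreal ((norm (v (x + s *\<^sub>R h)))\<^sup>2))) \<partial>lborel)
      = indicator {0..1::real} s * (ennreal ((norm h)\<^sup>2) * (\<integral>\<^sup>+x. indicator K x * ennreal ((norm (v x))\<^sup>2) \<partial>lborel))"
      by (simp add: nn_integral_cmult mult_ac)
  qed
  also have "\<dots> = ennreal ((norm h)\<^sup>2) * (\<integral>\<^sup>+x. indicator K x * ennreal ((norm (v x))\<^sup>2) \<partial>lborel)"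
    by (subst nn_integral_multc) auto
  finally show ?thesis .
qed

text \<open>
Compare \<open>u p\<close> with the values of \<open>u\<close> at the points \<open>z\<close> of \<open>Y\<close> near \<open>p\<close> where \<open>u\<close> is small; there are
enough of them by assumption. Writing \<open>z = p + h\<close>, the squared differences are bounded for each fixed
\<open>h\<close> by \<open>weak_deriv_translate_L2\<close>. The set \<open>Y\<close> enters because the error term must be proportional to the
measure of the comparison set and not to that of the ball of radius \<open>s\<close>.
\<close>
lemma Poincare_convex:
  fixes u :: "'a::euclidean_space \<Rightarrow> real" and v :: "'a \<Rightarrow> 'a"
  assumes uw: "\<And>h. weak_deriv h u (\<lambda>x. v x \<bullet> h)" and v [measurable]: "v \<in> borel_measurable borel"
    and u [measurable]: "u \<in> borel_measurable borel"
    and K: "convex K" and Kb [measurable]: "K \<in> sets borel" and Y [measurable]: "Y \<in> sets borel" and YK: "Y \<subseteq> K"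
    and m: "\<And>p. p \<in> K \<Longrightarrow> m \<le> emeasure lborel {z \<in> Y. dist p z < s \<and> \<bar>u z\<bar> \<le> \<kappa>}"
  shows "m * (\<integral>\<^sup>+x. indicator K x * ennreal ((u x)\<^sup>2) \<partial>lborel)
    \<le> emeasure lborel (ball (0::'a) s) * (2 * ennreal (s\<^sup>2) * (\<integral>\<^sup>+x. indicator K x * ennreal ((norm (v x))\<^sup>2) \<partial>lborel))
        + 2 * ennreal (\<kappa>\<^sup>2) * (emeasure lborel Y * emeasure lborel K)"
proof -
  have [measurable]: "ball (0::'a) s \<in> sets borel" by simp
  define E where "E = (\<integral>\<^sup>+x. indicator K x * ennreal ((norm (v x))\<^sup>2) \<partial>lborel)"
  \<comment> \<open>the two parts of \<open>u(p)\<^sup>2 \<le> 2 (u(p + h) - u(p))\<^sup>2 + 2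
    \<kappa>\<^sup>2\<close>, which holds if \<open>p + h\<close> is a comparison point\<close>
  define D where "D p h = indicator K p * indicator K (p + h) * (indicator (ball (0::'a) s) h :: ennreal)
    * (2 * ennreal ((u (p + h) - u p)\<^sup>2))" for p h
  define C where "C p h = indicator K p * (2 * ennreal (\<kappa>\<^sup>2)) * (indicator Y (h + p) :: ennreal)" for p h
  have Dm [measurable]: "(\<lambda>(p, h). D p h) \<in> borel_measurable (lborel \<Otimes>\<^sub>M lborel)"
    "(\<lambda>h. D p h) \<in> borel_measurable borel" "(\<lambda>p. \<integral>\<^sup>+h. D p h \<partial>lborel) \<in> borel_measurable borel" for p
    unfolding D_def by measurable
  have Cm [measurable]: "(\<lambda>h. C p h) \<in> borel_measurable borel" "(\<lambda>p. \<integral>\<^sup>+h. C p h \<partial>lborel) \<in> borel_measurable borel" for p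
    unfolding C_def by measurable
  have "m * (\<integral>\<^sup>+x. indicator K x * ennreal ((u x)\<^sup>2) \<partial>lborel)
    = (\<integral>\<^sup>+x. m * (indicator K x * ennreal ((u x)\<^sup>2)) \<partial>lborel)"
    by (rule nn_integral_cmult[symmetric]) measurable
  also have "\<dots> \<le> (\<integral>\<^sup>+p. (\<integral>\<^sup>+h. D p h + C p h \<partial>lborel) \<partial>lborel)"
  proof (rule nn_integral_mono)
    fix p
    show "m * (indicator K p * ennreal ((u p)\<^sup>2)) \<le> (\<integral>\<^sup>+h. D p h + C p h \<partial>lborel)"
    proof (cases "p \<in> K")
      case True
      have "m * ennreal ((u p)\<^sup>2) \<le> emeasure lborel {z \<in> Y. dist p z < s \<and> \<bar>u z\<bar> \<le> \<kappa>} * ennreal ((u p)\<^sup>2)"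
        by (rule mult_right_mono[OF m[OF True]]) simp
      also have "\<dots> = (\<integral>\<^sup>+z. ennreal ((u p)\<^sup>2) * indicator {z \<in> Y. dist p z < s \<and> \<bar>u z\<bar> \<le> \<kappa>} z \<partial>lborel)"
        by (subst nn_integral_cmult_indicator) (simp_all add: mult.commute)
      also have "\<dots> = (\<integral>\<^sup>+h. ennreal ((u p)\<^sup>2) * indicator {z \<in> Y. dist p z < s \<and> \<bar>u z\<bar> \<le> \<kappa>} (h + p) \<partial>lborel)"
        by (rule lborel_nn_integral_shift[symmetric]) measurable
      also have "\<dots> \<le> (\<integral>\<^sup>+h. D p h + C p h \<partial>lborel)"
      proof (rule nn_integral_mono)
        fix h
        show "ennreal ((u p)\<^sup>2) * indicator {z \<in> Y. dist p z < s \<and> \<bar>u z\<bar> \<le> \<kappa>} (h + p) \<le> D p h + C p h"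
        proof (cases "h + p \<in> {z \<in> Y. dist p z < s \<and> \<bar>u z\<bar> \<le> \<kappa>}")
          case h: True
          then have n: "p + h \<in> Y" "norm h < s" "\<bar>u (p + h)\<bar> \<le> \<kappa>" by (auto simp: dist_norm add.commute)
          then have nK: "p + h \<in> K" using YK by auto
          have "(u (p + h))\<^sup>2 \<le> \<kappa>\<^sup>2" using n(3) by (metis abs_ge_zero power2_abs power_mono)
          moreover have "(u p)\<^sup>2 \<le> 2 * (u (p + h) - u p)\<^sup>2 + 2 * (u (p + h))\<^sup>2"
            using zero_le_power2[of "u p - 2 * u (p + h)"] by (simp add: power2_eq_square algebra_simps)
          ultimately have "(u p)\<^sup>2 \<le> 2 * (u (p + h) - u p)\<^sup>2 + 2 * \<kappa>\<^sup>2" by linarith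
          then have "ennreal ((u p)\<^sup>2) \<le> ennreal (2 * (u (p + h) - u p)\<^sup>2 + 2 * \<kappa>\<^sup>2)" by (rule ennreal_leI)
          then show ?thesis using h n nK True by (simp add: D_def C_def ennreal_plus ennreal_mult)
        qed simp
      qed
      finally show ?thesis using True by simp
    qed simp
  qed
  also have "\<dots> = (\<integral>\<^sup>+p. (\<integral>\<^sup>+h. D p h \<partial>lborel) \<partial>lborel) + (\<integral>\<^sup>+p. (\<integral>\<^sup>+h. C p h \<partial>lborel) \<partial>lborel)"
    by (simp add: nn_integral_add)
  also have "(\<integral>\<^sup>+p. (\<integral>\<^sup>+h. C p h \<partial>lborel) \<partial>lborel) = (\<integral>\<^sup>+p. 2 * ennreal (\<kappa>\<^sup>2) * emeasure lborel Y * indicator K p \<partial>lborel)"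
  proof (rule nn_integral_cong)
    fix p
    have "(\<integral>\<^sup>+h. indicator Y (h + p) \<partial>lborel) = emeasure lborel Y"
      using lborel_nn_integral_shift[of "indicator Y" p] by simp
    then show "(\<integral>\<^sup>+h. C p h \<partial>lborel) = 2 * ennreal (\<kappa>\<^sup>2) * emeasure lborel Y * indicator K p"
      unfolding C_def by (subst nn_integral_cmult) (auto simp: mult_ac)
  qed
  also have "\<dots> = 2 * ennreal (\<kappa>\<^sup>2) * (emeasure lborel Y * emeasure lborel K)"
    by (subst nn_integral_cmult_indicator) (simp_all add: mult.assoc)
  also have "(\<integral>\<^sup>+p. (\<integral>\<^sup>+h. D p h \<partial>lborel) \<partial>lborel) = (\<integral>\<^sup>+h. (\<integral>\<^sup>+p. D p h \<partial>lborel) \<partial>lborel)"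
    by (rule lborel_pair.Fubini'[symmetric]) (use Dm(1) in \<open>simp add: case_prod_beta'\<close>)
  also have "\<dots> \<le> (\<integral>\<^sup>+h. indicator (ball (0::'a) s) h * (2 * ennreal (s\<^sup>2) * E) \<partial>lborel)"
  proof (rule nn_integral_mono)
    fix h :: 'a
    show "(\<integral>\<^sup>+p. D p h \<partial>lborel) \<le> indicator (ball 0 s) h * (2 * ennreal (s\<^sup>2) * E)"
    proof (cases "norm h < s")
      case True
      have "(\<integral>\<^sup>+p. D p h \<partial>lborel) = (\<integral>\<^sup>+p. 2 * (indicator K p * indicator K (p + h) * ennreal ((u (p + h) - u p)\<^sup>2)) \<partial>lborel)"
        using True by (intro nn_integral_cong) (simp add: D_def indicator_def)
      also have "\<dots> = 2 * (\<integral>\<^sup>+p. indicator K p * indicator K (p + h) * ennreal ((u (p + h) - u p)\<^sup>2) \<partial>lborel)"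
        by (rule nn_integral_cmult) measurable
      also have "\<dots> \<le> 2 * (ennreal (s\<^sup>2) * E)"
      proof (intro mult_left_mono)
        have "(\<integral>\<^sup>+p. indicator K p * indicator K (p + h) * ennreal ((u (p + h) - u p)\<^sup>2) \<partial>lborel)
          \<le> ennreal ((norm h)\<^sup>2) * E"
          unfolding E_def by (rule weak_deriv_translate_L2[OF uw v K Kb])
        also have "\<dots> \<le> ennreal (s\<^sup>2) * E"
          using True by (intro mult_right_mono ennreal_leI power_mono) auto
        finally show "(\<integral>\<^sup>+p. indicator K p * indicator K (p + h) * ennreal ((u (p + h) - u p)\<^sup>2) \<partial>lborel)
          \<le> ennreal (s\<^sup>2) * E" .
      qed auto
      finally show ?thesis using True by (simp add: mult.assoc)
    qed (simp add: D_def)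
  qed
  also have "\<dots> = emeasure lborel (ball (0::'a) s) * (2 * ennreal (s\<^sup>2) * E)"
    by (subst nn_integral_multc) auto
  finally show ?thesis unfolding E_def by (simp add: add_right_mono)
qed

section \<open>Calculus of weak gradients\<close>

lemma loc_int_mult_continuous:
  fixes f :: "'a::euclidean_space \<Rightarrow> real"
  assumes f: "loc_int f" and g: "continuous_on UNIV g"
  shows "loc_int (\<lambda>x. f x * g x)"
proof -
  have [measurable]: "f \<in> borel_measurable borel" "g \<in> borel_measurable borel"
    using f g by (auto intro: borel_measurable_continuous_onI)
  have "integrable lborel (\<lambda>x. indicator (cball 0 R) x * (f x * g x))" for R
  proof -
    have "bounded (g ` cball 0 R)"
      by (intro compact_imp_bounded compact_continuous_image continuous_on_subset[OF g]) auto
    then obtain M where M: "0 < M" "\<And>x. x \<in> cball 0 R \<Longrightarrow> \<bar>g x\<bar> \<le> M" by (auto simp: bounded_pos)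
    have "integrable lborel (\<lambda>x. f x * (indicator (cball 0 R) x * g x))"
    proof (rule loc_int_mult_bounded[OF f, where R = R and M = M])
      show "(\<lambda>x. indicator (cball 0 R) x * g x) \<in> borel_measurable borel"
        by (intro borel_measurable_times borel_measurable_indicator) auto
    qed (use M in \<open>auto simp: indicator_def\<close>)
    then show ?thesis by (simp add: mult.left_commute)
  qed
  then show ?thesis by (simp add: loc_int_def)
qed

lemma weak_deriv_linear:
  assumes "weak_deriv h u w" "weak_deriv h u2 w2"
  shows "weak_deriv h (\<lambda>x. u x + c * u2 x) (\<lambda>x. w x + c * w2 x)"
proof -
  note u = weak_derivD[OF assms(1)] and u2 = weak_derivD[OF assms(2)]
  have "(LINT x|lborel. (u x + c * u2 x) * (G x \<bullet> h)) = - (LINT x|lborel. (w x + c * w2 x) * \<phi> x)"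
    if \<phi>: "test_function \<phi>" and G: "\<And>x. GDERIV \<phi> x :> G x" for \<phi> G
  proof -
    obtain R where R: "\<And>x. R < norm x \<Longrightarrow> \<phi> x = 0" using test_function_support[OF \<phi>] by metis
    have c: "continuous_on UNIV (\<lambda>x. G x \<bullet> h)"
      using test_function_gradient(1)[OF \<phi> G R] by (intro continuous_intros)
    have G0: "G x = 0" if "R < norm x" for x
      using test_function_gradient(2)[OF \<phi> G R] that by blast
    obtain M where M: "\<And>x. \<bar>G x \<bullet> h\<bar> \<le> M"
      using bounded_of_compact_support[OF c, of R] G0 by (metis inner_zero_left real_norm_def)
    have i: "integrable lborel (\<lambda>x. f x * (G x \<bullet> h))" if "loc_int f" for f
      by (rule loc_int_mult_bounded[OF that borel_measurable_continuous_onI[OF c] M, of R]) (simp add: G0)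
    have "(LINT x|lborel. (u x + c * u2 x) * (G x \<bullet> h))
      = (LINT x|lborel. u x * (G x \<bullet> h)) + c * (LINT x|lborel. u2 x * (G x \<bullet> h))"
      using i[OF u(1)] i[OF u2(1)] by (simp add: distrib_right mult.assoc)
    also have "\<dots> = - ((LINT x|lborel. w x * \<phi> x) + c * (LINT x|lborel. w2 x * \<phi> x))"
      using u(3)[OF \<phi> G] u2(3)[OF \<phi> G] by simp
    also have "(LINT x|lborel. w x * \<phi> x) + c * (LINT x|lborel. w2 x * \<phi> x)
      = (LINT x|lborel. (w x + c * w2 x) * \<phi> x)"
      using loc_int_mult_test[OF u(2) \<phi>] loc_int_mult_test[OF u2(2) \<phi>] by (simp add: distrib_right mult.assoc)
    finally show ?thesis .
  qed
  then show ?thesis using loc_int_linear[OF u(1) u2(1)] loc_int_linear[OF u(2) u2(2)]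
    unfolding weak_deriv_def by blast
qed

text \<open>
If \<open>\<phi>\<close> is a test function, so is \<open>\<psi> \<phi>\<close>; the product rule for it, inserted into the definition, is
the product rule for \<open>\<psi> w\<close>.
\<close>
lemma weak_deriv_smooth_mult:
  fixes w :: "'a::euclidean_space \<Rightarrow> real"
  assumes w: "weak_deriv h w z" and \<psi>: "test_function \<psi>" and H: "\<And>x. GDERIV \<psi> x :> H x"
  shows "weak_deriv h (\<lambda>x. \<psi> x * w x) (\<lambda>x. \<psi> x * z x + w x * (H x \<bullet> h))"
proof -
  note wD = weak_derivD[OF w]
  obtain R where R: "\<And>x. R < norm x \<Longrightarrow> \<psi> x = 0" using test_function_support[OF \<psi>] by metis
  have cH: "continuous_on UNIV (\<lambda>x. H x \<bullet> h)"
    using test_function_gradient(1)[OF \<psi> H R] by (intro continuous_intros)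
  have l1: "loc_int (\<lambda>x. \<psi> x * w x)" and l2: "loc_int (\<lambda>x. \<psi> x * z x)" and l3: "loc_int (\<lambda>x. w x * (H x \<bullet> h))"
    using loc_int_mult_continuous[OF wD(1) test_function_continuous[OF \<psi>]]
      loc_int_mult_continuous[OF wD(2) test_function_continuous[OF \<psi>]]
      loc_int_mult_continuous[OF wD(1) cH] by (simp_all add: mult.commute)
  have "loc_int (\<lambda>x. \<psi> x * z x + w x * (H x \<bullet> h))"
    using loc_int_linear[OF l2 l3, of 1] by simp
  moreover have "(LINT x|lborel. \<psi> x * w x * (G x \<bullet> h)) = - (LINT x|lborel. (\<psi> x * z x + w x * (H x \<bullet> h)) * \<phi> x)"
    if \<phi>: "test_function \<phi>" and G: "\<And>x. GDERIV \<phi> x :> G x" for \<phi> G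
  proof -
    have t: "test_function (\<lambda>x. \<psi> x * \<phi> x)"
      using \<psi> by (intro test_function_smooth_mult \<phi>) (simp add: test_function_def)
    have d: "GDERIV (\<lambda>x. \<psi> x * \<phi> x) x :> \<psi> x *\<^sub>R G x + \<phi> x *\<^sub>R H x" for x
      by (rule GDERIV_mult[OF H G])
    have i2: "integrable lborel (\<lambda>x. \<psi> x * z x * \<phi> x)" "integrable lborel (\<lambda>x. w x * (H x \<bullet> h) * \<phi> x)"
      by (rule loc_int_mult_test[OF _ \<phi>], rule l2 l3)+
    have i1: "integrable lborel (\<lambda>x. \<psi> x * w x * (G x \<bullet> h))"
    proof -
      obtain R' where R': "\<And>x. R' < norm x \<Longrightarrow> \<phi> x = 0" using test_function_support[OF \<phi>] by metis
      have c: "continuous_on UNIV (\<lambda>x. \<psi> x * (G x \<bullet> h))"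
        using test_function_gradient(1)[OF \<phi> G R'] test_function_continuous[OF \<psi>]
        by (intro continuous_intros)
      obtain M where M: "\<And>x. \<bar>\<psi> x * (G x \<bullet> h)\<bar> \<le> M"
        using bounded_of_compact_support[OF c, of R] R by (metis mult_zero_left real_norm_def)
      have "integrable lborel (\<lambda>x. w x * (\<psi> x * (G x \<bullet> h)))"
        by (rule loc_int_mult_bounded[OF wD(1) borel_measurable_continuous_onI[OF c] M, of R]) (simp add: R)
      then show ?thesis by (simp add: mult_ac)
    qed
    have "- (LINT x|lborel. z x * (\<psi> x * \<phi> x)) = (LINT x|lborel. w x * ((\<psi> x *\<^sub>R G x + \<phi> x *\<^sub>R H x) \<bullet> h))"
      using wD(3)[OF t d] by simp
    also have "\<dots> = (LINT x|lborel. \<psi> x * w x * (G x \<bullet> h) + w x * (H x \<bullet> h) * \<phi> x)"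
      by (simp add: inner_add_left algebra_simps)
    also have "\<dots> = (LINT x|lborel. \<psi> x * w x * (G x \<bullet> h)) + (LINT x|lborel. w x * (H x \<bullet> h) * \<phi> x)"
      using i1 i2(2) by simp
    finally have "(LINT x|lborel. \<psi> x * w x * (G x \<bullet> h))
      = - ((LINT x|lborel. \<psi> x * z x * \<phi> x) + (LINT x|lborel. w x * (H x \<bullet> h) * \<phi> x))"
      by (simp add: mult_ac)
    also have "(LINT x|lborel. \<psi> x * z x * \<phi> x) + (LINT x|lborel. w x * (H x \<bullet> h) * \<phi> x)
      = (LINT x|lborel. (\<psi> x * z x + w x * (H x \<bullet> h)) * \<phi> x)"
      using i2 by (simp add: distrib_right)
    finally show ?thesis .
  qed
  ultimately show ?thesis using l1 unfolding weak_deriv_def by blast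
qed

lemma locally_integrable_measurable:
  fixes f :: "'a::euclidean_space \<Rightarrow> 'b::{banach, second_countable_topology}"
  assumes "locally_integrable f"
  shows "f \<in> borel_measurable lebesgue"
proof (rule borel_measurable_LIMSEQ_metric)
  show "(\<lambda>x. indicator (cball 0 (real n)) x *\<^sub>R f x) \<in> borel_measurable lebesgue" for n
    using assms unfolding locally_integrable_def set_integrable_def
    by (intro borel_measurable_integrable) (use compact_cball in blast)
  fix x :: 'a
  have "\<forall>\<^sub>F n in sequentially. norm x \<le> real n"
    using eventually_ge_at_top[of "nat \<lceil>norm x\<rceil>"] by eventually_elim linarith
  then have "\<forall>\<^sub>F n in sequentially. indicator (cball 0 (real n)) x *\<^sub>R f x = f x"
    by eventually_elim simp
  then show "(\<lambda>n. indicator (cball 0 (real n)) x *\<^sub>R f x) \<longlonglongrightarrow> f x"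
    by (rule tendsto_eventually)
qed

lemma AE_lebesgue_iff: "(AE x in lebesgue. P x) \<longleftrightarrow> (AE x in lborel. P x)"
  by (rule AE_completion_iff)

lemma loc_int_representative:
  fixes f :: "'a::euclidean_space \<Rightarrow> real"
  assumes "locally_integrable f"
  obtains f' where "loc_int f'" "AE x in lebesgue. f x = f' x"
proof -
  obtain f' where f': "f' \<in> borel_measurable lborel" "AE x in lborel. f x = f' x"
    using completion_ex_borel_measurable_real[OF locally_integrable_measurable[OF assms]] by blast
  have [measurable]: "f' \<in> borel_measurable lebesgue" "f \<in> borel_measurable lebesgue"
    using f'(1) locally_integrable_measurable[OF assms] by (auto simp: measurable_completion)
  have ae: "AE x in lebesgue. f x = f' x" using f'(2) by (simp add: AE_lebesgue_iff)
  have "integrable lborel (\<lambda>x. indicator (cball 0 R) x * f' x)" for R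
  proof -
    have "integrable lebesgue (\<lambda>x. indicator (cball 0 R) x * f x)"
      using assms unfolding locally_integrable_def set_integrable_def by auto
    then have "integrable lebesgue (\<lambda>x. indicator (cball 0 R) x * f' x)"
      by (rule integrable_cong_AE_imp) (use ae in \<open>auto intro!: borel_measurable_times borel_measurable_indicator elim: eventually_mono\<close>)
    then show ?thesis
      using f'(1) by (subst (asm) integrable_completion)
        (auto intro!: borel_measurable_times borel_measurable_indicator)
  qed
  then show ?thesis using that[of f'] f'(1) ae by (simp add: loc_int_def)
qed

lemma locally_integrable_cong_AE:
  fixes f g :: "'a::euclidean_space \<Rightarrow> 'b::{banach, second_countable_topology}"
  assumes "locally_integrable f" "AE x in lebesgue. f x = g x" "g \<in> borel_measurable lebesgue"
  shows "locally_integrable g"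
  unfolding locally_integrable_def set_integrable_def
proof (intro allI impI)
  fix K :: "'a set" assume K: "compact K"
  then have "K \<in> sets lebesgue" by (simp add: borel_compact)
  moreover have "integrable lebesgue (\<lambda>x. indicator K x *\<^sub>R f x)"
    using assms(1) K by (auto simp: locally_integrable_def set_integrable_def)
  ultimately show "integrable lebesgue (\<lambda>x. indicator K x *\<^sub>R g x)"
    by (elim integrable_cong_AE_imp) (use assms(2,3) in \<open>auto intro!: borel_measurable_scaleR borel_measurable_indicator elim: eventually_mono\<close>)
qed

lemma loc_int_imp_locally_integrable:
  assumes "loc_int f"
  shows "locally_integrable f"
  unfolding locally_integrable_def set_integrable_def
proof (intro allI impI)
  fix K :: "'a set" assume K: "compact K"
  have f: "f \<in> borel_measurable borel" using assms by (simp add: loc_int_def)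
  obtain R where R: "\<And>x. x \<in> K \<Longrightarrow> norm x \<le> R"
    using compact_imp_bounded[OF K] by (auto simp: bounded_iff)
  have m: "(\<lambda>x. indicator K x *\<^sub>R f x) \<in> borel_measurable borel"
    using f K by (intro borel_measurable_scaleR borel_measurable_indicator) (auto simp: borel_compact)
  have "integrable lborel (\<lambda>x. indicator K x *\<^sub>R f x)"
    by (rule Bochner_Integration.integrable_bound[of _ "\<lambda>x. indicator (cball 0 R) x * f x"])
      (use assms m R in \<open>auto simp: loc_int_def indicator_def\<close>)
  then show "integrable lebesgue (\<lambda>x. indicator K x *\<^sub>R f x)"
    using m by (subst integrable_completion) auto
qed

lemma locally_integrable_inner:
  assumes "locally_integrable v"
  shows "locally_integrable (\<lambda>x. v x \<bullet> b)"
  unfolding locally_integrable_def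
proof (intro allI impI)
  fix K :: "'a set" assume "compact K"
  then have "integrable lebesgue (\<lambda>x. (indicator K x *\<^sub>R v x) \<bullet> b)"
    using assms by (intro integrable_inner_left) (auto simp: locally_integrable_def set_integrable_def)
  then show "set_integrable lebesgue K (\<lambda>x. v x \<bullet> b)" by (simp add: set_integrable_def)
qed

lemma loc_int_sum:
  assumes "finite I" "\<And>i. i \<in> I \<Longrightarrow> loc_int (f i)"
  shows "loc_int (\<lambda>x. \<Sum>i\<in>I. c i * f i x)"
  using assms
proof (induction I rule: finite_induct)
  case empty
  then show ?case by (simp add: loc_int_def)
next
  case (insert i I)
  have "loc_int (\<lambda>x. (\<Sum>i\<in>I. c i * f i x) + c i * f i x)"
    by (intro loc_int_linear insert) (use insert in auto)
  then show ?case using insert by (simp add: add.commute)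
qed

lemma lebesgue_integral_rep:
  fixes f g :: "'a::euclidean_space \<Rightarrow> real"
  assumes "f \<in> borel_measurable lebesgue" "g \<in> borel_measurable borel" "AE x in lebesgue. f x = g x"
  shows "(LINT x|lebesgue. f x) = (LINT x|lborel. g x)"
proof -
  have "(LINT x|lebesgue. f x) = (LINT x|lebesgue. g x)"
    using assms by (intro integral_cong_AE) (auto simp: measurable_completion)
  then show ?thesis using assms(2) by (simp add: integral_completion)
qed

text \<open>
Passing to Borel representatives makes the results on directional derivatives available for weak
gradients with respect to the completed measure; \<open>has_weak_gradientI_representative\<close> goes back.
\<close>
lemma has_weak_gradient_representative:
  fixes u :: "'a::euclidean_space \<Rightarrow> real"
  assumes uv: "has_weak_gradient u v"
  obtains u' v' where "u' \<in> borel_measurable borel" "v' \<in> borel_measurable borel"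
    "AE x in lebesgue. u x = u' x" "AE x in lebesgue. v x = v' x"
    "\<And>h. weak_deriv h u' (\<lambda>x. v' x \<bullet> h)"
proof -
  have li: "locally_integrable u" "locally_integrable v" using uv by (auto simp: has_weak_gradient_def)
  obtain u' where u': "loc_int u'" "AE x in lebesgue. u x = u' x"
    using loc_int_representative[OF li(1)] .
  have "\<forall>b. \<exists>w. loc_int w \<and> (AE x in lebesgue. v x \<bullet> b = w x)"
    using loc_int_representative[OF locally_integrable_inner[OF li(2)]] by metis
  then obtain w where w: "\<And>b. loc_int (w b)" "\<And>b. AE x in lebesgue. v x \<bullet> b = w b x" by metis
  define v' where "v' x = (\<Sum>b\<in>Basis. w b x *\<^sub>R b)" for x
  have [measurable]: "w b \<in> borel_measurable borel" for b using w(1) by (simp add: loc_int_def)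
  have v'm: "v' \<in> borel_measurable borel" unfolding v'_def by measurable
  have u'm: "u' \<in> borel_measurable borel" using u'(1) by (simp add: loc_int_def)
  have "AE x in lebesgue. \<forall>b\<in>Basis. v x \<bullet> b = w b x"
    by (rule AE_finite_allI) (use w(2) in auto)
  then have v'ae: "AE x in lebesgue. v x = v' x"
  proof eventually_elim
    case (elim x)
    have "v x = (\<Sum>b\<in>Basis. (v x \<bullet> b) *\<^sub>R b)" by (rule euclidean_representation[symmetric])
    also have "\<dots> = v' x" unfolding v'_def using elim by (intro sum.cong) auto
    finally show ?case .
  qed
  have ip: "v' x \<bullet> h = (\<Sum>b\<in>Basis. (h \<bullet> b) * w b x)" for x h
    unfolding v'_def inner_sum_left by (intro sum.cong) (auto simp: inner_commute mult.commute)
  have "weak_deriv h u' (\<lambda>x. v' x \<bullet> h)" for h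
    unfolding weak_deriv_def
  proof (intro conjI allI impI)
    show "loc_int u'" by (rule u')
    show "loc_int (\<lambda>x. v' x \<bullet> h)" unfolding ip by (rule loc_int_sum) (use w in auto)
    fix \<phi> :: "'a \<Rightarrow> real" and G assume "test_function \<phi> \<and> (\<forall>x. GDERIV \<phi> x :> G x)"
    then have \<phi>: "test_function \<phi>" and G: "\<And>x. GDERIV \<phi> x :> G x" by auto
    obtain R where R: "\<And>x. R < norm x \<Longrightarrow> \<phi> x = 0" using test_function_support[OF \<phi>] by metis
    have Gc: "continuous_on UNIV G" by (rule test_function_gradient(1)[OF \<phi> G R])
    have tG: "test_function (\<lambda>x. G x \<bullet> b)" if "b \<in> Basis" for b
      using test_function_gradient(3)[OF \<phi> G R] that by blast
    have [measurable]: "\<phi> \<in> borel_measurable borel" "G \<in> borel_measurable borel"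
      using Gc test_function_continuous[OF \<phi>] by (auto intro: borel_measurable_continuous_onI)
    have um: "u \<in> borel_measurable lebesgue" and vm: "v \<in> borel_measurable lebesgue"
      using li locally_integrable_measurable by auto
    have \<phi>m: "\<phi> \<in> borel_measurable lebesgue" and Gm: "G \<in> borel_measurable lebesgue"
      by (simp_all add: measurable_completion)
    have bas: "(LINT x|lborel. u' x * (G x \<bullet> b)) = - (LINT x|lborel. w b x * \<phi> x)" if b: "b \<in> Basis" for b
    proof -
      have "(LINT x|lborel. u' x * (G x \<bullet> b)) = (LINT x|lebesgue. u x * (G x \<bullet> b))"
        by (rule lebesgue_integral_rep[symmetric]) (use um Gm u'm u'(2) in \<open>auto elim: eventually_mono\<close>)
      also have "\<dots> = - (LINT x|lebesgue. (v x \<bullet> b) * \<phi> x)"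
        using uv \<phi> G b by (auto simp: has_weak_gradient_def)
      also have "(LINT x|lebesgue. (v x \<bullet> b) * \<phi> x) = (LINT x|lborel. w b x * \<phi> x)"
        by (rule lebesgue_integral_rep) (use vm \<phi>m w(2)[of b] in \<open>auto elim: eventually_mono\<close>)
      finally show ?thesis .
    qed
    have "(LINT x|lborel. u' x * (G x \<bullet> h)) = (LINT x|lborel. (\<Sum>b\<in>Basis. (h \<bullet> b) * (u' x * (G x \<bullet> b))))"
      by (intro Bochner_Integration.integral_cong refl, subst euclidean_inner)
        (simp add: sum_distrib_left mult_ac)
    also have "\<dots> = (\<Sum>b\<in>Basis. (h \<bullet> b) * (LINT x|lborel. u' x * (G x \<bullet> b)))"
      using loc_int_mult_test[OF u'(1) tG] by (subst Bochner_Integration.integral_sum) auto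
    also have "\<dots> = - (\<Sum>b\<in>Basis. (h \<bullet> b) * (LINT x|lborel. w b x * \<phi> x))"
      by (simp add: bas sum_negf)
    also have "(\<Sum>b\<in>Basis. (h \<bullet> b) * (LINT x|lborel. w b x * \<phi> x)) = (LINT x|lborel. (\<Sum>b\<in>Basis. (h \<bullet> b) * (w b x * \<phi> x)))"
      using loc_int_mult_test[OF w(1) \<phi>] by (subst Bochner_Integration.integral_sum) auto
    also have "\<dots> = (LINT x|lborel. (v' x \<bullet> h) * \<phi> x)"
      unfolding ip by (simp add: sum_distrib_right mult.assoc)
    finally show "(LINT x|lborel. u' x * (G x \<bullet> h)) = - (LINT x|lborel. (v' x \<bullet> h) * \<phi> x)" .
  qed
  then show ?thesis using that u'm v'm u'(2) v'ae by blast
qed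

lemma has_weak_gradientI_representative:
  fixes u :: "'a::euclidean_space \<Rightarrow> real"
  assumes b: "u' \<in> borel_measurable borel" "v' \<in> borel_measurable borel"
    and ae: "AE x in lebesgue. u x = u' x" "AE x in lebesgue. v x = v' x"
    and d: "\<And>h. weak_deriv h u' (\<lambda>x. v' x \<bullet> h)"
    and m: "u \<in> borel_measurable lebesgue" "v \<in> borel_measurable lebesgue"
  shows "has_weak_gradient u v"
proof -
  have "locally_integrable u'" using d weak_derivD(1) loc_int_imp_locally_integrable by blast
  then have lu: "locally_integrable u"
    by (rule locally_integrable_cong_AE) (use ae m in \<open>auto elim: eventually_mono\<close>)
  have lvb: "locally_integrable (\<lambda>x. v' x \<bullet> b)" for b
    using d weak_derivD(2) loc_int_imp_locally_integrable by blast
  have "locally_integrable v'"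
    unfolding locally_integrable_def set_integrable_def
  proof (intro allI impI)
    fix K :: "'a set" assume "compact K"
    then have "integrable lebesgue (\<lambda>x. \<Sum>b\<in>Basis. (indicator K x *\<^sub>R (v' x \<bullet> b)) *\<^sub>R b)"
      using lvb by (intro Bochner_Integration.integrable_sum integrable_scaleR_left) (auto simp: locally_integrable_def set_integrable_def)
    moreover have "(\<Sum>b\<in>Basis. (indicator K x *\<^sub>R (v' x \<bullet> b)) *\<^sub>R b) = indicator K x *\<^sub>R v' x" for x
    proof -
      have "(\<Sum>b\<in>Basis. (indicator K x *\<^sub>R (v' x \<bullet> b)) *\<^sub>R b) = indicator K x *\<^sub>R (\<Sum>b\<in>Basis. (v' x \<bullet> b) *\<^sub>R b)"
        by (simp add: scaleR_sum_right)
      then show ?thesis by (simp add: euclidean_representation)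
    qed
    ultimately show "integrable lebesgue (\<lambda>x. indicator K x *\<^sub>R v' x)" by simp
  qed
  then have lv: "locally_integrable v"
    by (rule locally_integrable_cong_AE) (use ae m in \<open>auto elim: eventually_mono\<close>)
  have "(LINT x|lebesgue. u x * (G x \<bullet> h)) = - (LINT x|lebesgue. (v x \<bullet> h) * \<phi> x)"
    if \<phi>: "test_function \<phi>" and G: "\<And>x. GDERIV \<phi> x :> G x" for \<phi> G h
  proof -
    obtain R where R: "\<And>x. R < norm x \<Longrightarrow> \<phi> x = 0" using test_function_support[OF \<phi>] by metis
    have Gc: "continuous_on UNIV G" by (rule test_function_gradient(1)[OF \<phi> G R])
    have \<phi>G: "\<phi> \<in> borel_measurable borel" "G \<in> borel_measurable borel"
      using Gc test_function_continuous[OF \<phi>] by (auto intro: borel_measurable_continuous_onI)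
    then have \<phi>Gm: "\<phi> \<in> borel_measurable lebesgue" "G \<in> borel_measurable lebesgue"
      by (simp_all add: measurable_completion)
    have "(LINT x|lebesgue. u x * (G x \<bullet> h)) = (LINT x|lborel. u' x * (G x \<bullet> h))"
      by (rule lebesgue_integral_rep) (use m \<phi>G \<phi>Gm b ae in \<open>auto elim: eventually_mono\<close>)
    also have "\<dots> = - (LINT x|lborel. (v' x \<bullet> h) * \<phi> x)"
      by (rule weak_derivD(3)[OF d \<phi> G])
    also have "(LINT x|lborel. (v' x \<bullet> h) * \<phi> x) = (LINT x|lebesgue. (v x \<bullet> h) * \<phi> x)"
      by (rule lebesgue_integral_rep[symmetric]) (use m \<phi>G \<phi>Gm b ae in \<open>auto elim: eventually_mono\<close>)
    finally show ?thesis .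
  qed
  then show ?thesis using lu lv by (auto simp: has_weak_gradient_def)
qed

lemma has_weak_gradient_unique:
  fixes u :: "'a::euclidean_space \<Rightarrow> real"
  assumes "has_weak_gradient u v1" "has_weak_gradient u v2"
  shows "AE x in lebesgue. v1 x = v2 x"
proof -
  obtain u1 w1 where 1: "u1 \<in> borel_measurable borel" "w1 \<in> borel_measurable borel"
    "AE x in lebesgue. u x = u1 x" "AE x in lebesgue. v1 x = w1 x" "\<And>h. weak_deriv h u1 (\<lambda>x. w1 x \<bullet> h)"
    by (rule has_weak_gradient_representative[OF assms(1)]) blast
  obtain u2 w2 where 2: "u2 \<in> borel_measurable borel" "w2 \<in> borel_measurable borel"
    "AE x in lebesgue. u x = u2 x" "AE x in lebesgue. v2 x = w2 x" "\<And>h. weak_deriv h u2 (\<lambda>x. w2 x \<bullet> h)"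
    by (rule has_weak_gradient_representative[OF assms(2)]) blast
  have u12: "AE x in lborel. u1 x = u2 x"
    using 1(3) 2(3) unfolding AE_lebesgue_iff by eventually_elim simp
  have "AE x in lborel. (w1 x \<bullet> b) + (-1) * (w2 x \<bullet> b) = 0" for b
  proof (rule fundamental_lemma)
    show "loc_int (\<lambda>x. (w1 x \<bullet> b) + (-1) * (w2 x \<bullet> b))"
      by (intro loc_int_linear weak_derivD(2)[OF 1(5)] weak_derivD(2)[OF 2(5)])
    fix \<phi> :: "'a \<Rightarrow> real" assume \<phi>: "test_function \<phi>"
    obtain G where G: "\<And>x. GDERIV \<phi> x :> G x" by (rule test_function_GDERIV[OF \<phi>]) blast
    obtain R where R: "\<And>x. R < norm x \<Longrightarrow> \<phi> x = 0" using test_function_support[OF \<phi>] by metis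
    have Gc: "G \<in> borel_measurable borel"
      by (rule borel_measurable_continuous_onI[OF test_function_gradient(1)[OF \<phi> G R]])
    have "(LINT x|lborel. u1 x * (G x \<bullet> b)) = (LINT x|lborel. u2 x * (G x \<bullet> b))"
      by (rule integral_cong_AE) (use 1(1) 2(1) Gc u12 in \<open>auto elim: eventually_mono\<close>)
    then have "(LINT x|lborel. (w1 x \<bullet> b) * \<phi> x) = (LINT x|lborel. (w2 x \<bullet> b) * \<phi> x)"
      using weak_derivD(3)[OF 1(5) \<phi> G] weak_derivD(3)[OF 2(5) \<phi> G] by simp
    then show "(LINT x|lborel. ((w1 x \<bullet> b) + (-1) * (w2 x \<bullet> b)) * \<phi> x) = 0"
      using loc_int_mult_test[OF weak_derivD(2)[OF 1(5)[of b]] \<phi>] loc_int_mult_test[OF weak_derivD(2)[OF 2(5)[of b]] \<phi>]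
      by (simp add: left_diff_distrib)
  qed
  then have "AE x in lborel. \<forall>b\<in>Basis. w1 x \<bullet> b = w2 x \<bullet> b"
    by (intro AE_finite_allI) auto
  then have "AE x in lborel. w1 x = w2 x" by eventually_elim (rule euclidean_eqI, blast)
  then show ?thesis using 1(4) 2(4) unfolding AE_lebesgue_iff by eventually_elim simp
qed

lemma weak_grad_AE:
  assumes "has_weak_gradient u v"
  shows "AE x in lebesgue. weak_grad u x = v x"
  using assms has_weak_gradient_unique someI[of "has_weak_gradient u" v]
  unfolding weak_grad_def by blast

lemma has_weak_gradient_measurable:
  assumes "has_weak_gradient u v"
  shows "u \<in> borel_measurable lebesgue" "v \<in> borel_measurable lebesgue"
  using assms locally_integrable_measurable by (auto simp: has_weak_gradient_def)

lemma has_weak_gradient_pos_part: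
  fixes u :: "'a::euclidean_space \<Rightarrow> real"
  assumes uv: "has_weak_gradient u v"
  shows "has_weak_gradient (\<lambda>x. max 0 (u x)) (\<lambda>x. if 0 < u x then v x else 0)"
proof -
  note [measurable] = has_weak_gradient_measurable[OF uv]
  obtain u' v' where r: "u' \<in> borel_measurable borel" "v' \<in> borel_measurable borel"
    "AE x in lebesgue. u x = u' x" "AE x in lebesgue. v x = v' x" "\<And>h. weak_deriv h u' (\<lambda>x. v' x \<bullet> h)"
    by (rule has_weak_gradient_representative[OF uv]) blast
  note [measurable] = r(1,2)
  show ?thesis
  proof (rule has_weak_gradientI_representative)
    show "(\<lambda>x. max 0 (u' x)) \<in> borel_measurable borel" "(\<lambda>x. if 0 < u' x then v' x else 0) \<in> borel_measurable borel"
      by measurable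
    show "AE x in lebesgue. max 0 (u x) = max 0 (u' x)" using r(3) by eventually_elim simp
    show "AE x in lebesgue. (if 0 < u x then v x else 0) = (if 0 < u' x then v' x else 0)"
      using r(3,4) by eventually_elim simp
    show "weak_deriv h (\<lambda>x. max 0 (u' x)) (\<lambda>x. (if 0 < u' x then v' x else 0) \<bullet> h)" for h
      using weak_deriv_pos_part[OF r(5)[of h]] by (simp add: if_distrib[of "\<lambda>y. y \<bullet> h"] cong: if_cong)
  qed measurable
qed

lemma has_weak_gradient_linear:
  fixes u :: "'a::euclidean_space \<Rightarrow> real"
  assumes uv: "has_weak_gradient u v" and uv2: "has_weak_gradient u2 v2"
  shows "has_weak_gradient (\<lambda>x. u x + c * u2 x) (\<lambda>x. v x + c *\<^sub>R v2 x)"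
proof -
  note [measurable] = has_weak_gradient_measurable[OF uv] has_weak_gradient_measurable[OF uv2]
  obtain u' v' where r: "u' \<in> borel_measurable borel" "v' \<in> borel_measurable borel"
    "AE x in lebesgue. u x = u' x" "AE x in lebesgue. v x = v' x" "\<And>h. weak_deriv h u' (\<lambda>x. v' x \<bullet> h)"
    by (rule has_weak_gradient_representative[OF uv]) blast
  obtain u2' v2' where r2: "u2' \<in> borel_measurable borel" "v2' \<in> borel_measurable borel"
    "AE x in lebesgue. u2 x = u2' x" "AE x in lebesgue. v2 x = v2' x" "\<And>h. weak_deriv h u2' (\<lambda>x. v2' x \<bullet> h)"
    by (rule has_weak_gradient_representative[OF uv2]) blast
  note [measurable] = r(1,2) r2(1,2)
  show ?thesis
  proof (rule has_weak_gradientI_representative)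
    show "(\<lambda>x. u' x + c * u2' x) \<in> borel_measurable borel" "(\<lambda>x. v' x + c *\<^sub>R v2' x) \<in> borel_measurable borel"
      by measurable
    show "AE x in lebesgue. u x + c * u2 x = u' x + c * u2' x" using r(3) r2(3) by eventually_elim simp
    show "AE x in lebesgue. v x + c *\<^sub>R v2 x = v' x + c *\<^sub>R v2' x" using r(4) r2(4) by eventually_elim simp
    show "weak_deriv h (\<lambda>x. u' x + c * u2' x) (\<lambda>x. (v' x + c *\<^sub>R v2' x) \<bullet> h)" for h
      using weak_deriv_linear[OF r(5)[of h] r2(5)[of h]] by (simp add: inner_add_left)
  qed measurable
qed

lemma has_weak_gradient_smooth_mult:
  fixes w :: "'a::euclidean_space \<Rightarrow> real"
  assumes wv: "has_weak_gradient w v" and \<psi>: "test_function \<psi>" and H: "\<And>x. GDERIV \<psi> x :> H x"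
  shows "has_weak_gradient (\<lambda>x. \<psi> x * w x) (\<lambda>x. \<psi> x *\<^sub>R v x + w x *\<^sub>R H x)"
proof -
  note [measurable] = has_weak_gradient_measurable[OF wv]
  obtain w' v' where r: "w' \<in> borel_measurable borel" "v' \<in> borel_measurable borel"
    "AE x in lebesgue. w x = w' x" "AE x in lebesgue. v x = v' x" "\<And>h. weak_deriv h w' (\<lambda>x. v' x \<bullet> h)"
    by (rule has_weak_gradient_representative[OF wv]) blast
  obtain R where R: "\<And>x. R < norm x \<Longrightarrow> \<psi> x = 0" using test_function_support[OF \<psi>] by metis
  have \<psi>H [measurable]: "\<psi> \<in> borel_measurable borel" "H \<in> borel_measurable borel"
    using test_function_gradient(1)[OF \<psi> H R] test_function_continuous[OF \<psi>]
    by (auto intro: borel_measurable_continuous_onI)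
  then have [measurable]: "\<psi> \<in> borel_measurable lebesgue" "H \<in> borel_measurable lebesgue"
    by (simp_all add: measurable_completion)
  note [measurable] = r(1,2)
  show ?thesis
  proof (rule has_weak_gradientI_representative)
    show "(\<lambda>x. \<psi> x * w' x) \<in> borel_measurable borel" "(\<lambda>x. \<psi> x *\<^sub>R v' x + w' x *\<^sub>R H x) \<in> borel_measurable borel"
      by measurable
    show "AE x in lebesgue. \<psi> x * w x = \<psi> x * w' x" using r(3) by eventually_elim simp
    show "AE x in lebesgue. \<psi> x *\<^sub>R v x + w x *\<^sub>R H x = \<psi> x *\<^sub>R v' x + w' x *\<^sub>R H x"
      using r(3,4) by eventually_elim simp
    show "weak_deriv h (\<lambda>x. \<psi> x * w' x) (\<lambda>x. (\<psi> x *\<^sub>R v' x + w' x *\<^sub>R H x) \<bullet> h)" for h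
      using weak_deriv_smooth_mult[OF r(5)[of h] \<psi> H] by (simp add: inner_add_left)
  qed measurable
qed

lemma nn_integral_lebesgue_set_integral:
  fixes f g :: "'a::euclidean_space \<Rightarrow> real"
  assumes K: "K \<in> sets borel" and f: "set_integrable lebesgue K f" "\<And>x. 0 \<le> f x"
    and g: "g \<in> borel_measurable borel" "AE x in lebesgue. f x = g x"
  shows "(\<integral>\<^sup>+x. indicator K x * ennreal (g x) \<partial>lborel) = ennreal (LINT x:K|lebesgue. f x)"
proof -
  have "(\<integral>\<^sup>+x. indicator K x * ennreal (g x) \<partial>lborel) = (\<integral>\<^sup>+x. indicator K x * ennreal (g x) \<partial>lebesgue)"
    by (rule nn_integral_completion[symmetric])
  also have "\<dots> = (\<integral>\<^sup>+x. ennreal (indicator K x *\<^sub>R f x) \<partial>lebesgue)"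
    by (rule nn_integral_cong_AE) (use g(2) in eventually_elim, auto simp: indicator_def)
  also have "\<dots> = ennreal (LINT x:K|lebesgue. f x)"
    unfolding set_lebesgue_integral_def
    by (rule nn_integral_eq_integral) (use f in \<open>auto simp: set_integrable_def\<close>)
  finally show ?thesis .
qed

text \<open>
The form of \<open>Poincare_convex\<close> for weak gradients. It is a Poincare
inequality if the set where \<open>u\<close> is small is large, and a Faber-Krahn inequality if \<open>s\<close> is small.
\<close>
lemma Poincare_ball:
  fixes u :: "'a::euclidean_space \<Rightarrow> real"
  assumes uv: "has_weak_gradient u v"
    and iu: "set_integrable lebesgue (ball a R) (\<lambda>x. (u x)\<^sup>2)"
    and iv: "set_integrable lebesgue (ball a R) (\<lambda>x. (norm (v x))\<^sup>2)"
    and Y [measurable]: "Y \<in> sets borel" and YK: "Y \<subseteq> ball a R"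
    and m: "0 \<le> m" "\<And>p. p \<in> ball a R \<Longrightarrow> m \<le> measure lebesgue {z \<in> Y. dist p z < s \<and> \<bar>u z\<bar> \<le> \<kappa>}"
  shows "m * (LINT x:ball a R|lebesgue. (u x)\<^sup>2)
    \<le> measure lebesgue (ball (0::'a) s) * (2 * s\<^sup>2 * (LINT x:ball a R|lebesgue. (norm (v x))\<^sup>2))
        + 2 * \<kappa>\<^sup>2 * (measure lebesgue Y * measure lebesgue (ball a R))"
proof -
  note [measurable] = has_weak_gradient_measurable[OF uv]
  obtain u' v' where r: "u' \<in> borel_measurable borel" "v' \<in> borel_measurable borel"
    "AE x in lebesgue. u x = u' x" "AE x in lebesgue. v x = v' x" "\<And>h. weak_deriv h u' (\<lambda>x. v' x \<bullet> h)"
    by (rule has_weak_gradient_representative[OF uv]) blast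
  note [measurable] = r(1,2)
  have [measurable]: "ball a R \<in> sets borel" "ball a R \<in> sets lebesgue" by auto
  have "ennreal m \<le> emeasure lborel {z \<in> Y. dist p z < s \<and> \<bar>u' z\<bar> \<le> \<kappa>}" if p: "p \<in> ball a R" for p
  proof -
    have [measurable]: "ball p s \<in> sets lebesgue" "ball p s \<in> sets borel" "Y \<in> sets lebesgue" using Y by auto
    have e: "{z \<in> Y. dist p z < s \<and> \<bar>f z\<bar> \<le> \<kappa>} = Y \<inter> ball p s \<inter> {z. \<bar>f z\<bar> \<le> \<kappa>}" for f :: "'a \<Rightarrow> real"
      by auto
    have s1: "{z \<in> Y. dist p z < s \<and> \<bar>u z\<bar> \<le> \<kappa>} \<in> sets lebesgue"
      unfolding e using measurable_sets_Collect[of "\<lambda>z. \<bar>u z\<bar>" lebesgue borel "\<lambda>y. y \<le> \<kappa>"] by measurable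
    have s2: "{z \<in> Y. dist p z < s \<and> \<bar>u' z\<bar> \<le> \<kappa>} \<in> sets borel"
      unfolding e by measurable
    have "emeasure lebesgue {z \<in> Y. dist p z < s \<and> \<bar>u z\<bar> \<le> \<kappa>} < \<infinity>"
      by (rule le_less_trans[OF emeasure_mono[of _ "ball a R"]]) (use YK emeasure_lborel_ball_finite[of a R] in auto)
    then have ne: "emeasure lebesgue {z \<in> Y. dist p z < s \<and> \<bar>u z\<bar> \<le> \<kappa>} \<noteq> top" by auto
    have "ennreal m \<le> ennreal (measure lebesgue {z \<in> Y. dist p z < s \<and> \<bar>u z\<bar> \<le> \<kappa>})"
      by (rule ennreal_leI[OF m(2)[OF p]])
    also have "\<dots> = emeasure lebesgue {z \<in> Y. dist p z < s \<and> \<bar>u z\<bar> \<le> \<kappa>}"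
      by (rule emeasure_eq_ennreal_measure[OF ne, symmetric])
    also have "\<dots> = emeasure lebesgue {z \<in> Y. dist p z < s \<and> \<bar>u' z\<bar> \<le> \<kappa>}"
    proof (rule emeasure_eq_AE[OF _ s1])
      show "AE z in lebesgue. z \<in> {z \<in> Y. dist p z < s \<and> \<bar>u z\<bar> \<le> \<kappa>}
          \<longleftrightarrow> z \<in> {z \<in> Y. dist p z < s \<and> \<bar>u' z\<bar> \<le> \<kappa>}"
        using r(3) by eventually_elim simp
      show "{z \<in> Y. dist p z < s \<and> \<bar>u' z\<bar> \<le> \<kappa>} \<in> sets lebesgue"
        using s2 by simp
    qed
    finally show ?thesis using s2 by simp
  qed
  note P = Poincare_convex[OF r(5) r(2,1) convex_ball _ Y YK this]
  have e1: "(\<integral>\<^sup>+x. indicator (ball a R) x * ennreal ((u' x)\<^sup>2) \<partial>lborel) = ennreal (LINT x:ball a R|lebesgue. (u x)\<^sup>2)"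
    by (rule nn_integral_lebesgue_set_integral) (use iu r in \<open>auto elim: eventually_mono\<close>)
  have e2: "(\<integral>\<^sup>+x. indicator (ball a R) x * ennreal ((norm (v' x))\<^sup>2) \<partial>lborel) = ennreal (LINT x:ball a R|lebesgue. (norm (v x))\<^sup>2)"
    by (rule nn_integral_lebesgue_set_integral) (use iv r in \<open>auto elim: eventually_mono\<close>)
  have e3: "emeasure lborel (ball x t) = ennreal (measure lebesgue (ball x t))" for x :: 'a and t
  proof -
    have "emeasure lborel (ball x t) \<noteq> top" using emeasure_lborel_ball_finite[of x t] by auto
    then have "emeasure lborel (ball x t) = ennreal (measure lborel (ball x t))"
      by (rule emeasure_eq_ennreal_measure)
    then show ?thesis by simp
  qed
  have eY: "emeasure lborel Y = ennreal (measure lebesgue Y)"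
  proof -
    have "emeasure lborel Y \<le> emeasure lborel (ball a R)" by (rule emeasure_mono[OF YK]) simp
    then have "emeasure lborel Y \<noteq> top" by (rule neq_top_trans[rotated]) (simp add: e3)
    then have "emeasure lborel Y = ennreal (measure lborel Y)" by (rule emeasure_eq_ennreal_measure)
    then show ?thesis by simp
  qed
  have n: "0 \<le> (LINT x:ball a R|lebesgue. (u x)\<^sup>2)" "0 \<le> (LINT x:ball a R|lebesgue. (norm (v x))\<^sup>2)"
    unfolding set_lebesgue_integral_def by (intro Bochner_Integration.integral_nonneg; simp)+
  have two: "(2::ennreal) = ennreal 2" by simp
  have "ennreal (m * (LINT x:ball a R|lebesgue. (u x)\<^sup>2))
    \<le> ennreal (measure lebesgue (ball (0::'a) s) * (2 * s\<^sup>2 * (LINT x:ball a R|lebesgue. (norm (v x))\<^sup>2))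
        + 2 * \<kappa>\<^sup>2 * (measure lebesgue Y * measure lebesgue (ball a R)))"
    using P[simplified] n m(1) unfolding e1 e2 e3 eY two
    by (simp add: ennreal_mult[symmetric] ennreal_plus[symmetric] del: ennreal_plus ennreal_numeral)
  then show ?thesis using n by (subst (asm) ennreal_le_iff) auto
qed

section \<open>Cutoff functions and competitors\<close>

lemma C_k_inverse:
  fixes f :: "'a::euclidean_space \<Rightarrow> real"
  shows "C_k k f \<Longrightarrow> (\<And>x. f x \<noteq> 0) \<Longrightarrow> C_k k (\<lambda>x. inverse (f x))"
proof (induction k)
  case 0
  then show ?case by (auto intro!: continuous_intros)
next
  case (Suc k)
  obtain F where F: "\<And>x. GDERIV f x :> F x" "\<And>b. b \<in> Basis \<Longrightarrow> C_k k (\<lambda>x. F x \<bullet> b)"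
    by (rule C_k_SucE[OF Suc.prems(1)]) blast
  have inv: "C_k k (\<lambda>x. inverse (f x))"
    by (rule Suc.IH[OF C_k_SucD[OF Suc.prems(1)] Suc.prems(2)])
  show ?case
  proof (rule C_k_SucI)
    show "GDERIV (\<lambda>x. inverse (f x)) x :> (- (inverse (f x))\<^sup>2) *\<^sub>R F x" for x
      by (rule GDERIV_inverse[OF F(1) Suc.prems(2)])
    show "C_k k (\<lambda>x. (- (inverse (f x))\<^sup>2) *\<^sub>R F x \<bullet> b)" if b: "b \<in> Basis" for b
    proof -
      have "C_k k (\<lambda>x. (-1) * ((inverse (f x) * inverse (f x)) * (F x \<bullet> b)))"
        by (rule C_k_mult[OF C_k_const C_k_mult[OF C_k_mult[OF inv inv] F(2)[OF b]]])
      then show ?thesis by (simp add: power2_eq_square)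
    qed
  qed
qed

text \<open>
A smooth transition from \<open>0\<close> on the negative half line to \<open>1\<close> beyond \<open>1\<close>.
\<close>
definition smooth_step :: "real \<Rightarrow> real" where
  "smooth_step t = flat 0 t * inverse (flat 0 t + flat 0 (1 - t))"

lemma flat_0_sum_pos: "0 < flat 0 t + flat 0 (1 - t)"
  by (cases "0 < t") (auto simp: flat_def add_pos_nonneg)

lemma C_k_smooth_step: "C_k k smooth_step"
proof -
  have "C_k k (\<lambda>t::real. 1 + (-1) * (t \<bullet> 1))" by (intro C_k_add C_k_mult C_k_const C_k_inner)
  then have "C_k k (\<lambda>t::real. 1 - t)" by simp
  then have "C_k k (\<lambda>t. flat 0 (1 - t))" by (rule C_k_compose[OF C_k_flat])
  then have "C_k k (\<lambda>t. inverse (flat 0 t + flat 0 (1 - t)))"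
    using flat_0_sum_pos by (intro C_k_inverse C_k_add C_k_flat) (auto simp: less_le)
  then show ?thesis unfolding smooth_step_def[abs_def] by (rule C_k_mult[OF C_k_flat])
qed

lemma smooth_step_bounds: "0 \<le> smooth_step t" "smooth_step t \<le> 1"
  using flat_0_sum_pos[of t] flat_0_bounds[of t] flat_0_bounds[of "1 - t"]
  by (auto simp: smooth_step_def field_simps)

lemma smooth_step_0: "t \<le> 0 \<Longrightarrow> smooth_step t = 0"
  by (simp add: smooth_step_def flat_def)

lemma smooth_step_1: "1 \<le> t \<Longrightarrow> smooth_step t = 1"
  by (simp add: smooth_step_def flat_def)

lemma smooth_step_deriv:
  obtains D M where "\<And>t. DERIV smooth_step t :> D t" "\<And>t. t < 0 \<Longrightarrow> D t = 0" "0 < M" "\<And>t. \<bar>D t\<bar> \<le> M"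
proof -
  obtain D where D: "\<And>t. GDERIV smooth_step t :> D t" "\<And>b. b \<in> Basis \<Longrightarrow> C_k 0 (\<lambda>t. D t \<bullet> b)"
    by (rule C_k_SucE[OF C_k_smooth_step[of "Suc 0"]]) blast
  have dD: "DERIV smooth_step t :> D t" for t using D(1) by (simp add: GDERIV_real_iff)
  have c: "continuous_on UNIV D" using D(2)[of 1] by simp
  have loc: "D t = 0" if S: "open S" "t \<in> S" "\<And>s. s \<in> S \<Longrightarrow> smooth_step s = c" for t S c
  proof -
    have "\<forall>\<^sub>F s in nhds t. smooth_step s = c"
      using eventually_nhds_in_open[OF S(1,2)] by eventually_elim (rule S(3))
    then have "DERIV smooth_step t :> 0"
      using S by (subst DERIV_cong_ev[OF refl _ refl]) auto
    then show ?thesis using dD DERIV_unique by blast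
  qed
  have neg: "D t = 0" if "t < 0" for t
    by (rule loc[of "{..<0}" t 0]) (use that smooth_step_0 in auto)
  have pos: "D t = 0" if "1 < t" for t
    by (rule loc[of "{1<..}" t 1]) (use that smooth_step_1 in auto)
  have "D t = 0" if "1 < norm t" for t using that neg[of t] pos[of t] by (cases "t < 0") auto
  then obtain M where "0 < M" "\<And>t. norm (D t) \<le> M"
    using bounded_of_compact_support[OF c, of 1] by metis
  then show ?thesis using that[of D M] dD neg by simp
qed

text \<open>
Compose the step with a quadratic polynomial in the distance from \<open>y\<close>. The constant \<open>L\<close> is chosen
before the radii, as the iteration needs cutoffs for infinitely many pairs of them.
\<close>
lemma smooth_cutoff:
  obtains L where "0 < L" "\<And>(y::'a::euclidean_space) \<rho> R. 0 < \<rho> \<Longrightarrow> \<rho> < R \<Longrightarrow>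
    \<exists>\<psi> G. test_function \<psi> \<and> (\<forall>x. GDERIV \<psi> x :> G x) \<and> (\<forall>x. 0 \<le> \<psi> x \<and> \<psi> x \<le> 1) \<and>
      (\<forall>x\<in>ball y \<rho>. \<psi> x = 1) \<and> (\<forall>x. x \<notin> ball y R \<longrightarrow> \<psi> x = 0 \<and> G x = 0) \<and>
      (\<forall>x. norm (G x) \<le> L / (R - \<rho>))"
proof -
  obtain D M where D: "\<And>t. DERIV smooth_step t :> D t" "\<And>t. t < 0 \<Longrightarrow> D t = 0" "0 < M" "\<And>t. \<bar>D t\<bar> \<le> M"
    by (rule smooth_step_deriv) blast
  have "\<exists>\<psi> G. test_function \<psi> \<and> (\<forall>x. GDERIV \<psi> x :> G x) \<and> (\<forall>x. 0 \<le> \<psi> x \<and> \<psi> x \<le> 1) \<and>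
      (\<forall>x\<in>ball y \<rho>. \<psi> x = 1) \<and> (\<forall>x. x \<notin> ball y R \<longrightarrow> \<psi> x = 0 \<and> G x = 0) \<and>
      (\<forall>x. norm (G x) \<le> 4 * M / (R - \<rho>))"
    if \<rho>: "0 < \<rho>" "\<rho> < R" for y :: 'a and \<rho> R
  proof -
    \<comment> \<open>an intermediate radius, so that the gradient vanishes on the sphere of radius
      \<open>R\<close> as well\<close>
    define T where "T = (\<rho> + R) / 2"
    have T: "\<rho> < T" "T < R" "0 < T" "T - \<rho> = (R - \<rho>) / 2" using \<rho> by (auto simp: T_def field_simps)
    define d where "d = T\<^sup>2 - \<rho>\<^sup>2"
    have d: "0 < d" using T \<rho> by (simp add: d_def power_strict_mono)
    define q where "q x = (T\<^sup>2 - (x - y) \<bullet> (x - y)) / d" for x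
    define \<psi> where "\<psi> x = smooth_step (q x)" for x
    define G where "G x = D (q x) *\<^sub>R ((- 2 / d) *\<^sub>R (x - y))" for x
    have q0: "q x < 0" if "T < dist y x" for x
    proof -
      have "T\<^sup>2 < (norm (x - y))\<^sup>2" using that T by (intro power_strict_mono) (auto simp: dist_norm norm_minus_commute)
      then show ?thesis using d by (simp add: q_def power2_norm_eq_inner divide_less_0_iff)
    qed
    have q1: "1 \<le> q x" if "dist y x < \<rho>" for x
    proof -
      have "(norm (x - y))\<^sup>2 \<le> \<rho>\<^sup>2" using that by (intro power_mono) (auto simp: dist_norm norm_minus_commute)
      then show ?thesis using d by (simp add: q_def d_def power2_norm_eq_inner)
    qed
    have qk: "C_k k q" for k
    proof -
      have "C_k k (\<lambda>x::'a. inverse d * (T\<^sup>2 + (-1) * (\<Sum>b\<in>Basis. (x \<bullet> b + (- (y \<bullet> b))) * (x \<bullet> b + (- (y \<bullet> b))))))"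
        by (intro C_k_mult[OF C_k_const] C_k_add[OF C_k_const] C_k_sum, rule C_k_mult)
          (rule C_k_add[OF C_k_inner C_k_const])+
      moreover have "inverse d * (T\<^sup>2 + (-1) * (\<Sum>b\<in>Basis. (x \<bullet> b + (- (y \<bullet> b))) * (x \<bullet> b + (- (y \<bullet> b))))) = q x" for x
        unfolding q_def by (subst euclidean_inner) (simp add: inner_diff_left divide_inverse mult.commute)
      ultimately show ?thesis by simp
    qed
    have dq: "GDERIV q x :> (- 2 / d) *\<^sub>R (x - y)" for x
      unfolding gderiv_def q_def
      by (auto intro!: derivative_eq_intros simp: inner_commute inner_diff_left inner_diff_right fun_eq_iff)
        (use d in \<open>simp_all add: diff_divide_distrib\<close>)
    have G: "GDERIV \<psi> x :> G x" for x
      unfolding \<psi>_def G_def by (rule GDERIV_DERIV_compose[OF dq D(1)])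
    have t: "test_function \<psi>"
    proof (rule test_functionI)
      show "C_k k \<psi>" for k unfolding \<psi>_def by (rule C_k_compose[OF C_k_smooth_step qk])
      show "\<psi> x = 0" if "norm y + T < norm x" for x
      proof -
        have "T < dist y x" using that norm_triangle_ineq3[of x y] by (simp add: dist_norm norm_minus_commute)
        then show ?thesis using q0 by (simp add: \<psi>_def smooth_step_0 less_imp_le)
      qed
    qed
    have Gb: "norm (G x) \<le> 4 * M / (R - \<rho>)" for x
    proof (cases "T < dist y x")
      case True
      then show ?thesis using D(2)[OF q0] D(3) \<rho> by (simp add: G_def)
    next
      case False
      then have n: "norm (x - y) \<le> T" by (simp add: dist_norm norm_minus_commute)
      have "norm (G x) = \<bar>D (q x)\<bar> * (2 / d * norm (x - y))" using d by (simp add: G_def abs_mult)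
      also have "\<dots> \<le> M * (2 / d * T)"
        by (intro mult_mono D(4) order_refl n) (use d D(3) in auto)
      also have "\<dots> = 2 * M * (T / ((T - \<rho>) * (T + \<rho>)))" by (simp add: d_def power2_eq_square algebra_simps)
      also have "\<dots> \<le> 2 * M * (1 / (T - \<rho>))"
      proof (intro mult_left_mono)
        have "T / ((T - \<rho>) * (T + \<rho>)) = (T / (T + \<rho>)) * (1 / (T - \<rho>))" by simp
        also have "\<dots> \<le> 1 * (1 / (T - \<rho>))" using T \<rho> by (intro mult_right_mono) auto
        finally show "T / ((T - \<rho>) * (T + \<rho>)) \<le> 1 / (T - \<rho>)" by simp
      qed (use D(3) in auto)
      also have "\<dots> = 4 * M / (R - \<rho>)" unfolding T(4) by simp
      finally show ?thesis .
    qed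
    show ?thesis
    proof (intro exI[of _ \<psi>] exI[of _ G] conjI allI ballI impI)
      fix x
      show "\<psi> x = 1" if "x \<in> ball y \<rho>" using q1 that by (simp add: \<psi>_def smooth_step_1)
      show "\<psi> x = 0" "G x = 0" if "x \<notin> ball y R"
      proof -
        have "q x < 0" using that T by (intro q0) auto
        then show "\<psi> x = 0" "G x = 0" using D(2) by (auto simp: \<psi>_def G_def smooth_step_0)
      qed
    qed (use t G Gb smooth_step_bounds in \<open>auto simp: \<psi>_def\<close>)
  qed
  then show ?thesis using that[of "4 * M"] D(3) by simp
qed


text \<open>
The square in \<open>1 - t\<^sup>2\<close> is what makes the cross term absorbable: it carries a factor \<open>t\<close>, and so is
controlled by \<open>t\<^sup>2 |V|\<^sup>2\<close>, which the first term provides with a negative sign.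
\<close>
lemma cutoff_gradient_bound:
  fixes V G :: "'a::real_inner" and a t :: real
  assumes t: "0 \<le> t" "t \<le> 1" and a: "0 \<le> a"
  shows "(norm ((1 - t\<^sup>2) *\<^sub>R V - (2 * t * a) *\<^sub>R G))\<^sup>2
    \<le> (norm V)\<^sup>2 - t\<^sup>2 / 2 * (norm V)\<^sup>2 + 12 * (a\<^sup>2 * (norm G)\<^sup>2)"
proof -
  have t2: "0 \<le> t\<^sup>2" "t\<^sup>2 \<le> 1" using t by (auto intro: power_le_one)
  define A B where "A = norm V" and "B = a * norm G"
  have AB: "0 \<le> A" "0 \<le> B" using a by (auto simp: A_def B_def)
  have "norm ((1 - t\<^sup>2) *\<^sub>R V - (2 * t * a) *\<^sub>R G) \<le> norm ((1 - t\<^sup>2) *\<^sub>R V) + norm ((2 * t * a) *\<^sub>R G)"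
    by (rule norm_triangle_ineq4)
  also have "\<dots> = (1 - t\<^sup>2) * A + 2 * t * B" using t t2 a by (simp add: A_def B_def abs_mult)
  finally have "(norm ((1 - t\<^sup>2) *\<^sub>R V - (2 * t * a) *\<^sub>R G))\<^sup>2 \<le> ((1 - t\<^sup>2) * A + 2 * t * B)\<^sup>2"
    by (intro power_mono) auto
  also have "\<dots> = (1 - t\<^sup>2)\<^sup>2 * A\<^sup>2 + (1 - t\<^sup>2) * (4 * (t * A) * B) + 4 * t\<^sup>2 * B\<^sup>2"
    by (simp add: power2_eq_square algebra_simps)
  also have "\<dots> \<le> (1 - t\<^sup>2) * A\<^sup>2 + 4 * (t * A) * B + 4 * B\<^sup>2"
  proof (intro add_mono)
    have "(1 - t\<^sup>2)\<^sup>2 \<le> 1 - t\<^sup>2" using t2 by (simp add: power2_eq_square mult_left_le)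
    then show "(1 - t\<^sup>2)\<^sup>2 * A\<^sup>2 \<le> (1 - t\<^sup>2) * A\<^sup>2" by (intro mult_right_mono) auto
    show "(1 - t\<^sup>2) * (4 * (t * A) * B) \<le> 4 * (t * A) * B"
      using mult_right_mono[of "1 - t\<^sup>2" 1 "4 * (t * A) * B"] t t2 AB by simp
    show "4 * t\<^sup>2 * B\<^sup>2 \<le> 4 * B\<^sup>2" using mult_right_mono[OF t2(2), of "4 * B\<^sup>2"] by simp
  qed
  also have "4 * (t * A) * B \<le> (t * A)\<^sup>2 / 2 + 8 * B\<^sup>2"
    using zero_le_power2[of "t * A - 4 * B"] by (simp add: power2_diff power_mult_distrib)
  finally show ?thesis by (simp add: A_def B_def power_mult_distrib algebra_simps)
qed

lemma W12_weak_gradient: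
  assumes "u \<in> W12"
  obtains v where "has_weak_gradient u v" "integrable lebesgue (\<lambda>x. (norm (v x))\<^sup>2)"
  using assms by (auto simp: W12_def)

lemma lebesgue_measurable_borel: "f \<in> borel_measurable borel \<Longrightarrow> f \<in> borel_measurable lebesgue"
  by (simp add: measurable_completion)

lemma integrable_square_mult:
  fixes u :: "'a::euclidean_space \<Rightarrow> real"
  assumes u: "u \<in> borel_measurable lebesgue" "\<And>K. compact K \<Longrightarrow> set_integrable lebesgue K (\<lambda>x. (u x)\<^sup>2)"
    and g: "g \<in> borel_measurable borel" "\<And>x. \<bar>g x\<bar> \<le> M" "\<And>x. x \<notin> ball y R \<Longrightarrow> g x = 0"
  shows "integrable lebesgue (\<lambda>x. (max 0 (u x))\<^sup>2 * g x)"
proof (rule Bochner_Integration.integrable_bound)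
  show "integrable lebesgue (\<lambda>x. M * (indicator (cball y R) x *\<^sub>R (u x)\<^sup>2))"
    using u(2)[of "cball y R"] by (intro integrable_mult_right) (simp add: set_integrable_def)
  show "(\<lambda>x. (max 0 (u x))\<^sup>2 * g x) \<in> borel_measurable lebesgue"
    using u(1) lebesgue_measurable_borel[OF g(1)] by measurable
  have "0 \<le> M" using g(2)[of y] by auto
  have "(max 0 (u x))\<^sup>2 * \<bar>g x\<bar> \<le> \<bar>M * (indicator (cball y R) x * (u x)\<^sup>2)\<bar>" for x
  proof (cases "x \<in> ball y R")
    case True
    have "(max 0 (u x))\<^sup>2 * \<bar>g x\<bar> \<le> (u x)\<^sup>2 * M"
      by (intro mult_mono g(2)) (auto simp: max_def)
    then show ?thesis using True \<open>0 \<le> M\<close> by (simp add: mult.commute)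
  qed (use g(3) in auto)
  then show "AE x in lebesgue. norm ((max 0 (u x))\<^sup>2 * g x) \<le> norm (M * (indicator (cball y R) x *\<^sub>R (u x)\<^sup>2))"
    by (simp add: abs_mult)
qed

text \<open>
Where \<open>\<psi> = 1\<close> the competitor is \<open>min 0 u\<close>, so the positivity set is given up there. Elsewhere the gradient is
estimated by \<open>cutoff_gradient_bound\<close>.
\<close>
lemma cutoff_competitor:
  fixes u :: "'a::euclidean_space \<Rightarrow> real"
  assumes u: "u \<in> W12" and uv: "has_weak_gradient u v" and iv: "integrable lebesgue (\<lambda>x. (norm (v x))\<^sup>2)"
    and \<psi>: "test_function \<psi>" and G: "\<And>x. GDERIV \<psi> x :> G x"
    and \<psi>01: "\<And>x. 0 \<le> \<psi> x" "\<And>x. \<psi> x \<le> 1"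
    and out: "\<And>x. x \<notin> ball y R \<Longrightarrow> \<psi> x = 0" "\<And>x. x \<notin> ball y R \<Longrightarrow> G x = 0"
    and GL: "\<And>x. norm (G x) \<le> L"
  defines "us \<equiv> \<lambda>x. u x - (\<psi> x)\<^sup>2 * max 0 (u x)"
  shows "us \<in> W12"
    and "(LINT x|lebesgue. (norm (weak_grad us x))\<^sup>2) \<le> (LINT x|lebesgue. (norm (v x))\<^sup>2)
      - (LINT x|lebesgue. (\<psi> x)\<^sup>2 * (norm (if 0 < u x then v x else 0))\<^sup>2) / 2
      + 12 * L\<^sup>2 * (LINT x:ball y R|lebesgue. (max 0 (u x))\<^sup>2)"
proof -
  have uW: "u \<in> borel_measurable lebesgue" "\<And>K. compact K \<Longrightarrow> set_integrable lebesgue K (\<lambda>x. (u x)\<^sup>2)"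
    using u by (auto simp: W12_def)
  obtain r where r: "\<And>x. r < norm x \<Longrightarrow> \<psi> x = 0" using test_function_support[OF \<psi>] by metis
  have Gb: "G \<in> borel_measurable borel" and \<psi>b: "\<psi> \<in> borel_measurable borel"
    using test_function_gradient(1)[OF \<psi> G r] test_function_continuous[OF \<psi>]
    by (auto intro: borel_measurable_continuous_onI)
  note [measurable] = Gb \<psi>b lebesgue_measurable_borel[OF Gb] lebesgue_measurable_borel[OF \<psi>b] uW(1)
    has_weak_gradient_measurable(2)[OF uv]
  define vs where "vs x = v x + (-1) *\<^sub>R ((\<psi> x * \<psi> x) *\<^sub>R (if 0 < u x then v x else 0)
    + max 0 (u x) *\<^sub>R (\<psi> x *\<^sub>R G x + \<psi> x *\<^sub>R G x))" for x
  have wg: "has_weak_gradient us vs"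
  proof -
    have t: "test_function (\<lambda>x. \<psi> x * \<psi> x)"
      by (rule test_function_smooth_mult[OF \<psi>]) (use \<psi> in \<open>simp add: test_function_def\<close>)
    have "has_weak_gradient (\<lambda>x. u x + (-1) * ((\<psi> x * \<psi> x) * max 0 (u x))) vs"
      unfolding vs_def
      by (intro has_weak_gradient_linear[OF uv] has_weak_gradient_smooth_mult t
          has_weak_gradient_pos_part[OF uv] GDERIV_mult G)
    then show ?thesis by (simp add: us_def power2_eq_square)
  qed
  have vs_eq: "vs x = (if 0 < u x then (1 - (\<psi> x)\<^sup>2) *\<^sub>R v x - (2 * \<psi> x * u x) *\<^sub>R G x else v x)" for x
    by (simp add: vs_def power2_eq_square algebra_simps flip: scaleR_2)
  have pw: "(norm (vs x))\<^sup>2 \<le> (norm (v x))\<^sup>2 - (\<psi> x)\<^sup>2 * (norm (if 0 < u x then v x else 0))\<^sup>2 / 2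
      + 12 * ((max 0 (u x))\<^sup>2 * (norm (G x))\<^sup>2)" for x
    using cutoff_gradient_bound[OF \<psi>01(1)[of x] \<psi>01(2), of "u x" "v x" "G x"]
    by (auto simp: vs_eq max_def)
  have iG: "integrable lebesgue (\<lambda>x. (max 0 (u x))\<^sup>2 * (norm (G x))\<^sup>2)"
  proof (rule integrable_square_mult[OF uW])
    show "\<bar>(norm (G x))\<^sup>2\<bar> \<le> L\<^sup>2" for x using GL by (simp add: power_mono)
    show "(norm (G x))\<^sup>2 = 0" if "x \<notin> ball y R" for x using out that by simp
  qed measurable
  have i1: "integrable lebesgue (\<lambda>x. (max 0 (u x))\<^sup>2 * indicator (ball y R) x)"
    by (rule integrable_square_mult[OF uW, where M = 1 and y = y and R = R]) (auto simp: indicator_def)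
  have iP: "integrable lebesgue (\<lambda>x. (\<psi> x)\<^sup>2 * (norm (if 0 < u x then v x else 0))\<^sup>2)"
  proof (rule Bochner_Integration.integrable_bound[OF iv])
    have "(\<psi> x)\<^sup>2 * (norm (v x))\<^sup>2 \<le> (norm (v x))\<^sup>2" for x
      using \<psi>01[of x] by (intro mult_left_le_one_le) (auto intro: power_le_one)
    then show "AE x in lebesgue. norm ((\<psi> x)\<^sup>2 * (norm (if 0 < u x then v x else 0))\<^sup>2) \<le> norm ((norm (v x))\<^sup>2)"
      by auto
  qed measurable
  have usm: "us \<in> borel_measurable lebesgue" and vsm: "vs \<in> borel_measurable lebesgue"
    using has_weak_gradient_measurable[OF wg] by auto
  have iR: "integrable lebesgue (\<lambda>x. (norm (v x))\<^sup>2 - (\<psi> x)\<^sup>2 * (norm (if 0 < u x then v x else 0))\<^sup>2 / 2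
      + 12 * ((max 0 (u x))\<^sup>2 * (norm (G x))\<^sup>2))"
    using iv iP iG by simp
  have ivs: "integrable lebesgue (\<lambda>x. (norm (vs x))\<^sup>2)"
  proof (rule Bochner_Integration.integrable_bound[OF iR])
    show "AE x in lebesgue. norm ((norm (vs x))\<^sup>2) \<le> norm ((norm (v x))\<^sup>2
        - (\<psi> x)\<^sup>2 * (norm (if 0 < u x then v x else 0))\<^sup>2 / 2 + 12 * ((max 0 (u x))\<^sup>2 * (norm (G x))\<^sup>2))"
    proof (intro AE_I2)
      fix x
      show "norm ((norm (vs x))\<^sup>2) \<le> norm ((norm (v x))\<^sup>2
        - (\<psi> x)\<^sup>2 * (norm (if 0 < u x then v x else 0))\<^sup>2 / 2 + 12 * ((max 0 (u x))\<^sup>2 * (norm (G x))\<^sup>2))"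
        using order_trans[OF pw[of x] abs_ge_self] by (simp only: real_norm_def abs_power2)
    qed
  qed (use vsm in measurable)
  have us_le: "\<bar>us x\<bar> \<le> \<bar>u x\<bar>" for x
  proof (cases "0 < u x")
    case True
    have "us x = (1 - (\<psi> x)\<^sup>2) * u x" using True by (simp add: us_def algebra_simps)
    moreover have "0 \<le> 1 - (\<psi> x)\<^sup>2" "1 - (\<psi> x)\<^sup>2 \<le> 1" using \<psi>01[of x] by (auto intro: power_le_one)
    ultimately show ?thesis using True by (simp add: abs_mult mult_left_le_one_le)
  qed (simp add: us_def)
  show "us \<in> W12"
    unfolding W12_def
  proof (intro CollectI conjI allI impI exI[of _ vs])
    fix K :: "'a set" assume K: "compact K"
    show "set_integrable lebesgue K (\<lambda>x. (us x)\<^sup>2)"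
      unfolding set_integrable_def
    proof (rule Bochner_Integration.integrable_bound)
      show "integrable lebesgue (\<lambda>x. indicator K x *\<^sub>R (u x)\<^sup>2)" using uW(2)[OF K] by (simp add: set_integrable_def)
      have "K \<in> sets lebesgue" using K by (simp add: borel_compact)
      then show "(\<lambda>x. indicator K x *\<^sub>R (us x)\<^sup>2) \<in> borel_measurable lebesgue"
        using usm by measurable
      show "AE x in lebesgue. norm (indicator K x *\<^sub>R (us x)\<^sup>2) \<le> norm (indicator K x *\<^sub>R (u x)\<^sup>2)"
        using us_le by (auto simp: indicator_def abs_le_square_iff)
    qed
  qed (use usm wg ivs in auto)
  have "(LINT x|lebesgue. (norm (weak_grad us x))\<^sup>2) = (LINT x|lebesgue. (norm (vs x))\<^sup>2)"
  proof (rule integral_cong_AE)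
    have "has_weak_gradient us (weak_grad us)" 
      unfolding weak_grad_def by (rule someI[where P = "has_weak_gradient us", OF wg])
    then show "(\<lambda>x. (norm (weak_grad us x))\<^sup>2) \<in> borel_measurable lebesgue"
      using has_weak_gradient_measurable(2) by measurable
    show "AE x in lebesgue. (norm (weak_grad us x))\<^sup>2 = (norm (vs x))\<^sup>2"
      using weak_grad_AE[OF wg] by eventually_elim simp
  qed (use vsm in measurable)
  also have "\<dots> \<le> (LINT x|lebesgue. (norm (v x))\<^sup>2 - (\<psi> x)\<^sup>2 * (norm (if 0 < u x then v x else 0))\<^sup>2 / 2
      + 12 * ((max 0 (u x))\<^sup>2 * (norm (G x))\<^sup>2))"
    by (rule integral_mono[OF ivs iR pw])
  also have "\<dots> = (LINT x|lebesgue. (norm (v x))\<^sup>2)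
      - (LINT x|lebesgue. (\<psi> x)\<^sup>2 * (norm (if 0 < u x then v x else 0))\<^sup>2) / 2
      + 12 * (LINT x|lebesgue. (max 0 (u x))\<^sup>2 * (norm (G x))\<^sup>2)"
    using iv iP iG by simp
  also have "(LINT x|lebesgue. (max 0 (u x))\<^sup>2 * (norm (G x))\<^sup>2) \<le> (LINT x|lebesgue. L\<^sup>2 * ((max 0 (u x))\<^sup>2 * indicator (ball y R) x))"
  proof (rule integral_mono[OF iG])
    show "integrable lebesgue (\<lambda>x. L\<^sup>2 * ((max 0 (u x))\<^sup>2 * indicator (ball y R) x))" using i1 by simp
    show "(max 0 (u x))\<^sup>2 * (norm (G x))\<^sup>2 \<le> L\<^sup>2 * ((max 0 (u x))\<^sup>2 * indicator (ball y R) x)" for x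
    proof (cases "x \<in> ball y R")
      case True
      have "(max 0 (u x))\<^sup>2 * (norm (G x))\<^sup>2 \<le> (max 0 (u x))\<^sup>2 * L\<^sup>2"
        using GL by (intro mult_left_mono power_mono) auto
      then show ?thesis using True by (simp add: mult.commute)
    qed (simp add: out)
  qed
  finally show "(LINT x|lebesgue. (norm (weak_grad us x))\<^sup>2) \<le> (LINT x|lebesgue. (norm (v x))\<^sup>2)
      - (LINT x|lebesgue. (\<psi> x)\<^sup>2 * (norm (if 0 < u x then v x else 0))\<^sup>2) / 2
      + 12 * L\<^sup>2 * (LINT x:ball y R|lebesgue. (max 0 (u x))\<^sup>2)"
    by (simp add: set_lebesgue_integral_def mult.commute)
qed

section \<open>The Caccioppoli inequality at a free boundary\<close>

lemma partitions_transfer: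
  assumes W: "W \<in> partitions N \<Omega>" and N: "1 \<le> N"
    and A: "A \<in> sets borel" "A \<subseteq> W 1"
    and A': "\<And>j. j \<in> {2..N} \<Longrightarrow> A' j \<in> sets borel \<and> A' j \<subseteq> A" "disjoint_family_on A' {2..N}"
  shows "(\<lambda>i\<in>{1..N}. if i = 1 then W 1 - A else W i \<union> A' i) \<in> partitions N \<Omega>"
proof -
  have Wi: "W i \<in> sets borel" "W i \<subseteq> \<Omega>" if "i \<in> {1..N}" for i
    using W that by (auto simp: partitions_def)
  have Wd: "W i \<inter> W j = {}" if "i \<in> {1..N}" "j \<in> {1..N}" "i \<noteq> j" for i j
    using W that by (auto simp: partitions_def disjoint_family_on_def)
  have in2: "i \<in> {2..N}" if "i \<in> {1..N}" "i \<noteq> 1" for i using that by auto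
  have one: "1 \<in> {1..N}" using N by simp
  have AO: "A \<subseteq> \<Omega>" using A(2) Wi(2)[OF one] by blast
  define V where "V i = (if i = 1 then W 1 - A else W i \<union> A' i)" for i
  have V: "V i \<in> sets borel \<and> V i \<subseteq> \<Omega>" if i: "i \<in> {1..N}" for i
  proof (cases "i = 1")
    case True
    then show ?thesis using Wi[OF one] A(1) by (auto simp: V_def)
  next
    case False
    then show ?thesis using Wi[OF i] A'(1)[OF in2[OF i False]] AO by (auto simp: V_def)
  qed
  have "V i \<inter> V j = {}" if i: "i \<in> {1..N}" and j: "j \<in> {1..N}" and ij: "i \<noteq> j" for i j
  proof -
    have d1: "V 1 \<inter> V k = {}" if k: "k \<in> {1..N}" "k \<noteq> 1" for k
      using Wd[OF one k(1)] k(2) A'(1)[OF in2[OF k]] by (auto simp: V_def)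
    show ?thesis
    proof (cases "i = 1 \<or> j = 1")
      case True
      then show ?thesis using d1[of i] d1[of j] i j ij by blast
    next
      case False
      have "A' i \<inter> A' j = {}"
        using A'(2) in2[OF i] in2[OF j] False ij by (auto simp: disjoint_family_on_def)
      moreover have "W i \<inter> A' j = {}" "W j \<inter> A' i = {}"
        using Wd[OF one i] Wd[OF one j] A'(1)[OF in2[OF i]] A'(1)[OF in2[OF j]] A(2) False by blast+
      ultimately show ?thesis using Wd[OF i j ij] False by (auto simp: V_def)
    qed
  qed
  then have "(\<lambda>i\<in>{1..N}. V i) \<in> partitions N \<Omega>"
    using V by (auto simp: partitions_def disjoint_family_on_def)
  then show ?thesis unfolding V_def .
qed

text \<open>
Test minimality with \<open>cutoff_competitor\<close> and with the regions of the nondegeneracy condition, where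
\<open>A\<close> is the positivity set in the ball of radius \<open>\<rho>\<close>. The competitor is admissible since it vanishes
on \<open>A\<close>. The other components cancel, and the terms with \<open>f\<close> and \<open>g\<close> change only where
\<open>u\<close> is positive and inside the ball of radius \<open>R\<close>.
\<close>
lemma Caccioppoli_nondegenerate:
  fixes \<Omega> :: "'a::euclidean_space set"
  assumes N: "1 \<le> N" and \<Omega>: "\<Omega> \<in> sets borel"
    and conv: "lower_order_converges N \<Omega> f g" and min: "is_minimizer N \<Omega> f g F u W"
    and Mf: "AE x in lebesgue. x \<in> \<Omega> \<longrightarrow> \<bar>f 1 x\<bar> \<le> Mf" "0 \<le> Mf"
    and Mg: "AE x in lebesgue. x \<in> \<Omega> \<longrightarrow> \<bar>g 1 x\<bar> \<le> Mg" "0 \<le> Mg"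
    and nd: "nondegenerate N F W lam eps"
    and v: "has_weak_gradient (u 1) v" "integrable lebesgue (\<lambda>x. (norm (v x))\<^sup>2)"
    and cont: "continuous_on (ball y \<rho>) (u 1)"
    and A: "0 < measure lebesgue {z \<in> ball y \<rho>. 0 < u 1 z}" "measure lebesgue {z \<in> ball y \<rho>. 0 < u 1 z} \<le> eps"
    and \<psi>: "test_function \<psi>" and G: "\<And>x. GDERIV \<psi> x :> G x"
    and \<psi>01: "\<And>x. 0 \<le> \<psi> x" "\<And>x. \<psi> x \<le> 1" and in1: "\<And>x. x \<in> ball y \<rho> \<Longrightarrow> \<psi> x = 1"
    and out: "\<And>x. x \<notin> ball y R \<Longrightarrow> \<psi> x = 0" "\<And>x. x \<notin> ball y R \<Longrightarrow> G x = 0"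
    and GL: "\<And>x. norm (G x) \<le> L"
  shows "(LINT x:ball y \<rho>|lebesgue. (norm (if 0 < u 1 x then v x else 0))\<^sup>2) / 2
      + lam * measure lebesgue {z \<in> ball y \<rho>. 0 < u 1 z}
    \<le> (12 * L\<^sup>2 + Mf) * (LINT x:ball y R|lebesgue. (max 0 (u 1 x))\<^sup>2)
      + Mg * (LINT x:ball y R|lebesgue. max 0 (u 1 x))"
proof -
  have adm: "(u, W) \<in> admissible N \<Omega>"
    and le: "\<And>u' W'. (u', W') \<in> admissible N \<Omega> \<Longrightarrow> J_functional N \<Omega> f g F u W \<le> J_functional N \<Omega> f g F u' W'"
    using min by (auto simp: is_minimizer_def)
  have Wp: "W \<in> partitions N \<Omega>" and one: "1 \<in> {1..N}" using adm N by (auto simp: admissible_def)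
  have uW: "\<And>i. i \<in> {1..N} \<Longrightarrow> u i \<in> W12" "\<And>i. i \<in> {1..N} \<Longrightarrow> AE x in lebesgue. x \<notin> W i \<longrightarrow> u i x = 0"
    using adm by (auto simp: admissible_def)
  have u1: "u 1 \<in> borel_measurable lebesgue" "\<And>K. compact K \<Longrightarrow> set_integrable lebesgue K (\<lambda>x. (u 1 x)\<^sup>2)"
    using uW(1)[OF one] by (auto simp: W12_def)
  have W1: "W 1 \<in> sets borel" using Wp one by (auto simp: partitions_def)
  define S where "S = {z \<in> ball y \<rho>. 0 < u 1 z}"
  define A0 where "A0 = W 1 \<inter> S"
  have "open S"
    using continuous_open_preimage[OF cont open_ball, of "{0<..}"]
    by (simp add: S_def vimage_def Int_def)
  then have Sb: "S \<in> sets borel" and A0b: "A0 \<in> sets borel" using W1 by (auto simp: A0_def)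
  have mA0: "measure lebesgue A0 = measure lebesgue S"
  proof (rule measure_eq_AE)
    show "AE x in lebesgue. x \<in> A0 \<longleftrightarrow> x \<in> S"
      using uW(2)[OF one] by eventually_elim (auto simp: A0_def S_def)
  qed (use Sb A0b in auto)
  obtain A' where A': "\<And>j. j \<in> {2..N} \<Longrightarrow> A' j \<in> sets borel \<and> A' j \<subseteq> A0" "disjoint_family_on A' {2..N}"
    "F (\<lambda>i\<in>{1..N}. if i = 1 then W 1 - A0 else W i \<union> A' i) \<le> F W - lam * measure lebesgue A0"
  proof -
    have "A0 \<subseteq> W 1 \<and> 0 < measure lebesgue A0 \<and> measure lebesgue A0 \<le> eps"
      using A unfolding mA0 unfolding A0_def S_def by blast
    from nd[unfolded nondegenerate_def, rule_format, OF A0b this] show ?thesis using that by blast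
  qed
  define W' where "W' = (\<lambda>i\<in>{1..N}. if i = 1 then W 1 - A0 else W i \<union> A' i)"
  have W'p: "W' \<in> partitions N \<Omega>"
    unfolding W'_def by (rule partitions_transfer[OF Wp N A0b _ A'(1,2)]) (auto simp: A0_def)
  define us where "us = (\<lambda>x. u 1 x - (\<psi> x)\<^sup>2 * max 0 (u 1 x))"
  note comp = cutoff_competitor[OF uW(1)[OF one] v \<psi> G \<psi>01 out GL, folded us_def]
  define u' where "u' = u(1 := us)"
  have adm': "(u', W') \<in> admissible N \<Omega>"
    unfolding admissible_def
  proof (intro CollectI case_prodI conjI ballI W'p)
    fix i assume i: "i \<in> {1..N}"
    show "u' i \<in> W12" using comp(1) uW(1)[OF i] by (simp add: u'_def)
    show "AE x in lebesgue. x \<notin> W' i \<longrightarrow> u' i x = 0"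
    proof (cases "i = 1")
      case True
      show ?thesis using uW(2)[OF one]
        by eventually_elim (use True one in1 in \<open>auto simp: W'_def u'_def us_def A0_def S_def\<close>)
    next
      case False
      show ?thesis using uW(2)[OF i]
        by eventually_elim (use False i in \<open>auto simp: W'_def u'_def\<close>)
    qed
  qed
  define E where "E w = (LINT x|lebesgue. (norm (weak_grad w x))\<^sup>2)" for w :: "'a \<Rightarrow> real"
  define P where "P i w = (LINT x:\<Omega>|lebesgue. (w x)\<^sup>2 * f i x - w x * g i x)" for i and w :: "'a \<Rightarrow> real"
  have split1: "(\<Sum>i = 1..N. h i) = h 1 + (\<Sum>i = 2..N. h i)" for h :: "nat \<Rightarrow> real"
    using N by (simp add: sum.atLeast_Suc_atMost numeral_2_eq_2)
  have rest: "(\<Sum>i = 2..N. E (u' i)) = (\<Sum>i = 2..N. E (u i))" "(\<Sum>i = 2..N. P i (u' i)) = (\<Sum>i = 2..N. P i (u i))"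
    by (auto simp: u'_def intro!: sum.cong)
  have "J_functional N \<Omega> f g F u W \<le> J_functional N \<Omega> f g F u' W'" by (rule le[OF adm'])
  then have "E (u 1) + P 1 (u 1) + F W \<le> E us + P 1 us + F W'"
    unfolding J_functional_def E_def[symmetric] P_def[symmetric] split1 rest by (simp add: u'_def)
  then have J: "E (u 1) + P 1 (u 1) + lam * measure lebesgue S \<le> E us + P 1 us"
    using A'(3) mA0 by (simp add: W'_def)
  have "E (u 1) = (LINT x|lebesgue. (norm (v x))\<^sup>2)"
    unfolding E_def
  proof (rule integral_cong_AE)
    have "has_weak_gradient (u 1) (weak_grad (u 1))"
      unfolding weak_grad_def by (rule someI[where P = "has_weak_gradient (u 1)", OF v(1)])
    then show "(\<lambda>x. (norm (weak_grad (u 1) x))\<^sup>2) \<in> borel_measurable lebesgue"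
      using has_weak_gradient_measurable(2) by measurable
    show "(\<lambda>x. (norm (v x))\<^sup>2) \<in> borel_measurable lebesgue" using v(2) by auto
    show "AE x in lebesgue. (norm (weak_grad (u 1) x))\<^sup>2 = (norm (v x))\<^sup>2"
      using weak_grad_AE[OF v(1)] by eventually_elim simp
  qed
  then have E: "E us \<le> E (u 1) - (LINT x|lebesgue. (\<psi> x)\<^sup>2 * (norm (if 0 < u 1 x then v x else 0))\<^sup>2) / 2
      + 12 * L\<^sup>2 * (LINT x:ball y R|lebesgue. (max 0 (u 1 x))\<^sup>2)"
    using comp(2) by (simp add: E_def)
  have \<psi>m: "\<psi> \<in> borel_measurable lebesgue"
    by (intro lebesgue_measurable_borel borel_measurable_continuous_onI test_function_continuous \<psi>)
  have vm: "v \<in> borel_measurable lebesgue" using has_weak_gradient_measurable[OF v(1)] by simp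
  note [measurable] = \<psi>m vm u1(1)
  have [measurable]: "ball y \<rho> \<in> sets lebesgue" "ball y R \<in> sets lebesgue" by auto
  have low: "(LINT x:ball y \<rho>|lebesgue. (norm (if 0 < u 1 x then v x else 0))\<^sup>2)
     \<le> (LINT x|lebesgue. (\<psi> x)\<^sup>2 * (norm (if 0 < u 1 x then v x else 0))\<^sup>2)"
    unfolding set_lebesgue_integral_def
  proof (rule integral_mono)
    show "integrable lebesgue (\<lambda>x. (\<psi> x)\<^sup>2 * (norm (if 0 < u 1 x then v x else 0))\<^sup>2)"
    proof (rule Bochner_Integration.integrable_bound[OF v(2)])
      have "(\<psi> x)\<^sup>2 * (norm (v x))\<^sup>2 \<le> (norm (v x))\<^sup>2" for x
        using \<psi>01[of x] by (intro mult_left_le_one_le) (auto intro: power_le_one)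
      then show "AE x in lebesgue. norm ((\<psi> x)\<^sup>2 * (norm (if 0 < u 1 x then v x else 0))\<^sup>2) \<le> norm ((norm (v x))\<^sup>2)"
        by auto
    qed measurable
    show "integrable lebesgue (\<lambda>x. indicator (ball y \<rho>) x *\<^sub>R (norm (if 0 < u 1 x then v x else 0))\<^sup>2)"
      by (rule Bochner_Integration.integrable_bound[OF v(2)]) (measurable, auto simp: indicator_def)
    show "indicator (ball y \<rho>) x *\<^sub>R (norm (if 0 < u 1 x then v x else 0))\<^sup>2
      \<le> (\<psi> x)\<^sup>2 * (norm (if 0 < u 1 x then v x else 0))\<^sup>2" for x
      using in1[of x] by (auto simp: indicator_def)
  qed
  have i2: "integrable lebesgue (\<lambda>x. (max 0 (u 1 x))\<^sup>2 * indicator (ball y R) x)"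
    by (rule integrable_square_mult[OF u1, where M = 1 and y = y and R = R]) (auto simp: indicator_def)
  have i1: "integrable lebesgue (\<lambda>x. indicator (ball y R) x * max 0 (u 1 x))"
  proof (rule Bochner_Integration.integrable_bound)
    have "locally_integrable (u 1)" using v(1) by (simp add: has_weak_gradient_def)
    then show "integrable lebesgue (\<lambda>x. indicator (cball y R) x *\<^sub>R u 1 x)"
      by (auto simp: locally_integrable_def set_integrable_def)
  qed (measurable, auto simp: indicator_def)
  have lo: "(u', W') \<in> admissible N \<Omega> \<Longrightarrow> set_integrable lebesgue \<Omega> (\<lambda>x. (u' 1 x)\<^sup>2 * f 1 x - u' 1 x * g 1 x)"
    for u' W' using conv one by (force simp: lower_order_converges_def)
  have "P 1 us - P 1 (u 1) = (LINT x:\<Omega>|lebesgue. ((us x)\<^sup>2 * f 1 x - us x * g 1 x) - ((u 1 x)\<^sup>2 * f 1 x - u 1 x * g 1 x))"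
    unfolding P_def using lo[OF adm] lo[OF adm'] by (subst set_integral_diff) (auto simp: u'_def)
  also have "\<dots> \<le> (LINT x|lebesgue. Mf * ((max 0 (u 1 x))\<^sup>2 * indicator (ball y R) x) + Mg * (indicator (ball y R) x * max 0 (u 1 x)))"
    unfolding set_lebesgue_integral_def
  proof (rule integral_mono_AE)
    show "integrable lebesgue (\<lambda>x. indicator \<Omega> x *\<^sub>R (((us x)\<^sup>2 * f 1 x - us x * g 1 x) - ((u 1 x)\<^sup>2 * f 1 x - u 1 x * g 1 x)))"
      using set_integral_diff(1)[OF lo[OF adm'] lo[OF adm]] by (simp add: set_integrable_def u'_def)
    show "integrable lebesgue (\<lambda>x. Mf * ((max 0 (u 1 x))\<^sup>2 * indicator (ball y R) x) + Mg * (indicator (ball y R) x * max 0 (u 1 x)))"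
      using i1 i2 by simp
    show "AE x in lebesgue. indicator \<Omega> x *\<^sub>R (((us x)\<^sup>2 * f 1 x - us x * g 1 x) - ((u 1 x)\<^sup>2 * f 1 x - u 1 x * g 1 x))
       \<le> Mf * ((max 0 (u 1 x))\<^sup>2 * indicator (ball y R) x) + Mg * (indicator (ball y R) x * max 0 (u 1 x))"
      using Mf(1) Mg(1)
    proof eventually_elim
      case (elim x)
      have nn: "0 \<le> Mf * ((max 0 (u 1 x))\<^sup>2 * indicator (ball y R) x) + Mg * (indicator (ball y R) x * max 0 (u 1 x))"
        using Mf(2) Mg(2) by (intro add_nonneg_nonneg mult_nonneg_nonneg) auto
      show ?case
      proof (cases "x \<in> \<Omega> \<and> 0 < u 1 x \<and> x \<in> ball y R")
        case True
        define a where "a = u 1 x"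
        define t where "t = (\<psi> x)\<^sup>2"
        have a: "0 < a" and t: "0 \<le> t" "t \<le> 1" using True \<psi>01[of x] by (auto simp: a_def t_def intro: power_le_one)
        have us: "us x = (1 - t) * a" using True by (simp add: us_def a_def t_def algebra_simps)
        have "((us x)\<^sup>2 * f 1 x - us x * g 1 x) - ((u 1 x)\<^sup>2 * f 1 x - u 1 x * g 1 x)
          = ((1 - t)\<^sup>2 - 1) * (a\<^sup>2 * f 1 x) + t * (a * g 1 x)"
          unfolding us a_def[symmetric] power2_eq_square by (simp only: algebra_simps)
        also have "\<dots> \<le> 1 * (a\<^sup>2 * Mf) + 1 * (a * Mg)"
        proof (intro add_mono)
          have "((1 - t)\<^sup>2 - 1) * (a\<^sup>2 * f 1 x) \<le> \<bar>((1 - t)\<^sup>2 - 1) * (a\<^sup>2 * f 1 x)\<bar>" by simp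
          also have "\<dots> = \<bar>(1 - t)\<^sup>2 - 1\<bar> * (a\<^sup>2 * \<bar>f 1 x\<bar>)" by (simp add: abs_mult)
          also have "\<dots> \<le> 1 * (a\<^sup>2 * Mf)"
          proof (intro mult_mono)
            have "(1 - t)\<^sup>2 \<le> 1" using t by (intro power_le_one) auto
            then show "\<bar>(1 - t)\<^sup>2 - 1\<bar> \<le> 1" by (simp add: abs_le_iff)
          qed (use elim True in auto)
          finally show "((1 - t)\<^sup>2 - 1) * (a\<^sup>2 * f 1 x) \<le> 1 * (a\<^sup>2 * Mf)" .
          have "t * (a * g 1 x) \<le> t * (a * Mg)"
            using elim True t a by (intro mult_left_mono) auto
          also have "\<dots> \<le> 1 * (a * Mg)" using t a Mg(2) by (intro mult_right_mono) auto
          finally show "t * (a * g 1 x) \<le> 1 * (a * Mg)" .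
        qed
        finally show ?thesis using True by (simp add: a_def mult.commute)
      next
        case False
        have "us x = u 1 x" if "\<not> (0 < u 1 x \<and> x \<in> ball y R)"
          using that out(1)[of x] by (auto simp: us_def)
        then show ?thesis using False nn by (cases "x \<in> \<Omega>") auto
      qed
    qed
  qed
  also have "\<dots> = Mf * (LINT x:ball y R|lebesgue. (max 0 (u 1 x))\<^sup>2) + Mg * (LINT x:ball y R|lebesgue. max 0 (u 1 x))"
    using i1 i2 by (simp add: set_lebesgue_integral_def mult.commute)
  finally have "P 1 us - P 1 (u 1) \<le> Mf * (LINT x:ball y R|lebesgue. (max 0 (u 1 x))\<^sup>2) + Mg * (LINT x:ball y R|lebesgue. max 0 (u 1 x))" .
  then show ?thesis using J E low unfolding S_def by (simp add: distrib_right)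
qed

section \<open>De Giorgi iteration\<close>

text \<open>
Here \<open>\<alpha> k\<close>, \<open>\<beta> k\<close> and \<open>\<gamma> k\<close> stand for the normalized volume of the support, mean square and energy
on the \<open>k\<close>-th ball. The two hypotheses are the Caccioppoli inequality, with a free parameter \<open>\<theta>\<close> from
the linear term, and the Faber-Krahn inequality at scale \<open>\<tau>\<close>. With \<open>s k\<close> a geometric sequence, the
bounds \<open>\<alpha> \<le> s\<^sup>2\<^sup>n\<close> and \<open>\<beta> \<le> s\<^sup>2\<^sup>n\<^sup>+\<^sup>2\<close> propagate: for \<open>\<theta> = s k\<close> the first hypothesis gains a factor
\<open>s k\<close> over the bound for \<open>\<alpha>\<close>, which pays for \<open>4 ^ k\<close>, and for \<open>\<tau>\<close> of the order of the square of \<open>s k\<close> the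
second one gains a fourth power where a second power is needed.
\<close>
lemma De_Giorgi_iteration:
  fixes n :: nat and D B c :: real
  assumes n: "1 \<le> n" and pos: "0 < D" "0 < B" "0 < c"
  obtains \<eta> where "0 < \<eta>"
    "\<And>\<alpha> \<beta> \<gamma> :: nat \<Rightarrow> real. (\<And>k. 0 \<le> \<alpha> k) \<Longrightarrow> (\<And>k. 0 \<le> \<beta> k) \<Longrightarrow> (\<And>k. 0 \<le> \<gamma> k) \<Longrightarrow>
      \<alpha> 0 \<le> 1 \<Longrightarrow> \<beta> 0 \<le> \<eta> \<Longrightarrow>
      (\<And>k \<theta>. 0 < \<theta> \<Longrightarrow> \<theta> \<le> 1 \<Longrightarrow> \<gamma> (Suc k) + \<alpha> (Suc k) \<le> D * 4 ^ k * (\<beta> k / \<theta> + \<theta> * \<alpha> k)) \<Longrightarrow>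
      (\<And>k \<tau>. 0 < \<tau> \<Longrightarrow> \<tau> \<le> 1/4 \<Longrightarrow> \<alpha> (Suc k) \<le> c * \<tau> ^ n \<Longrightarrow> \<beta> (Suc k) \<le> B * \<tau>\<^sup>2 * \<gamma> (Suc k)) \<Longrightarrow>
      \<alpha> \<longlonglongrightarrow> 0"
proof -
  \<comment> \<open>\<open>\<tau> = K s\<^sup>2\<close> will satisfy \<open>s\<^sup>2\<^sup>n \<le>
    c \<tau>\<^sup>n\<close>\<close>
  define K where "K = max 1 (1 / c)"
  have K1: "1 \<le> K" by (simp add: K_def)
  have Kc: "1 \<le> c * K ^ n"
  proof -
    have "1 \<le> c * K" using pos(3) by (simp add: K_def max_def field_simps)
    also have "\<dots> \<le> c * K ^ n" using power_increasing[OF n K1] pos(3) by simp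
    finally show ?thesis .
  qed
  \<comment> \<open>each summand of \<open>M\<close> serves one smallness condition on
    \<open>\<sigma>\<close>\<close>
  define M where "M = 1 + K + 8 * D * 16 ^ n + 8 * B * D * K\<^sup>2 * 16 ^ (n + 1)"
  define \<sigma> where "\<sigma> = 1 / M"
  have M1: "1 \<le> M" "K \<le> M" "8 * D * 16 ^ n \<le> M" "8 * B * D * K\<^sup>2 * 16 ^ (n + 1) \<le> M"
    using pos K1 by (auto simp: M_def intro!: add_nonneg_nonneg)
  have \<sigma>: "0 < \<sigma>" "\<sigma> \<le> 1" "K * \<sigma> \<le> 1" "8 * D * 16 ^ n * \<sigma> \<le> 1" "8 * B * D * K\<^sup>2 * 16 ^ (n + 1) * \<sigma> \<le> 1"
    using M1 by (auto simp: \<sigma>_def)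
  \<comment> \<open>\<open>x\<close> is the target of the first step, where \<open>\<alpha>
    0\<close> is only bounded: \<open>\<theta>\<close> makes the term with \<open>\<alpha> 0\<close>
    small, and then \<open>\<eta>\<close> the other one\<close>
  define x where "x = min (\<sigma> ^ (2 * n)) (min (c / 4 ^ n) (16 * \<sigma> ^ (2 * n + 2) / B))"
  have x: "0 < x" "x \<le> \<sigma> ^ (2 * n)" "x \<le> c / 4 ^ n" "x \<le> 16 * \<sigma> ^ (2 * n + 2) / B"
    using \<sigma> pos by (auto simp: x_def)
  define \<theta> where "\<theta> = min 1 (x / (2 * D))"
  have \<theta>: "0 < \<theta>" "\<theta> \<le> 1" "D * \<theta> \<le> x / 2"
    using x pos by (auto simp: \<theta>_def min_def field_simps)
  define \<eta> where "\<eta> = x * \<theta> / (2 * D)"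
  have \<eta>: "0 < \<eta>" "D * (\<eta> / \<theta>) = x / 2" using x pos \<theta> by (auto simp: \<eta>_def field_simps)
  define s where "s k = \<sigma> / 4 ^ k" for k :: nat
  have s: "0 < s k" "s k \<le> 1" "s k \<le> \<sigma>" "4 ^ k * s k = \<sigma>" "s (Suc k) = s k / 4" for k
  proof -
    have "(1::real) \<le> 4 ^ k" by simp
    then show "0 < s k" "s k \<le> \<sigma>" "4 ^ k * s k = \<sigma>" "s (Suc k) = s k / 4"
      using \<sigma> by (auto simp: s_def divide_simps mult_le_cancel_left1)
    then show "s k \<le> 1" using \<sigma> by linarith
  qed
  have "\<alpha> \<longlonglongrightarrow> 0"
    if nonneg: "\<And>k. 0 \<le> \<alpha> k" "\<And>k. 0 \<le> \<beta> k" "\<And>k. 0 \<le> \<gamma> k" and a0: "\<alpha> 0 \<le> 1" and b0: "\<beta> 0 \<le> \<eta>"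
      and C: "\<And>k \<theta>. 0 < \<theta> \<Longrightarrow> \<theta> \<le> 1 \<Longrightarrow> \<gamma> (Suc k) + \<alpha> (Suc k) \<le> D * 4 ^ k * (\<beta> k / \<theta> + \<theta> * \<alpha> k)"
      and P: "\<And>k \<tau>. 0 < \<tau> \<Longrightarrow> \<tau> \<le> 1/4 \<Longrightarrow> \<alpha> (Suc k) \<le> c * \<tau> ^ n \<Longrightarrow> \<beta> (Suc k) \<le> B * \<tau>\<^sup>2 * \<gamma> (Suc k)"
    for \<alpha> \<beta> \<gamma> :: "nat \<Rightarrow> real"
  proof -
    have inv: "\<alpha> (Suc k) \<le> s k ^ (2 * n) \<and> \<beta> (Suc k) \<le> s k ^ (2 * n + 2)" for k
    proof (induction k)
      case 0
      have "\<gamma> (Suc 0) + \<alpha> (Suc 0) \<le> D * (\<beta> 0 / \<theta> + \<theta> * \<alpha> 0)" using C[OF \<theta>(1,2), of 0] by simp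
      also have "\<dots> \<le> D * (\<eta> / \<theta> + \<theta> * 1)"
        using b0 a0 \<theta> pos by (intro mult_left_mono add_mono divide_right_mono) auto
      also have "\<dots> \<le> x" using \<eta>(2) \<theta>(3) by (simp add: distrib_left)
      finally have le: "\<gamma> (Suc 0) \<le> x" "\<alpha> (Suc 0) \<le> x" using nonneg(1,3)[of "Suc 0"] by linarith+
      have "\<beta> (Suc 0) \<le> B * (1/4)\<^sup>2 * \<gamma> (Suc 0)"
        by (rule P) (use le(2) x(3) in \<open>auto simp: power_divide\<close>)
      also have "\<dots> \<le> B * (1/4)\<^sup>2 * (16 * \<sigma> ^ (2 * n + 2) / B)"
        using le(1) x(4) pos by (intro mult_left_mono) auto
      also have "\<dots> = \<sigma> ^ (2 * n + 2)" using pos by (simp add: power2_eq_square)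
      finally show ?case using le x(2) by (simp add: s_def)
    next
      case (Suc k)
      have "\<gamma> (Suc (Suc k)) + \<alpha> (Suc (Suc k)) \<le> D * 4 ^ Suc k * (\<beta> (Suc k) / s k + s k * \<alpha> (Suc k))"
        by (rule C[OF s(1,2)])
      also have "\<dots> \<le> D * 4 ^ Suc k * (s k ^ (2 * n + 2) / s k + s k * s k ^ (2 * n))"
        using Suc s[of k] pos by (intro mult_left_mono add_mono divide_right_mono) auto
      also have "\<dots> = 8 * D * (4 ^ k * s k) * s k ^ (2 * n)"
        using s(1)[of k] by (simp add: field_simps)
      finally have le0: "\<gamma> (Suc (Suc k)) + \<alpha> (Suc (Suc k)) \<le> 8 * D * \<sigma> * s k ^ (2 * n)"
        by (simp only: s(4))
      have pw: "s (Suc k) ^ (2 * n) = s k ^ (2 * n) / 16 ^ n"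
        unfolding s(5) power_divide by (simp add: power_mult)
      have "8 * D * \<sigma> * s k ^ (2 * n) \<le> s k ^ (2 * n) / 16 ^ n"
        using mult_right_mono[OF \<sigma>(4), of "s k ^ (2 * n)"] s(1)[of k] by (simp add: field_simps)
      then have a: "\<alpha> (Suc (Suc k)) \<le> s (Suc k) ^ (2 * n)"
        using le0 nonneg(3)[of "Suc (Suc k)"] unfolding pw by linarith
      define \<tau> where "\<tau> = K * (s (Suc k))\<^sup>2"
      have "\<beta> (Suc (Suc k)) \<le> B * \<tau>\<^sup>2 * \<gamma> (Suc (Suc k))"
      proof (rule P)
        show "0 < \<tau>" using K1 s(1)[of "Suc k"] by (simp add: \<tau>_def)
        have "K * (s (Suc k) * s (Suc k)) \<le> K * (\<sigma> * (1 / 4))"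
          using s[of k] K1 \<sigma> by (intro mult_left_mono mult_mono s) (auto simp: s(5))
        also have "\<dots> \<le> 1 / 4" using \<sigma>(3) by simp
        finally show "\<tau> \<le> 1 / 4" by (simp add: \<tau>_def power2_eq_square)
        have "s (Suc k) ^ (2 * n) \<le> (c * K ^ n) * s (Suc k) ^ (2 * n)"
          using mult_right_mono[OF Kc, of "s (Suc k) ^ (2 * n)"] s(1)[of "Suc k"] by simp
        also have "\<dots> = c * \<tau> ^ n" by (simp add: \<tau>_def power_mult_distrib power_mult)
        finally show "\<alpha> (Suc (Suc k)) \<le> c * \<tau> ^ n" using a by linarith
      qed
      also have "\<dots> \<le> B * \<tau>\<^sup>2 * (8 * D * \<sigma> * s k ^ (2 * n))"
        using le0 nonneg(1)[of "Suc (Suc k)"] pos by (intro mult_left_mono) auto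
      also have "\<dots> = (8 * B * D * K\<^sup>2 * \<sigma>) * (s k ^ 4 * s k ^ (2 * n) / 256)"
        unfolding \<tau>_def s(5) by (simp add: power2_eq_square power4_eq_xxxx)
      also have "\<dots> \<le> (8 * B * D * K\<^sup>2 * \<sigma>) * (s k ^ 2 * s k ^ (2 * n))"
      proof (intro mult_left_mono)
        have "s k ^ 4 \<le> s k ^ 2" using s[of k] by (intro power_decreasing) auto
        then have "s k ^ 4 * s k ^ (2 * n) \<le> s k ^ 2 * s k ^ (2 * n)" using s(1)[of k] by (intro mult_right_mono) auto
        moreover have "0 \<le> s k ^ 4 * s k ^ (2 * n)" using s(1)[of k] by simp
        ultimately show "s k ^ 4 * s k ^ (2 * n) / 256 \<le> s k ^ 2 * s k ^ (2 * n)" by linarith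
      qed (use pos \<sigma> in auto)
      also have "\<dots> \<le> (1 / 16 ^ (n + 1)) * (s k ^ 2 * s k ^ (2 * n))"
      proof (intro mult_right_mono)
        show "8 * B * D * K\<^sup>2 * \<sigma> \<le> 1 / 16 ^ (n + 1)"
          using \<sigma>(5) by (simp add: field_simps)
      qed (use s(1)[of k] in auto)
      also have "\<dots> = s (Suc k) ^ (2 * n + 2)"
        unfolding s(5) power_divide by (simp add: power_mult power_add power2_eq_square)
      finally show ?case using a by simp
    qed
    have "(\<lambda>k. \<alpha> (Suc k)) \<longlonglongrightarrow> 0"
    proof (rule tendsto_sandwich[OF _ _ tendsto_const])
      have "\<alpha> (Suc k) \<le> \<sigma> * (1 / 4) ^ k" for k
      proof -
        have "\<alpha> (Suc k) \<le> s k ^ (2 * n)" using inv by blast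
        also have "\<dots> \<le> s k ^ 1" using s[of k] n by (intro power_decreasing) auto
        finally show ?thesis by (simp add: s_def power_divide)
      qed
      then show "\<forall>\<^sub>F k in sequentially. \<alpha> (Suc k) \<le> \<sigma> * (1 / 4) ^ k" by simp
      have "(\<lambda>k. \<sigma> * (1 / 4) ^ k) \<longlonglongrightarrow> \<sigma> * 0" by (intro tendsto_intros LIMSEQ_realpow_zero) auto
      then show "(\<lambda>k. \<sigma> * (1 / 4) ^ k) \<longlonglongrightarrow> 0" by simp
    qed (use nonneg in auto)
    then show "\<alpha> \<longlonglongrightarrow> 0" by (rule LIMSEQ_imp_Suc)
  qed
  then show ?thesis using that \<eta>(1) by blast
qed

section \<open>Poincare and Faber-Krahn inequalities on balls\<close>

lemma measure_ball_le_cube: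
  fixes a :: "'a::euclidean_space"
  assumes "0 \<le> t"
  shows "measure lebesgue (ball a t) \<le> (2 * t) ^ DIM('a)"
proof -
  have sub: "ball a t \<subseteq> cbox (a - t *\<^sub>R One) (a + t *\<^sub>R One)"
  proof
    fix z assume z: "z \<in> ball a t"
    have "\<bar>(z - a) \<bullet> b\<bar> \<le> t" if "b \<in> Basis" for b
      using Basis_le_norm[OF that, of "z - a"] z by (simp add: dist_norm norm_minus_commute)
    then show "z \<in> cbox (a - t *\<^sub>R One) (a + t *\<^sub>R One)"
      by (auto simp: mem_box inner_diff_left inner_add_left abs_le_iff algebra_simps)
  qed
  have "measure lebesgue (ball a t) \<le> measure lebesgue (cbox (a - t *\<^sub>R One) (a + t *\<^sub>R One))"
    by (rule measure_mono_fmeasurable[OF sub]) auto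
  also have "\<dots> = (2 * t) ^ DIM('a)"
    using assms by (simp add: measure_lborel_cbox_eq inner_diff_left inner_add_left)
  finally show ?thesis .
qed

lemma lmeasurable_ball_Collect:
  fixes w :: "'a::euclidean_space \<Rightarrow> real"
  assumes w: "w \<in> borel_measurable lebesgue" and P: "Measurable.pred borel P"
  shows "{q \<in> ball y R. P (w q)} \<in> lmeasurable"
proof -
  have "{q \<in> ball y R. P (w q)} = ball y R \<inter> {q \<in> space lebesgue. P (w q)}" by auto
  moreover have "{q \<in> space lebesgue. P (w q)} \<in> sets lebesgue"
    using w P by measurable
  ultimately show ?thesis by (auto intro!: fmeasurable_Int_fmeasurable)
qed

text \<open>
Move from \<open>p\<close> towards the centre \<open>y\<close> by \<open>s / 2\<close>, or go to \<open>y\<close> if it is closer.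
\<close>
lemma ball_inside_two_balls:
  fixes p y :: "'a::real_normed_vector"
  assumes "p \<in> ball y R" "0 < s" "s \<le> R"
  obtains q where "ball q (s / 2) \<subseteq> ball y R \<inter> ball p s"
proof (cases "norm (y - p) \<le> s / 2")
  case True
  have "ball y (s / 2) \<subseteq> ball y R \<inter> ball p s"
  proof
    fix z assume z: "z \<in> ball y (s / 2)"
    have "dist p z \<le> dist p y + dist y z" by (rule dist_triangle)
    then show "z \<in> ball y R \<inter> ball p s" using z True assms by (auto simp: dist_norm norm_minus_commute)
  qed
  then show ?thesis using that by blast
next
  case False
  define d where "d = norm (y - p)"
  have d: "s / 2 < d" "d < R" using False assms by (auto simp: d_def dist_norm)
  then have d0: "0 < d" using assms by linarith
  define q where "q = p + (s / 2 / d) *\<^sub>R (y - p)"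
  have qp: "dist p q = s / 2" using d0 assms by (simp add: q_def dist_norm d_def[symmetric])
  have "y - q = (1 - s / 2 / d) *\<^sub>R (y - p)" by (simp add: q_def algebra_simps)
  then have "dist y q = \<bar>1 - s / 2 / d\<bar> * d" by (simp add: dist_norm d_def)
  also have "\<dots> = d - s / 2" using d d0 by (simp add: field_simps)
  finally have qy: "dist y q = d - s / 2" .
  have "ball q (s / 2) \<subseteq> ball y R \<inter> ball p s"
  proof
    fix z assume "z \<in> ball q (s / 2)"
    then have z: "dist q z < s / 2" by simp
    have "dist p z \<le> dist p q + dist q z" "dist y z \<le> dist y q + dist q z" by (rule dist_triangle)+
    then show "z \<in> ball y R \<inter> ball p s" using z qp qy d by auto
  qed
  then show ?thesis using that by blast
qed

text \<open>
The smallness of the support guarantees that within distance \<open>s\<close> of every point of the ball the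
function vanishes on at least half of a ball of radius \<open>s / 2\<close>.
\<close>
lemma Faber_Krahn_ball:
  fixes w :: "'a::euclidean_space \<Rightarrow> real"
  assumes wz: "has_weak_gradient w z" and w0: "\<And>x. 0 \<le> w x"
    and iw: "set_integrable lebesgue (ball y R) (\<lambda>x. (w x)\<^sup>2)"
    and iz: "set_integrable lebesgue (ball y R) (\<lambda>x. (norm (z x))\<^sup>2)"
    and s: "0 < s" "s \<le> R"
    and small: "measure lebesgue {q \<in> ball y R. 0 < w q} \<le> unit_ball_vol (real DIM('a)) * s ^ DIM('a) / 2 ^ (DIM('a) + 1)"
  shows "(LINT x:ball y R|lebesgue. (w x)\<^sup>2) \<le> 2 ^ (DIM('a) + 2) * s\<^sup>2 * (LINT x:ball y R|lebesgue. (norm (z x))\<^sup>2)"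
proof -
  define om where "om = unit_ball_vol (real DIM('a))"
  have om: "0 < om" by (simp add: om_def)
  define m where "m = om * s ^ DIM('a) / 2 ^ (DIM('a) + 1)"
  have m: "0 < m" using om s by (simp add: m_def)
  have wm: "w \<in> borel_measurable lebesgue" using has_weak_gradient_measurable(1)[OF wz] .
  have pt: "m \<le> measure lebesgue {q \<in> ball y R. dist p q < s \<and> \<bar>w q\<bar> \<le> 0}" if p: "p \<in> ball y R" for p
  proof -
    obtain q where q: "ball q (s / 2) \<subseteq> ball y R \<inter> ball p s" using ball_inside_two_balls[OF p s] .
    have mp: "{q \<in> ball y R. 0 < w q} \<in> lmeasurable" by (rule lmeasurable_ball_Collect[OF wm]) measurable
    have mz': "{q \<in> ball y R. \<bar>w q\<bar> \<le> 0} \<in> lmeasurable" by (rule lmeasurable_ball_Collect[OF wm]) measurable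
    have "{q \<in> ball y R. dist p q < s \<and> \<bar>w q\<bar> \<le> 0} = {q \<in> ball y R. \<bar>w q\<bar> \<le> 0} \<inter> ball p s" by auto
    then have mz: "{q \<in> ball y R. dist p q < s \<and> \<bar>w q\<bar> \<le> 0} \<in> lmeasurable" using mz' by (simp add: fmeasurable.Int)
    have "2 * m = measure lebesgue (ball q (s / 2))"
      using s by (simp add: content_ball m_def om_def power_divide)
    also have "\<dots> \<le> measure lebesgue ({q \<in> ball y R. dist p q < s \<and> \<bar>w q\<bar> \<le> 0} \<union> {q \<in> ball y R. 0 < w q})"
    proof (rule measure_mono_fmeasurable)
      show "ball q (s / 2) \<subseteq> {q \<in> ball y R. dist p q < s \<and> \<bar>w q\<bar> \<le> 0} \<union> {q \<in> ball y R. 0 < w q}"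
      proof
        fix a assume a: "a \<in> ball q (s / 2)"
        then have "a \<in> ball y R" "dist p a < s" using q by auto
        then show "a \<in> {q \<in> ball y R. dist p q < s \<and> \<bar>w q\<bar> \<le> 0} \<union> {q \<in> ball y R. 0 < w q}"
          using w0[of a] by (cases "w a = 0") auto
      qed
    qed (use mp mz in \<open>auto intro: fmeasurable.Un\<close>)
    also have "\<dots> \<le> measure lebesgue {q \<in> ball y R. dist p q < s \<and> \<bar>w q\<bar> \<le> 0} + measure lebesgue {q \<in> ball y R. 0 < w q}"
      by (rule measure_Un_le) (use mp mz in auto)
    finally show ?thesis using small by (simp add: m_def om_def)
  qed
  have "m * (LINT x:ball y R|lebesgue. (w x)\<^sup>2) \<le> measure lebesgue (ball (0::'a) s) * (2 * s\<^sup>2 * (LINT x:ball y R|lebesgue. (norm (z x))\<^sup>2))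
     + 2 * 0\<^sup>2 * (measure lebesgue (ball y R) * measure lebesgue (ball y R))"
    by (rule Poincare_ball[OF wz iw iz _ _ less_imp_le[OF m] pt]) auto
  also have "measure lebesgue (ball (0::'a) s) = 2 ^ (DIM('a) + 1) * m"
    using s by (simp add: content_ball m_def om_def)
  finally have "m * (LINT x:ball y R|lebesgue. (w x)\<^sup>2)
      \<le> m * (2 ^ (DIM('a) + 2) * s\<^sup>2 * (LINT x:ball y R|lebesgue. (norm (z x))\<^sup>2))"
    by (simp add: mult_ac)
  then show ?thesis using m by (simp only: mult_le_cancel_left_pos)
qed

lemma Poincare_zero_set:
  fixes w :: "'a::euclidean_space \<Rightarrow> real"
  assumes wz: "has_weak_gradient w z"
    and iw: "set_integrable lebesgue (ball x r) (\<lambda>x. (w x)\<^sup>2)"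
    and iz: "set_integrable lebesgue (ball x r) (\<lambda>x. (norm (z x))\<^sup>2)"
    and r: "0 < r" and m: "0 < m" "m \<le> measure lebesgue {q \<in> ball x r. w q = 0}"
  shows "m * (LINT q:ball x r|lebesgue. (w q)\<^sup>2)
    \<le> unit_ball_vol (real DIM('a)) * (2 * r) ^ DIM('a) * (8 * r\<^sup>2 * (LINT q:ball x r|lebesgue. (norm (z q))\<^sup>2))"
proof -
  have "{q \<in> ball x r. dist p q < 2 * r \<and> \<bar>w q\<bar> \<le> 0} = {q \<in> ball x r. w q = 0}" if "p \<in> ball x r" for p
  proof -
    have "dist p q < 2 * r" if "q \<in> ball x r" for q
      using \<open>p \<in> ball x r\<close> that dist_triangle2[of p q x] by (simp add: dist_commute)
    then show ?thesis by auto
  qed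
  then have "m * (LINT q:ball x r|lebesgue. (w q)\<^sup>2) \<le> measure lebesgue (ball (0::'a) (2 * r)) * (2 * (2 * r)\<^sup>2 * (LINT q:ball x r|lebesgue. (norm (z q))\<^sup>2))
     + 2 * 0\<^sup>2 * (measure lebesgue (ball x r) * measure lebesgue (ball x r))"
    using m by (intro Poincare_ball[OF wz iw iz]) auto
  then show ?thesis using r by (simp add: content_ball power2_eq_square)
qed

lemma Poincare_small_ball:
  fixes w :: "'a::euclidean_space \<Rightarrow> real"
  assumes wz: "has_weak_gradient w z"
    and iw: "set_integrable lebesgue (ball x r) (\<lambda>x. (w x)\<^sup>2)"
    and iz: "set_integrable lebesgue (ball x r) (\<lambda>x. (norm (z x))\<^sup>2)"
    and r: "0 < r" and d: "0 < d" "ball y d \<subseteq> ball x r" and \<kappa>: "\<And>q. q \<in> ball y d \<Longrightarrow> \<bar>w q\<bar> \<le> \<kappa>"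
  shows "(LINT q:ball x r|lebesgue. (w q)\<^sup>2)
    \<le> (2 * r / d) ^ DIM('a) * (8 * r\<^sup>2 * (LINT q:ball x r|lebesgue. (norm (z q))\<^sup>2))
      + 2 * \<kappa>\<^sup>2 * (unit_ball_vol (real DIM('a)) * r ^ DIM('a))"
proof -
  define m where "m = unit_ball_vol (real DIM('a)) * d ^ DIM('a)"
  have m: "0 < m" using d by (simp add: m_def)
  have md: "measure lebesgue (ball y d) = m" using d by (simp add: m_def content_ball)
  have "{q \<in> ball y d. dist p q < 2 * r \<and> \<bar>w q\<bar> \<le> \<kappa>} = ball y d" if "p \<in> ball x r" for p
  proof -
    have "dist p q < 2 * r" if "q \<in> ball x r" for q
      using \<open>p \<in> ball x r\<close> that dist_triangle2[of p q x] by (simp add: dist_commute)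
    then show ?thesis using d \<kappa> by auto
  qed
  then have "m * (LINT q:ball x r|lebesgue. (w q)\<^sup>2) \<le> measure lebesgue (ball (0::'a) (2 * r)) * (2 * (2 * r)\<^sup>2 * (LINT q:ball x r|lebesgue. (norm (z q))\<^sup>2))
     + 2 * \<kappa>\<^sup>2 * (measure lebesgue (ball y d) * measure lebesgue (ball x r))"
    using m md d by (intro Poincare_ball[OF wz iw iz]) auto
  also have "\<dots> = m * ((2 * r / d) ^ DIM('a) * (8 * r\<^sup>2 * (LINT q:ball x r|lebesgue. (norm (z q))\<^sup>2))
      + 2 * \<kappa>\<^sup>2 * (unit_ball_vol (real DIM('a)) * r ^ DIM('a)))"
  proof -
    have "measure lebesgue (ball (0::'a) (2 * r)) = m * (2 * r / d) ^ DIM('a)"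
      using r d by (simp add: content_ball m_def power_divide)
    moreover have "measure lebesgue (ball x r) = unit_ball_vol (real DIM('a)) * r ^ DIM('a)"
      using r by (simp add: content_ball)
    ultimately show ?thesis unfolding md by (simp add: distrib_left power2_eq_square)
  qed
  finally show ?thesis using m by (simp only: mult_le_cancel_left_pos)
qed

section \<open>Nondegeneracy in mean square\<close>

lemma integrable_imp_set_integrable_ball:
  fixes f :: "'a::euclidean_space \<Rightarrow> real"
  assumes "integrable lebesgue f"
  shows "set_integrable lebesgue (ball y R) f"
  using integrable_mult_indicator[OF _ assms, of "ball y R"] by (simp add: set_integrable_def)

lemma pos_part_square_integrable:
  fixes u :: "'a::euclidean_space \<Rightarrow> real"
  assumes u: "u \<in> W12" and v: "has_weak_gradient u v" "integrable lebesgue (\<lambda>x. (norm (v x))\<^sup>2)"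
  shows "set_integrable lebesgue (ball y R) (\<lambda>x. (max 0 (u x))\<^sup>2)"
    and "set_integrable lebesgue (ball y R) (\<lambda>x. (norm (if 0 < u x then v x else 0))\<^sup>2)"
proof -
  have uW: "u \<in> borel_measurable lebesgue" "\<And>K. compact K \<Longrightarrow> set_integrable lebesgue K (\<lambda>x. (u x)\<^sup>2)"
    using u by (auto simp: W12_def)
  have "integrable lebesgue (\<lambda>x. (max 0 (u x))\<^sup>2 * indicator (ball y R) x)"
    by (rule integrable_square_mult[OF uW, where M = 1 and y = y and R = R]) (auto simp: indicator_def)
  then show "set_integrable lebesgue (ball y R) (\<lambda>x. (max 0 (u x))\<^sup>2)"
    by (simp add: set_integrable_def mult.commute)
  have [measurable]: "u \<in> borel_measurable lebesgue" "v \<in> borel_measurable lebesgue"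
    using has_weak_gradient_measurable[OF v(1)] by auto
  show "set_integrable lebesgue (ball y R) (\<lambda>x. (norm (if 0 < u x then v x else 0))\<^sup>2)"
  proof (rule integrable_imp_set_integrable_ball)
    show "integrable lebesgue (\<lambda>x. (norm (if 0 < u x then v x else 0))\<^sup>2)"
      by (rule Bochner_Integration.integrable_bound[OF v(2)]) auto
  qed
qed

lemma set_integral_ball_mono:
  fixes f :: "'a::euclidean_space \<Rightarrow> real"
  assumes "set_integrable lebesgue (ball x r) f" "ball y d \<subseteq> ball x r" "\<And>q. 0 \<le> f q"
  shows "(LINT q:ball y d|lebesgue. f q) \<le> (LINT q:ball x r|lebesgue. f q)"
  unfolding set_lebesgue_integral_def
proof (rule integral_mono)
  show "integrable lebesgue (\<lambda>q. indicator (ball y d) q *\<^sub>R f q)"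
    using set_integrable_subset[OF assms(1) _ assms(2)] by (simp add: set_integrable_def)
  show "indicator (ball y d) q *\<^sub>R f q \<le> indicator (ball x r) q *\<^sub>R f q" for q
    using assms(2,3) by (auto simp: indicator_def)
qed (use assms(1) in \<open>simp add: set_integrable_def\<close>)

lemma set_integral_nonneg_ball:
  fixes f :: "'a::euclidean_space \<Rightarrow> real"
  assumes "\<And>q. 0 \<le> f q"
  shows "0 \<le> (LINT q:ball y d|lebesgue. f q)"
  unfolding set_lebesgue_integral_def
  by (rule Bochner_Integration.integral_nonneg) (use assms in auto)

text \<open>
Apply \<open>De_Giorgi_iteration\<close> to balls with radii decreasing from \<open>r / 2\<close> to \<open>r / 4\<close>. The conclusion that
the volume of the positivity set tends to \<open>0\<close> contradicts the fact that it is a nonempty open set even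
in the limit ball. The same fact supplies the positive measure required by the nondegeneracy condition;
the upper bound on the measure holds as a ball of radius \<open>r / 2\<close> fits into a cube of side \<open>r\<close>.
\<close>
lemma L2_nondegeneracy:
  fixes lam Mf Mg :: real
  assumes lam: "0 < lam" and Mf0: "0 \<le> Mf" and Mg0: "0 \<le> Mg"
  obtains \<eta> where "0 < \<eta>"
    "\<And>N (\<Omega> :: 'a::euclidean_space set) f g F u W eps v y r.
      1 \<le> N \<Longrightarrow> \<Omega> \<in> sets borel \<Longrightarrow> lower_order_converges N \<Omega> f g \<Longrightarrow> is_minimizer N \<Omega> f g F u W \<Longrightarrow>
      (AE x in lebesgue. x \<in> \<Omega> \<longrightarrow> \<bar>f 1 x\<bar> \<le> Mf) \<Longrightarrow> (AE x in lebesgue. x \<in> \<Omega> \<longrightarrow> \<bar>g 1 x\<bar> \<le> Mg) \<Longrightarrow>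
      nondegenerate N F W lam eps \<Longrightarrow>
      has_weak_gradient (u 1) v \<Longrightarrow> integrable lebesgue (\<lambda>x. (norm (v x))\<^sup>2) \<Longrightarrow>
      0 < r \<Longrightarrow> r \<le> 1 \<Longrightarrow> r ^ DIM('a) \<le> eps \<Longrightarrow> continuous_on (ball y (r / 2)) (u 1) \<Longrightarrow>
      (\<And>\<rho>. 0 < \<rho> \<Longrightarrow> \<exists>z\<in>ball y \<rho>. 0 < u 1 z) \<Longrightarrow>
      \<eta> * r ^ (DIM('a) + 2) < (LINT z:ball y (r / 2)|lebesgue. (max 0 (u 1 z))\<^sup>2)"
proof -
  define n where "n = DIM('a)"
  have n: "1 \<le> n" by (simp add: n_def Suc_leI)
  obtain L where L: "0 < L" "\<And>(y::'a) \<rho> R. 0 < \<rho> \<Longrightarrow> \<rho> < R \<Longrightarrow>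
    \<exists>\<psi> G. test_function \<psi> \<and> (\<forall>x. GDERIV \<psi> x :> G x) \<and> (\<forall>x. 0 \<le> \<psi> x \<and> \<psi> x \<le> 1) \<and>
      (\<forall>x\<in>ball y \<rho>. \<psi> x = 1) \<and> (\<forall>x. x \<notin> ball y R \<longrightarrow> \<psi> x = 0 \<and> G x = 0) \<and>
      (\<forall>x. norm (G x) \<le> L / (R - \<rho>))"
    by (rule smooth_cutoff[where 'a = 'a]) blast
  define om where "om = unit_ball_vol (real n)"
  have om: "0 < om" by (simp add: om_def)
  \<comment> \<open>\<open>768 = 12 * 8\<^sup>2\<close>: the factor of the Caccioppoli inequality,
    for gaps \<open>r / 8 / 2 ^ k\<close> between the radii\<close>
  define D0 where "D0 = 768 * L\<^sup>2 + Mf + Mg"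
  define D where "D = (2 + 1 / lam) * D0"
  define B :: real where "B = 2 ^ (n + 2)"
  define c where "c = om / 2 ^ (n + 1)"
  have D0: "0 < D0" using L(1) Mf0 Mg0 by (simp add: D0_def add_pos_nonneg)
  have pos: "0 < D" "0 < B" "0 < c" using D0 lam om by (auto simp: D_def B_def c_def add_pos_pos)
  obtain \<eta> where \<eta>: "0 < \<eta>"
    "\<And>\<alpha> \<beta> \<gamma> :: nat \<Rightarrow> real. (\<And>k. 0 \<le> \<alpha> k) \<Longrightarrow> (\<And>k. 0 \<le> \<beta> k) \<Longrightarrow> (\<And>k. 0 \<le> \<gamma> k) \<Longrightarrow>
      \<alpha> 0 \<le> 1 \<Longrightarrow> \<beta> 0 \<le> \<eta> \<Longrightarrow>
      (\<And>k \<theta>. 0 < \<theta> \<Longrightarrow> \<theta> \<le> 1 \<Longrightarrow> \<gamma> (Suc k) + \<alpha> (Suc k) \<le> D * 4 ^ k * (\<beta> k / \<theta> + \<theta> * \<alpha> k)) \<Longrightarrow>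
      (\<And>k \<tau>. 0 < \<tau> \<Longrightarrow> \<tau> \<le> 1/4 \<Longrightarrow> \<alpha> (Suc k) \<le> c * \<tau> ^ n \<Longrightarrow> \<beta> (Suc k) \<le> B * \<tau>\<^sup>2 * \<gamma> (Suc k)) \<Longrightarrow>
      \<alpha> \<longlonglongrightarrow> 0"
    using De_Giorgi_iteration[OF n pos] by metis
  have main: "\<eta> * r ^ (n + 2) < (LINT z:ball y (r / 2)|lebesgue. (max 0 (u 1 z))\<^sup>2)"
    if N: "1 \<le> N" and \<Omega>: "\<Omega> \<in> sets borel" and conv: "lower_order_converges N \<Omega> f g"
      and min: "is_minimizer N \<Omega> f g F u W"
      and Mf: "AE x in lebesgue. x \<in> \<Omega> \<longrightarrow> \<bar>f 1 x\<bar> \<le> Mf" and Mg: "AE x in lebesgue. x \<in> \<Omega> \<longrightarrow> \<bar>g 1 x\<bar> \<le> Mg"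
      and nd: "nondegenerate N F W lam eps"
      and v: "has_weak_gradient (u 1) v" "integrable lebesgue (\<lambda>x. (norm (v x))\<^sup>2)"
      and r: "0 < r" "r \<le> 1" and eps: "r ^ n \<le> eps" and cont: "continuous_on (ball y (r / 2)) (u 1)"
      and near: "\<And>\<rho>. 0 < \<rho> \<Longrightarrow> \<exists>z\<in>ball y \<rho>. 0 < u 1 z"
    for N and \<Omega> :: "'a set" and f g F u W eps v y r
  proof (rule ccontr)
    assume "\<not> ?thesis"
    then have small: "(LINT z:ball y (r / 2)|lebesgue. (max 0 (u 1 z))\<^sup>2) \<le> \<eta> * r ^ (n + 2)" by simp
    have uW: "u 1 \<in> W12" using min N by (auto simp: is_minimizer_def admissible_def)
    have um: "u 1 \<in> borel_measurable lebesgue" using has_weak_gradient_measurable[OF v(1)] by simp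
    define w where "w z = max 0 (u 1 z)" for z
    define V where "V z = (if 0 < u 1 z then v z else 0)" for z
    have wV: "has_weak_gradient w V"
      unfolding w_def[abs_def] V_def[abs_def] by (rule has_weak_gradient_pos_part[OF v(1)])
    have iw: "set_integrable lebesgue (ball y R) (\<lambda>x. (w x)\<^sup>2)" for R
      using pos_part_square_integrable(1)[OF uW v] by (simp add: w_def)
    have iV: "set_integrable lebesgue (ball y R) (\<lambda>x. (norm (V x))\<^sup>2)" for R
      using pos_part_square_integrable(2)[OF uW v] by (simp add: V_def)
    have wpos: "0 < w z \<longleftrightarrow> 0 < u 1 z" for z by (auto simp: w_def max_def)
    define R where "R k = r / 4 + r / 4 / 2 ^ k" for k :: nat
    have R: "0 < R k" "R k \<le> r / 2" "r / 4 < R k" "R (Suc k) < R k" "R k - R (Suc k) = r / 8 / 2 ^ k" for k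
    proof -
      have "r / 4 / 2 ^ k \<le> r / 4" "0 < r / 4 / 2 ^ k" using r by (auto simp: field_simps)
      then show "0 < R k" "R k \<le> r / 2" "r / 4 < R k" using r unfolding R_def by linarith+
      show "R k - R (Suc k) = r / 8 / 2 ^ k" by (simp add: R_def field_simps)
      then show "R (Suc k) < R k" using r by (smt (verit) divide_pos_pos zero_less_power)
    qed
    define S where "S t = {z \<in> ball y t. 0 < u 1 z}" for t
    have Sm: "S t \<in> lmeasurable" for t
      unfolding S_def by (rule lmeasurable_ball_Collect[OF um]) measurable
    have So: "open (S t)" if "t \<le> r / 2" for t
    proof -
      have "continuous_on (ball y t) (u 1)" using that by (intro continuous_on_subset[OF cont]) auto
      from continuous_open_preimage[OF this open_ball, of "{0<..}"] show ?thesis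
        by (simp add: S_def vimage_def Int_def)
    qed
    have Spos: "0 < measure lebesgue (S t)" if t: "0 < t" "t \<le> r / 2" for t
    proof -
      obtain z where z: "z \<in> S t" using near[OF t(1)] by (auto simp: S_def)
      have "\<not> negligible (S t)" using So[OF t(2)] z open_not_negligible by blast
      then show ?thesis using Sm[of t] by (simp add: negligible_iff_measure zero_less_measure_iff)
    qed
    have Smono: "measure lebesgue (S t) \<le> measure lebesgue (S t')" if "t \<le> t'" for t t'
      by (rule measure_mono_fmeasurable) (use that Sm in \<open>auto simp: S_def\<close>)
    have Sle: "measure lebesgue (S t) \<le> r ^ n" if "t \<le> r / 2" for t
    proof -
      have "measure lebesgue (S t) \<le> measure lebesgue (ball y (r / 2))"
        by (rule measure_mono_fmeasurable) (use that Sm in \<open>auto simp: S_def\<close>)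
      also have "\<dots> \<le> (2 * (r / 2)) ^ DIM('a)" using r by (intro measure_ball_le_cube) simp
      finally show ?thesis by (simp add: n_def)
    qed
    have rn: "0 < r ^ n" "0 < r ^ (n + 2)" using r by auto
    define \<alpha> where "\<alpha> k = measure lebesgue (S (R k)) / r ^ n" for k
    define \<beta> where "\<beta> k = (LINT z:ball y (R k)|lebesgue. (w z)\<^sup>2) / r ^ (n + 2)" for k
    define \<gamma> where "\<gamma> k = (LINT z:ball y (R k)|lebesgue. (norm (V z))\<^sup>2) / r ^ n" for k
    have mS: "measure lebesgue (S (R k)) = \<alpha> k * r ^ n" for k using r by (simp add: \<alpha>_def)
    have Iw: "(LINT z:ball y (R k)|lebesgue. (w z)\<^sup>2) = \<beta> k * r ^ (n + 2)" for k using r by (simp add: \<beta>_def)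
    have IV: "(LINT z:ball y (R k)|lebesgue. (norm (V z))\<^sup>2) = \<gamma> k * r ^ n" for k using r by (simp add: \<gamma>_def)
    have nonneg: "0 \<le> \<alpha> k" "0 \<le> \<beta> k" "0 \<le> \<gamma> k" for k
      using rn set_integral_nonneg_ball[of "\<lambda>z. (w z)\<^sup>2"] set_integral_nonneg_ball[of "\<lambda>z. (norm (V z))\<^sup>2"]
      by (auto simp: \<alpha>_def \<beta>_def \<gamma>_def)
    have "\<alpha> \<longlonglongrightarrow> 0"
    proof (rule \<eta>(2)[of \<alpha> \<beta> \<gamma>])
      show "\<alpha> 0 \<le> 1" using Sle[OF R(2)[of 0]] rn by (simp add: \<alpha>_def)
      have R0: "R 0 = r / 2" by (simp add: R_def)
      show "\<beta> 0 \<le> \<eta>" using small r unfolding \<beta>_def w_def R0 by (simp add: divide_le_eq)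
      fix k
      show "\<gamma> (Suc k) + \<alpha> (Suc k) \<le> D * 4 ^ k * (\<beta> k / \<theta> + \<theta> * \<alpha> k)" if \<theta>: "0 < \<theta>" "\<theta> \<le> 1" for \<theta>
      proof -
        obtain \<psi> G where \<psi>: "test_function \<psi>" "\<And>x. GDERIV \<psi> x :> G x" "\<And>x. 0 \<le> \<psi> x" "\<And>x. \<psi> x \<le> 1"
          "\<And>x. x \<in> ball y (R (Suc k)) \<Longrightarrow> \<psi> x = 1" "\<And>x. x \<notin> ball y (R k) \<Longrightarrow> \<psi> x = 0"
          "\<And>x. x \<notin> ball y (R k) \<Longrightarrow> G x = 0" "\<And>x. norm (G x) \<le> L / (R k - R (Suc k))"
          using L(2)[OF R(1)[of "Suc k"] R(4)[of k], of y] by blast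
        have "(LINT x:ball y (R (Suc k))|lebesgue. (norm (if 0 < u 1 x then v x else 0))\<^sup>2) / 2
            + lam * measure lebesgue {z \<in> ball y (R (Suc k)). 0 < u 1 z}
          \<le> (12 * (L / (R k - R (Suc k)))\<^sup>2 + Mf) * (LINT x:ball y (R k)|lebesgue. (max 0 (u 1 x))\<^sup>2)
            + Mg * (LINT x:ball y (R k)|lebesgue. max 0 (u 1 x))"
        proof (rule Caccioppoli_nondegenerate[OF N \<Omega> conv min Mf Mf0 Mg Mg0 nd v])
          show "continuous_on (ball y (R (Suc k))) (u 1)"
            using R(2)[of "Suc k"] by (intro continuous_on_subset[OF cont]) auto
          show "0 < measure lebesgue {z \<in> ball y (R (Suc k)). 0 < u 1 z}"
            using Spos[OF R(1) R(2)] unfolding S_def .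
          show "measure lebesgue {z \<in> ball y (R (Suc k)). 0 < u 1 z} \<le> eps"
            using order_trans[OF Sle[OF R(2)] eps] unfolding S_def .
        qed (fact \<psi>)+
        then have cac: "\<gamma> (Suc k) * r ^ n / 2 + lam * (\<alpha> (Suc k) * r ^ n)
          \<le> (12 * (L / (R k - R (Suc k)))\<^sup>2 + Mf) * (\<beta> k * r ^ (n + 2)) + Mg * (LINT x:ball y (R k)|lebesgue. w x)"
          unfolding V_def[symmetric] w_def[symmetric] S_def[symmetric] mS Iw IV by simp
        have q: "12 * (L / (R k - R (Suc k)))\<^sup>2 = 768 * L\<^sup>2 * 4 ^ k / r\<^sup>2"
          unfolding R(5) using r by (simp add: power_divide power_mult_distrib power2_eq_square mult_ac flip: power_mult_distrib)
        have lin: "(LINT x:ball y (R k)|lebesgue. w x) \<le> r * (\<beta> k / \<theta> + \<theta> * \<alpha> k) * r ^ n"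
        proof -
          have "(LINT x:ball y (R k)|lebesgue. w x)
            \<le> (LINT x|lebesgue. (1 / (r * \<theta>)) * (indicator (ball y (R k)) x *\<^sub>R (w x)\<^sup>2) + (r * \<theta>) * indicator (S (R k)) x)"
            unfolding set_lebesgue_integral_def
          proof (rule integral_mono')
            show "integrable lebesgue (\<lambda>x. (1 / (r * \<theta>)) * (indicator (ball y (R k)) x *\<^sub>R (w x)\<^sup>2) + (r * \<theta>) * indicator (S (R k)) x)"
              using iw[of "R k"] Sm[of "R k"]
              by (intro Bochner_Integration.integrable_add integrable_mult_right)
                (auto simp: set_integrable_def fmeasurable_def)
            show "indicator (ball y (R k)) x *\<^sub>R w x \<le> (1 / (r * \<theta>)) * (indicator (ball y (R k)) x *\<^sub>R (w x)\<^sup>2) + (r * \<theta>) * indicator (S (R k)) x" for x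
            proof (cases "x \<in> S (R k)")
              case True
              define a b where "a = w x" and "b = r * \<theta>"
              have b: "0 < b" using r \<theta> by (simp add: b_def)
              \<comment> \<open>on the positivity set \<open>w \<le> w\<^sup>2 / b + b\<close>,
                which trades the linear term for mean square and volume\<close>
              have "a * b \<le> a\<^sup>2 + b\<^sup>2"
                using zero_le_power2[of "a - b"] zero_le_power2[of a] zero_le_power2[of b] unfolding power2_diff by linarith
              then have "a \<le> (1 / b) * a\<^sup>2 + b" using b by (simp add: field_simps power2_eq_square)
              then show ?thesis using True by (simp add: a_def b_def S_def)
            next
              case False
              then show ?thesis by (auto simp: S_def indicator_def w_def)
            qed
            show "0 \<le> (1 / (r * \<theta>)) * (indicator (ball y (R k)) x *\<^sub>R (w x)\<^sup>2) + (r * \<theta>) * indicator (S (R k)) x" for x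
              using r \<theta> by auto
          qed
          also have "\<dots> = (1 / (r * \<theta>)) * (\<beta> k * r ^ (n + 2)) + (r * \<theta>) * (\<alpha> k * r ^ n)"
            using iw[of "R k"] Sm[of "R k"] unfolding Iw[symmetric] mS[symmetric]
            by (subst Bochner_Integration.integral_add)
              (auto simp: set_integrable_def set_lebesgue_integral_def fmeasurable_def)
          also have "\<dots> = r * (\<beta> k / \<theta> + \<theta> * \<alpha> k) * r ^ n"
            using r \<theta> by (simp add: field_simps power2_eq_square)
          finally show ?thesis .
        qed
        define X where "X = \<beta> k / \<theta> + \<theta> * \<alpha> k"
        have X0: "0 \<le> X" using nonneg \<theta> by (simp add: X_def)
        have bX: "\<beta> k \<le> X"
        proof -
          have "\<beta> k * 1 \<le> \<beta> k * (1 / \<theta>)" using nonneg \<theta> by (intro mult_left_mono) auto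
          moreover have "0 \<le> \<theta> * \<alpha> k" using nonneg \<theta> by simp
          ultimately show ?thesis by (simp add: X_def)
        qed
        have k1: "(1::real) \<le> 4 ^ k" by simp
        have "\<gamma> (Suc k) * r ^ n / 2 + lam * (\<alpha> (Suc k) * r ^ n)
          \<le> (768 * L\<^sup>2 * 4 ^ k / r\<^sup>2 + Mf) * (\<beta> k * r ^ (n + 2)) + Mg * (r * X * r ^ n)"
          using cac mult_left_mono[OF lin Mg0] unfolding q X_def[symmetric] by linarith
        also have "\<dots> = (768 * L\<^sup>2 * 4 ^ k * \<beta> k + Mf * r\<^sup>2 * \<beta> k + Mg * r * X) * r ^ n"
          using r by (simp add: field_simps power2_eq_square)
        also have "\<dots> \<le> (D0 * 4 ^ k * X) * r ^ n"
        proof (intro mult_right_mono)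
          have "768 * L\<^sup>2 * 4 ^ k * \<beta> k \<le> 768 * L\<^sup>2 * 4 ^ k * X" using bX by (intro mult_left_mono) auto
          moreover have "Mf * r\<^sup>2 * \<beta> k \<le> Mf * 4 ^ k * X"
          proof (intro mult_mono bX)
            have "r\<^sup>2 \<le> 1" using r by (simp add: power_le_one)
            then show "r\<^sup>2 \<le> 4 ^ k" using k1 by linarith
          qed (use Mf0 nonneg in auto)
          moreover have "Mg * r * X \<le> Mg * 4 ^ k * X"
            using Mg0 X0 order_trans[OF r(2) k1] by (intro mult_right_mono mult_left_mono) auto
          ultimately show "768 * L\<^sup>2 * 4 ^ k * \<beta> k + Mf * r\<^sup>2 * \<beta> k + Mg * r * X \<le> D0 * 4 ^ k * X"
            unfolding D0_def by (simp add: distrib_right)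
        qed (use rn in auto)
        finally have "(\<gamma> (Suc k) / 2 + lam * \<alpha> (Suc k)) * r ^ n \<le> (D0 * 4 ^ k * X) * r ^ n"
          by (simp add: distrib_right)
        then have both: "\<gamma> (Suc k) / 2 + lam * \<alpha> (Suc k) \<le> D0 * 4 ^ k * X" using rn by simp
        moreover have "0 \<le> lam * \<alpha> (Suc k)" using lam nonneg by simp
        ultimately have 1: "\<gamma> (Suc k) \<le> 2 * (D0 * 4 ^ k * X)" "lam * \<alpha> (Suc k) \<le> D0 * 4 ^ k * X"
          using nonneg(3)[of "Suc k"] by linarith+
        then have "\<alpha> (Suc k) \<le> 1 / lam * (D0 * 4 ^ k * X)" using lam by (simp add: field_simps)
        then show ?thesis using 1(1) unfolding D_def X_def[symmetric] by (simp add: distrib_right mult.assoc)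
      qed
      show "\<beta> (Suc k) \<le> B * \<tau>\<^sup>2 * \<gamma> (Suc k)" if \<tau>: "0 < \<tau>" "\<tau> \<le> 1/4" and le: "\<alpha> (Suc k) \<le> c * \<tau> ^ n" for \<tau>
      proof -
        have "(LINT x:ball y (R (Suc k))|lebesgue. (w x)\<^sup>2)
          \<le> 2 ^ (DIM('a) + 2) * (\<tau> * r)\<^sup>2 * (LINT x:ball y (R (Suc k))|lebesgue. (norm (V x))\<^sup>2)"
        proof (rule Faber_Krahn_ball[OF wV _ iw iV])
          show "0 \<le> w x" for x by (simp add: w_def)
          show "0 < \<tau> * r" using \<tau> r by simp
          have "\<tau> * r \<le> 1 / 4 * r" using \<tau> r by (intro mult_right_mono) auto
          then show "\<tau> * r \<le> R (Suc k)" using R(3)[of "Suc k"] by linarith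
          have "\<alpha> (Suc k) * r ^ n \<le> c * \<tau> ^ n * r ^ n" using le rn by (intro mult_right_mono) auto
          then show "measure lebesgue {q \<in> ball y (R (Suc k)). 0 < w q}
             \<le> unit_ball_vol (real DIM('a)) * (\<tau> * r) ^ DIM('a) / 2 ^ (DIM('a) + 1)"
            unfolding wpos S_def[symmetric] mS by (simp add: c_def om_def n_def power_mult_distrib)
        qed
        then have "\<beta> (Suc k) * r ^ (n + 2) \<le> (B * \<tau>\<^sup>2 * \<gamma> (Suc k)) * r ^ (n + 2)"
          unfolding Iw IV by (simp add: B_def n_def power_mult_distrib power_add power2_eq_square mult_ac)
        then show ?thesis using rn(2) by (simp only: mult_le_cancel_right_pos)
      qed
    qed (use nonneg in auto)
    moreover have "measure lebesgue (S (r / 4)) / r ^ n \<le> \<alpha> k" for k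
      unfolding \<alpha>_def using Smono[of "r / 4" "R k"] R(3)[of k] rn by (intro divide_right_mono) auto
    ultimately have "measure lebesgue (S (r / 4)) / r ^ n \<le> 0"
      by (intro LIMSEQ_le_const) auto
    then show False using Spos[of "r / 4"] r rn by (simp add: divide_le_0_iff)
  qed
  show ?thesis
    by (rule that[OF \<eta>(1)]) (use main in \<open>simp add: n_def\<close>)
qed

section \<open>Nondegeneracy of the gradient\<close>

text \<open>
Boundedness makes the essential supremum finite, so that its conversion to a real number loses
nothing.
\<close>
lemma Linf_norm_bound:
  fixes h :: "'a::euclidean_space \<Rightarrow> real"
  assumes \<Omega>: "\<Omega> \<in> sets borel" and h: "h \<in> borel_measurable (lebesgue_on \<Omega>)" and b: "bounded (h ` \<Omega>)"
  shows "AE x in lebesgue. x \<in> \<Omega> \<longrightarrow> \<bar>h x\<bar> \<le> Linf_norm \<Omega> h"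
proof -
  obtain M where M: "\<And>x. x \<in> \<Omega> \<Longrightarrow> \<bar>h x\<bar> \<le> M" using b by (auto simp: bounded_iff)
  define s where "s = esssup (lebesgue_on \<Omega>) (\<lambda>x. ennreal \<bar>h x\<bar>)"
  have sM: "s \<le> ennreal M"
    unfolding s_def using M h by (intro esssup_I) (auto intro!: AE_I2 ennreal_leI)
  have s: "s \<noteq> top" by (rule neq_top_trans[OF ennreal_neq_top sM])
  have "AE x in lebesgue_on \<Omega>. ennreal \<bar>h x\<bar> \<le> s" unfolding s_def by (rule esssup_AE)
  then have "AE x in lebesgue. x \<in> \<Omega> \<longrightarrow> ennreal \<bar>h x\<bar> \<le> s"
    using \<Omega> by (subst (asm) AE_restrict_space_iff) auto
  then show ?thesis
  proof eventually_elim
    case (elim x)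
    show ?case
    proof
      assume "x \<in> \<Omega>"
      then have "enn2real (ennreal \<bar>h x\<bar>) \<le> enn2real s"
        using elim s by (intro enn2real_mono) (auto simp: less_top)
      then show "\<bar>h x\<bar> \<le> Linf_norm \<Omega> h" by (simp add: Linf_norm_def s_def)
    qed
  qed
qed

theorem theorem15p2:
  fixes lam Mf Mg C0 :: real
  assumes "2 \<le> CARD('n::finite)" and "0 < lam" and "0 < C0"
  shows "\<exists>c3>0. \<forall>(N::nat) (\<Omega>::(real^'n) set) f g F u W (eps::real) x r.
    1 \<le> N \<and>
    \<Omega> \<in> sets borel \<and> emeasure lebesgue \<Omega> < \<infinity> \<and>
    (\<forall>i\<in>{1..N}. f i \<in> borel_measurable (lebesgue_on \<Omega>) \<and>
                g i \<in> borel_measurable (lebesgue_on \<Omega>)) \<and>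
    lower_order_converges N \<Omega> f g \<and>
    is_minimizer N \<Omega> f g F u W \<and>
    bounded (f 1 ` \<Omega>) \<and> Linf_norm \<Omega> (f 1) = Mf \<and>
    bounded (g 1 ` \<Omega>) \<and> Linf_norm \<Omega> (g 1) = Mg \<and>
    0 < eps \<and> nondegenerate N F W lam eps \<and>
    0 < r \<and> (\<forall>i\<in>{1..N}. continuous_on (ball x r) (u i)) \<and>
    r \<le> min 1 (root CARD('n) eps) \<and>
    (\<exists>y \<in> ball x (r/2) \<inter> frontier (pos_set \<Omega> (u 1)). u 1 y = 0) \<and>
    (C0-lipschitz_on (ball x r) (u 1) \<or>
     measure lebesgue (ball x r - pos_set \<Omega> (u 1)) \<ge> inverse C0 * r ^ CARD('n))
    \<longrightarrow>
    1 / measure lebesgue (ball x r) *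
      (LINT y:ball x r|lebesgue. (norm (weak_grad (\<lambda>z. max 0 (u 1 z)) y))\<^sup>2) \<ge> c3"
proof -
  note lam = assms(2) and C0 = assms(3)
  define n where "n = CARD('n)"
  have n: "DIM(real^'n) = n" "0 < n" by (simp_all add: n_def)
  define om where "om = unit_ball_vol (real n)"
  have om: "0 < om" by (simp add: om_def)
  obtain \<eta> where \<eta>: "0 < \<eta>"
    "\<And>N (\<Omega> :: (real^'n) set) f g F u W eps v y r.
      1 \<le> N \<Longrightarrow> \<Omega> \<in> sets borel \<Longrightarrow> lower_order_converges N \<Omega> f g \<Longrightarrow> is_minimizer N \<Omega> f g F u W \<Longrightarrow>
      (AE x in lebesgue. x \<in> \<Omega> \<longrightarrow> \<bar>f 1 x\<bar> \<le> \<bar>Mf\<bar>) \<Longrightarrow> (AE x in lebesgue. x \<in> \<Omega> \<longrightarrow> \<bar>g 1 x\<bar> \<le> \<bar>Mg\<bar>) \<Longrightarrow>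
      nondegenerate N F W lam eps \<Longrightarrow>
      has_weak_gradient (u 1) v \<Longrightarrow> integrable lebesgue (\<lambda>x. (norm (v x))\<^sup>2) \<Longrightarrow>
      0 < r \<Longrightarrow> r \<le> 1 \<Longrightarrow> r ^ n \<le> eps \<Longrightarrow> continuous_on (ball y (r / 2)) (u 1) \<Longrightarrow>
      (\<And>\<rho>. 0 < \<rho> \<Longrightarrow> \<exists>z\<in>ball y \<rho>. 0 < u 1 z) \<Longrightarrow>
      \<eta> * r ^ (n + 2) < (LINT z:ball y (r / 2)|lebesgue. (max 0 (u 1 z))\<^sup>2)"
    by (rule L2_nondegeneracy[where 'a = "real^'n", OF lam abs_ge_zero[of Mf] abs_ge_zero[of Mg],
          unfolded n(1)]) blast
  \<comment> \<open>first \<open>\<delta>\<close> makes the error term of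
    \<open>Poincare_small_ball\<close> at most half of \<open>\<eta>\<close>; then \<open>c3\<close>
    handles the energy terms of the two cases\<close>
  define \<delta> where "\<delta> = min (1 / 2) (\<eta> / (4 * C0\<^sup>2 * om))"
  have \<delta>: "0 < \<delta>" "\<delta> \<le> 1 / 2" "2 * C0\<^sup>2 * \<delta>\<^sup>2 * om \<le> \<eta> / 2"
  proof -
    show 1: "0 < \<delta>" "\<delta> \<le> 1 / 2" using \<eta>(1) C0 om by (auto simp: \<delta>_def)
    have "\<delta>\<^sup>2 \<le> \<delta>" using 1 by (simp add: power2_eq_square mult_left_le)
    also have "\<dots> \<le> \<eta> / (4 * C0\<^sup>2 * om)" by (simp add: \<delta>_def)
    finally show "2 * C0\<^sup>2 * \<delta>\<^sup>2 * om \<le> \<eta> / 2" using C0 om by (simp add: field_simps)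
  qed
  define c3 where "c3 = min (\<eta> / (C0 * 2 ^ (n + 3) * om\<^sup>2)) (\<eta> * \<delta> ^ n / (2 ^ (n + 4) * om))"
  have c3: "0 < c3" "C0 * 2 ^ (n + 3) * om\<^sup>2 * c3 \<le> \<eta>" "2 ^ (n + 4) * om * c3 \<le> \<eta> * \<delta> ^ n"
  proof -
    show "0 < c3" using \<eta>(1) C0 om \<delta> by (simp add: c3_def)
    have "c3 \<le> \<eta> / (C0 * 2 ^ (n + 3) * om\<^sup>2)" by (simp add: c3_def)
    then show "C0 * 2 ^ (n + 3) * om\<^sup>2 * c3 \<le> \<eta>" using C0 om by (simp add: field_simps)
    have "c3 \<le> \<eta> * \<delta> ^ n / (2 ^ (n + 4) * om)" by (simp add: c3_def)
    then show "2 ^ (n + 4) * om * c3 \<le> \<eta> * \<delta> ^ n" using om by (simp add: field_simps)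
  qed
  have "c3 \<le> 1 / measure lebesgue (ball x r) *
      (LINT y:ball x r|lebesgue. (norm (weak_grad (\<lambda>z. max 0 (u 1 z)) y))\<^sup>2)"
    if N: "1 \<le> N" and \<Omega>: "\<Omega> \<in> sets borel"
      and meas: "\<forall>i\<in>{1..N}. f i \<in> borel_measurable (lebesgue_on \<Omega>) \<and> g i \<in> borel_measurable (lebesgue_on \<Omega>)"
      and conv: "lower_order_converges N \<Omega> f g" and min: "is_minimizer N \<Omega> f g F u W"
      and f1: "bounded (f 1 ` \<Omega>)" "Linf_norm \<Omega> (f 1) = Mf" and g1: "bounded (g 1 ` \<Omega>)" "Linf_norm \<Omega> (g 1) = Mg"
      and eps: "0 < eps" and nd: "nondegenerate N F W lam eps" and r: "0 < r"
      and cont: "\<forall>i\<in>{1..N}. continuous_on (ball x r) (u i)" and rle: "r \<le> min 1 (root n eps)"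
      and bd: "\<exists>y \<in> ball x (r/2) \<inter> frontier (pos_set \<Omega> (u 1)). u 1 y = 0"
      and alt: "C0-lipschitz_on (ball x r) (u 1) \<or>
         measure lebesgue (ball x r - pos_set \<Omega> (u 1)) \<ge> inverse C0 * r ^ n"
    for N and \<Omega> :: "(real^'n) set" and f g F u W eps x r
  proof (rule ccontr)
    assume neg: "\<not> ?thesis"
    have one: "1 \<in> {1..N}" using N by simp
    have adm: "u 1 \<in> W12" "AE z in lebesgue. z \<notin> W 1 \<longrightarrow> u 1 z = 0" "W 1 \<subseteq> \<Omega>"
      using min one by (auto simp: is_minimizer_def admissible_def partitions_def)
    obtain v where v: "has_weak_gradient (u 1) v" "integrable lebesgue (\<lambda>x. (norm (v x))\<^sup>2)"
      using W12_weak_gradient[OF adm(1)] .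
    define w where "w z = max 0 (u 1 z)" for z
    define V where "V z = (if 0 < u 1 z then v z else 0)" for z
    have wV: "has_weak_gradient w V"
      unfolding w_def[abs_def] V_def[abs_def] by (rule has_weak_gradient_pos_part[OF v(1)])
    have iw: "set_integrable lebesgue (ball x r) (\<lambda>x. (w x)\<^sup>2)"
      using pos_part_square_integrable(1)[OF adm(1) v] by (simp add: w_def)
    have iV: "set_integrable lebesgue (ball x r) (\<lambda>x. (norm (V x))\<^sup>2)"
      using pos_part_square_integrable(2)[OF adm(1) v] by (simp add: V_def)
    define I where "I = (LINT y:ball x r|lebesgue. (norm (V y))\<^sup>2)"
    define Q where "Q = (LINT y:ball x r|lebesgue. (w y)\<^sup>2)"
    have "(LINT y:ball x r|lebesgue. (norm (weak_grad w y))\<^sup>2) = I"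
      unfolding I_def set_lebesgue_integral_def
    proof (rule integral_cong_AE)
      have "has_weak_gradient w (weak_grad w)"
        unfolding weak_grad_def by (rule someI[where P = "has_weak_gradient w", OF wV])
      then have [measurable]: "weak_grad w \<in> borel_measurable lebesgue" "V \<in> borel_measurable lebesgue"
        using has_weak_gradient_measurable(2) wV by auto
      have [measurable]: "ball x r \<in> sets lebesgue" by simp
      show "(\<lambda>y. indicator (ball x r) y *\<^sub>R (norm (weak_grad w y))\<^sup>2) \<in> borel_measurable lebesgue"
        "(\<lambda>y. indicator (ball x r) y *\<^sub>R (norm (V y))\<^sup>2) \<in> borel_measurable lebesgue" by measurable
      show "AE y in lebesgue. indicator (ball x r) y *\<^sub>R (norm (weak_grad w y))\<^sup>2 = indicator (ball x r) y *\<^sub>R (norm (V y))\<^sup>2"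
        using weak_grad_AE[OF wV] by eventually_elim simp
    qed
    moreover have vol: "measure lebesgue (ball x r) = om * r ^ n"
      using r content_ball[of r x] by (simp add: om_def n_def)
    ultimately have "1 / (om * r ^ n) * I < c3"
      using neg unfolding w_def[abs_def] by simp
    then have I: "I \<le> c3 * (om * r ^ n)" using om r by (simp add: field_simps)
    obtain y where y: "y \<in> ball x (r / 2)" "y \<in> frontier (pos_set \<Omega> (u 1))" "u 1 y = 0" using bd by auto
    have sub: "ball y d \<subseteq> ball x r" if "d \<le> r / 2" for d
    proof
      fix z assume "z \<in> ball y d"
      then show "z \<in> ball x r" using y(1) that dist_triangle[of x z y] by (simp add: dist_commute)
    qed
    have yr: "y \<in> ball x r" using y(1) r by simp
    have near: "\<exists>z\<in>ball y \<rho>. 0 < u 1 z" if \<rho>: "0 < \<rho>" for \<rho>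
    proof -
      have "y \<in> closure (pos_set \<Omega> (u 1))" using y(2) by (simp add: frontier_def)
      then obtain z where "z \<in> pos_set \<Omega> (u 1)" "dist z y < \<rho>"
        using \<rho> unfolding closure_approachable by blast
      then show ?thesis by (auto simp: pos_set_def dist_commute)
    qed
    have "r ^ n \<le> (root n eps) ^ n" using r rle by (intro power_mono) auto
    then have reps: "r ^ n \<le> eps" using n(2) eps by simp
    have big: "\<eta> * r ^ (n + 2) < Q"
    proof -
      have "\<eta> * r ^ (n + 2) < (LINT z:ball y (r / 2)|lebesgue. (max 0 (u 1 z))\<^sup>2)"
      proof (rule \<eta>(2)[OF N \<Omega> conv min _ _ nd v r _ reps _ near])
        show "AE x in lebesgue. x \<in> \<Omega> \<longrightarrow> \<bar>f 1 x\<bar> \<le> \<bar>Mf\<bar>"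
          using Linf_norm_bound[OF \<Omega> _ f1(1)] meas one unfolding f1(2)
          by (auto intro: order_trans[OF _ abs_ge_self] elim!: eventually_mono)
        show "AE x in lebesgue. x \<in> \<Omega> \<longrightarrow> \<bar>g 1 x\<bar> \<le> \<bar>Mg\<bar>"
          using Linf_norm_bound[OF \<Omega> _ g1(1)] meas one unfolding g1(2)
          by (auto intro: order_trans[OF _ abs_ge_self] elim!: eventually_mono)
        show "continuous_on (ball y (r / 2)) (u 1)"
          using cont one sub[of "r / 2"] continuous_on_subset by blast
      qed (use rle in auto)
      also have "\<dots> \<le> Q"
        unfolding Q_def w_def using iw by (intro set_integral_ball_mono sub) (auto simp: w_def)
      finally show ?thesis .
    qed
    have "Q \<le> \<eta> * r ^ (n + 2)"
      using alt
    proof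
      assume lip: "C0-lipschitz_on (ball x r) (u 1)"
      define d where "d = \<delta> * r"
      have d: "0 < d" "d \<le> r / 2" using \<delta> r by (auto simp: d_def)
      have "Q \<le> (2 * r / d) ^ n * (8 * r\<^sup>2 * I) + 2 * (C0 * d)\<^sup>2 * (om * r ^ n)"
        unfolding Q_def I_def om_def n(1)[symmetric]
      proof (rule Poincare_small_ball[OF wV iw iV r d(1) sub[OF d(2)]])
        fix q assume q: "q \<in> ball y d"
        have "dist (u 1 q) (u 1 y) \<le> C0 * dist q y"
          by (rule lipschitz_onD[OF lip]) (use q sub[OF d(2)] yr in auto)
        also have "\<dots> \<le> C0 * d" using q C0 by (intro mult_left_mono) (auto simp: dist_commute)
        finally show "\<bar>w q\<bar> \<le> C0 * d" using y(3) C0 d(1) by (auto simp: w_def dist_real_def)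
      qed
      also have "\<dots> \<le> (2 * r / d) ^ n * (8 * r\<^sup>2 * (c3 * (om * r ^ n))) + 2 * (C0 * d)\<^sup>2 * (om * r ^ n)"
        using I d r by (intro add_right_mono mult_left_mono) auto
      also have "\<dots> = (2 ^ (n + 4) * om * c3 / \<delta> ^ n / 2 + 2 * C0\<^sup>2 * \<delta>\<^sup>2 * om) * r ^ (n + 2)"
        using r \<delta>(1) by (simp add: d_def power_divide power_mult_distrib power_add field_simps power2_eq_square)
      also have "\<dots> \<le> (\<eta> / 2 + \<eta> / 2) * r ^ (n + 2)"
        using c3(3) \<delta> r by (intro mult_right_mono add_mono divide_right_mono) (auto simp: divide_le_eq)
      finally show ?thesis by simp
    next
      assume meas_b: "measure lebesgue (ball x r - pos_set \<Omega> (u 1)) \<ge> inverse C0 * r ^ n"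
      have um: "u 1 \<in> borel_measurable lebesgue" using has_weak_gradient_measurable[OF v(1)] by simp
      have "measure lebesgue (ball x r - pos_set \<Omega> (u 1)) = measure lebesgue {q \<in> ball x r. w q = 0}"
      proof (rule measure_eq_AE)
        show "AE q in lebesgue. q \<in> ball x r - pos_set \<Omega> (u 1) \<longleftrightarrow> q \<in> {q \<in> ball x r. w q = 0}"
          using adm(2) by eventually_elim (use adm(3) in \<open>auto simp: pos_set_def w_def max_def\<close>)
        have "{q \<in> ball x r. 0 < u 1 q} \<in> lmeasurable"
          by (rule lmeasurable_ball_Collect[OF um]) measurable
        then have "ball x r - (\<Omega> \<inter> {q \<in> ball x r. 0 < u 1 q}) \<in> sets lebesgue"
          using \<Omega> by (intro sets.Diff sets.Int) (auto dest: fmeasurableD)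
        moreover have "ball x r - pos_set \<Omega> (u 1) = ball x r - (\<Omega> \<inter> {q \<in> ball x r. 0 < u 1 q})"
          by (auto simp: pos_set_def)
        ultimately show "ball x r - pos_set \<Omega> (u 1) \<in> sets lebesgue" by simp
        have "{q \<in> ball x r. max 0 (u 1 q) = 0} \<in> lmeasurable"
          by (rule lmeasurable_ball_Collect[OF um]) measurable
        then show "{q \<in> ball x r. w q = 0} \<in> sets lebesgue" by (simp add: w_def fmeasurableD)
      qed
      then have "inverse C0 * r ^ n * Q \<le> om * (2 * r) ^ n * (8 * r\<^sup>2 * I)"
        unfolding Q_def I_def om_def
        using meas_b C0 r by (intro Poincare_zero_set[OF wV iw iV r, unfolded n(1)]) auto
      also have "\<dots> \<le> om * (2 * r) ^ n * (8 * r\<^sup>2 * (c3 * (om * r ^ n)))"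
        using I om r by (intro mult_left_mono) auto
      also have "\<dots> = inverse C0 * r ^ n * ((C0 * 2 ^ (n + 3) * om\<^sup>2 * c3) * r ^ (n + 2))"
        using C0 by (simp add: power_mult_distrib power_add power2_eq_square field_simps)
      finally have "Q \<le> (C0 * 2 ^ (n + 3) * om\<^sup>2 * c3) * r ^ (n + 2)"
        using C0 r by (subst (asm) mult_le_cancel_left_pos) auto
      also have "\<dots> \<le> \<eta> * r ^ (n + 2)" using c3(2) r by (intro mult_right_mono) auto
      finally show ?thesis .
    qed
    then show False using big by simp
  qed
  then show ?thesis
    using c3(1) unfolding n_def by (intro exI[of _ c3] conjI allI impI; (elim conjE)?) blast+
qed

end
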